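(* Consider the POD-reduced system with state $x_{\rm POD}$ and the POD-DEIM-reduced system with state $x_{\rm DEIM}$ (both defined in the context, with the same input $u$ and the same initial value), let $\varepsilon=x_{\rm POD}-x_{\rm DEIM}$, and let $\delta:[0,T]\to\mathbb{R}$ satisfy, for all $t\in[0,T]$, $$\delta(t)\ge\begin{cases}\dfrac{\|C\|\,\|\varepsilon(t)\|}{\|u(t)\|},&\text{if }\|u(t)\|\ne0,\\[2mm]0,&\text{if }\|u(t)\|=0.\end{cases}$$ Then the perturbed control system $$\tfrac{\rm d}{{\rm d}t}E\,x_{\rm DEIM}=F(x_{\rm DEIM})\,x_{\rm DEIM}+B\,u,\quad x_{\rm DEIM}(0)=x_{\rm DEIM,0},\qquad y_\delta=C\,x_{\rm DEIM}+\delta\,u$$ is input-output-passive.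
   Context: All spaces are real; $\|\cdot\|$ is the Euclidean vector norm and the spectral matrix norm. Domain and data. $\Omega\subset\mathbb{R}^3$ is a simply connected bounded Lipschitz domain, decomposed into a conducting subdomain $\Omega_C$ (connected, $\overline{\Omega}_C\subset\Omega$) and a non-conducting subdomain $\Omega_I=\Omega\setminus\overline{\Omega}_C$; $\Omega_I$ has finitely many connected internal subdomains with single boundary components and an external subdomain $\Omega_{I,\rm ext}$ with two boundary components $\overline{\Omega}_{I,\rm ext}\cap\overline{\Omega}_C$ and $\partial\Omega$. The conductivity is $\sigma=\sigma_C\mathbb{1}_{\Omega_C}$ with $\sigma_C>0$. The reluctivity is $\nu(\xi,\zeta)=\nu_C(\zeta)\mathbb{1}_{\Omega_C}(\xi)+\nu_I\mathbb{1}_{\Omega_I}(\xi)$, where $\nu_I>0$ and $\nu_C:\mathbb{R}_{\ge0}\to\mathbb{R}_{\ge0}$ is measurable, and $\zeta\mapsto\nu_C(\zeta)\zeta$ is strongly monotone with constant $m_{\nu_C}>0$ and Lipschitz continuous with constant $L_{\nu_C}>0$. The resistance matrix $R\in\mathbb{R}^{m\times m}$ is symmetric positive definite. The winding function $\chi=[\chi_1,\ldots,\chi_m]$ has columns $\chi_j\in L^2(\Omega;\mathbb{R}^3)$ with $\nabla\cdot\chi_j=0$ and pairwise disjoint supports; $\gamma_j$ are functions with components in $H^1(\Omega)$ and $\chi_j=\nabla\times\gamma_j$. FEM matrices. $\varphi_1^e,\ldots,\varphi_{n_e}^e\in H_0(\mathrm{curl},\Omega)$ are the edge (Nédélec, first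 type) basis functions and $\varphi_1^f,\ldots,\varphi_{n_f}^f$ the face basis functions of a regular simplicial triangulation of $\Omega$. $C_d\in\mathbb{R}^{n_f\times n_e}$ is the discrete curl matrix, with $(C_d)_{kj}=\pm1$ if edge $j$ belongs to face $k$ with the same/opposite orientation, and $0$ otherwise. For $a=[\alpha_1^e,\ldots,\alpha_{n_e}^e]^T$ put $(M_\sigma)_{kl}=\int_\Omega\sigma\,\varphi_l^e\cdot\varphi_k^e\,{\rm d}\xi$, $(K(a))_{kl}=\int_\Omega\nu(\xi,\|\nabla\times\sum_j\alpha_j^e\varphi_j^e\|)(\nabla\times\varphi_l^e)\cdot(\nabla\times\varphi_k^e)\,{\rm d}\xi$, $X_{kj}=\int_\Omega\chi_j\cdot\varphi_k^e\,{\rm d}\xi$. They factor as $K(a)=C_d^TM_\nu(C_d\,a)C_d$ and $X=C_d^T\Upsilon$, where, with $C_d\,a=[\alpha_1^f,\ldots,\alpha_{n_f}^f]^T$, $(M_\nu(C_d\,a))_{kl}=\int_\Omega\nu(\xi,\|\sum_j\alpha_j^f\varphi_j^f\|)\varphi_l^f\cdot\varphi_k^f\,{\rm d}\xi$ and $\Upsilon_{kj}=\int_\Omega\gamma_j\cdot\varphi_k^f\,{\rm d}\xi$; $M_\nu(C_d\,a)$ is symmetric positive definite for all $a$. Ordering the edge basis functions according to the conducting and non-conducting subdomains gives $a=[a_1^T,a_2^T]^T$ with $a_1\in\mathbb{R}^{n_1}$, $a_2\in\mathbb{R}^{n_2}$, $n_e=n_1+n_2$, $C_d=[C_1\ C_2]$,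 and $$M_\sigma=\begin{bmatrix}M_{11}&0\\ 0&0\end{bmatrix},\quad K(a)=\begin{bmatrix}K_{11}(a_1)&K_{12}\\ K_{21}&K_{22}\end{bmatrix},\quad X=\begin{bmatrix}X_1\\ X_2\end{bmatrix},$$ where only $K_{11}(a_1)$ depends on $a$, $K_{21}=K_{12}^T$, $M_{11}$ is symmetric positive definite, and $X_2\in\mathbb{R}^{n_2\times m}$ has full column rank. Write $K_{11}(a_1)=K_{11,l}+K_{11,n}(a_1)$, where the constant matrix $K_{11,l}$ and the nonlinear matrix-valued function $K_{11,n}(a_1)$ come from the parts of the integral over $\Omega_I$ and $\Omega_C$, respectively. The semidiscretized system is $\tfrac{\rm d}{{\rm d}t}M_\sigma a=-K(a)a+X\boldsymbol{i}$, $\tfrac{\rm d}{{\rm d}t}X^Ta=-R\boldsymbol{i}+u$, with input $u$ and output $\boldsymbol{i}$. Auxiliary matrices. Let $k_2=\dim\ker(C_2)$ and let the columns of $\hat{Y}_{C_2}\in\mathbb{R}^{n_2\times(n_2-k_2)}$ form a basis of $\mathrm{im}(C_2^T)$. Let the columns of $Y$ form an orthonormal basis of $\ker(X_2^T\hat{Y}_{C_2})$, $Z=\hat{Y}_{C_2}^TX_2(X_2^T\hat{Y}_{C_2}\hat{Y}_{C_2}^TX_2)^{-1/2}$, $\hat{Z}=\hat{Y}_{C_2}^TX_2(X_2^T\hat{Y}_{C_2}\hat{Y}_{C_2}^TX_2)^{-1}$, $Y_2=\hat{Y}_{C_2}Y$, $Z_2=\hat{Y}_{C_2}Z$ ($Y_2^TK_{22}Y_2$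 is invertible). The columns of $U_{a_1}\in\mathbb{R}^{n_1\times r}$, $r\ll n_1$, form the POD basis (the $r$ leading left singular vectors) of a snapshot matrix $X_{a_1}=[a_1(t_1),\ldots,a_1(t_q)]$ of the $a_1$-component of the semidiscretized system, and $$U=\begin{bmatrix}U_{a_1}&0\\ -Y_2(Y_2^TK_{22}Y_2)^{-1}Y_2^TK_{21}U_{a_1}&(I-Y_2(Y_2^TK_{22}Y_2)^{-1}Y_2^TK_{22})Z_2\end{bmatrix}.$$ POD-reduced system. $\tfrac{\rm d}{{\rm d}t}E\,x_{\rm POD}=A(x_{\rm POD})x_{\rm POD}+Bu$, $x_{\rm POD}(0)=x_{\rm POD,0}$, $y_{\rm POD}=Cx_{\rm POD}$, with $x_{\rm POD}=[\tilde a_1^T,\tilde a_{21}^T]^T\in\mathbb{R}^{r+m}$ and $$E=\begin{bmatrix}U_{a_1}^TM_{11}U_{a_1}&0\\ 0&0\end{bmatrix}+U^TXR^{-1}X^TU,\quad A(x)=-U^TK(Ux)U,\quad B=U^TXR^{-1},$$ $$C=\hat{Z}^T\hat{Y}_{C_2}^T\bigl(I-K_{22}Y_2(Y_2^TK_{22}Y_2)^{-1}Y_2^T\bigr)\begin{bmatrix}K_{21}U_{a_1}&K_{22}Z_2\end{bmatrix};$$ $E$ is symmetric positive definite. One has $A(x_{\rm POD})x_{\rm POD}=A_l\,x_{\rm POD}+\begin{bmatrix}U_{a_1}^Tf_1(U_{a_1}\tilde a_1)\\ 0\end{bmatrix}$ with $f_1(U_{a_1}\tilde a_1)=-K_{11,n}(U_{a_1}\tilde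 a_1)U_{a_1}\tilde a_1$ and $A_l=-U^T\begin{bmatrix}K_{11,l}&K_{12}\\ K_{21}&K_{22}\end{bmatrix}U$. POD-DEIM-reduced system. $\tfrac{\rm d}{{\rm d}t}E\,x_{\rm DEIM}=F(x_{\rm DEIM})x_{\rm DEIM}+Bu$, $x_{\rm DEIM}(0)=x_{\rm DEIM,0}=x_{\rm POD,0}$, $y_{\rm DEIM}=Cx_{\rm DEIM}$, with $x_{\rm DEIM}=[\hat a_1^T,\hat a_{21}^T]^T$, $F(x_{\rm DEIM})x_{\rm DEIM}=A_l\,x_{\rm DEIM}+\begin{bmatrix}\hat f_1(\hat a_1)\\ 0\end{bmatrix}$ and $\hat f_1(\hat a_1)=U_{a_1}^TU_{f_1}(S_{\mathcal{K}}^TU_{f_1})^{-1}S_{\mathcal{K}}^Tf_1(U_{a_1}\hat a_1)$. Here $U_{f_1}\in\mathbb{R}^{n_1\times\ell}$ is the DEIM basis matrix (the $\ell$ leading left singular vectors of the snapshot matrix $X_{f_1}=[f_1(a_1(t_1)),\ldots,f_1(a_1(t_q))]$, where $f_1(a_1)=-K_{11,n}(a_1)a_1$), and $S_{\mathcal{K}}\in\mathbb{R}^{n_1\times\ell}$ is the selector matrix whose columns are the unit vectors with indices in the DEIM index set $\mathcal{K}$ chosen by the standard greedy DEIM procedure: the first index is that of the largest-modulus entry of the first column of $U_{f_1}$; given the first $j-1$ indices, the $j$-th index is that of the largest-modulus entry of the residual of interpolating the $j$-th column by the first $j-1$ columns at the first $j-1$ indices. Input-output-passivity. An input $u\in L^2([0,T];\mathbb{R}^m)$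 is admissible with a given initial condition if the corresponding initial value problem has a solution $x$ on $[0,T]$ (state equation in the sense of weak derivatives, $x$ continuous) whose output $y$ is in $L^2([0,T];\mathbb{R}^m)$. A control system with state equation $\tfrac{\rm d}{{\rm d}t}Ex=\ldots$ and initial condition $Ex(0)=Ex_0$ with $Ex_0=0$ is input-output-passive if for all $0\le t\le T$ and all inputs $u\in L^2([0,T];\mathbb{R}^m)$ admissible with $Ex(0)=0$, the output $y$ satisfies $\int_0^tu(\tau)^Ty(\tau)\,{\rm d}\tau\ge0$. (The function $\delta$ is chosen depending on $u$ via the displayed inequality.) *)

theory Defs
  imports
    "HOL-Analysis.Analysis"
    "Jordan_Normal_Form.Matrix"
    "Jordan_Normal_Form.Gauss_Jordan_Elimination"
    "Jordan_Normal_Form.Matrix_Kernel"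
    "Jordan_Normal_Form.DL_Rank"
begin

text \<open>Points and fields on the spatial domain live in the type \<^typ>\<open>real^3\<close>; coefficient vectors
  and matrices are those of Jordan_Normal_Form, indexed from 0, so that all dimensions are natural
  numbers (possibly 0).  The symbols for component access and scalar product denote the operations of
  Jordan_Normal_Form; those of HOL-Analysis are written \<open>$h\<close> and \<open>inner\<close>.\<close>

no_notation vec_nth (infixl \<open>$\<close> 90)
notation vec_nth (infixl \<open>$h\<close> 90)
no_notation inner (infix \<open>\<bullet>\<close> 70)

type_synonym pt = "real^3"


section \<open>Linear algebra\<close>

definition enorm :: "real vec \<Rightarrow> real" where
  "enorm v = sqrt (v \<bullet> v)"

definition spectral_norm :: "real mat \<Rightarrow> real" where
  "spectral_norm A = Sup {enorm (A *\<^sub>v v) | v. v \<in> carrier_vec (dim_col A) \<and> enorm v \<le> 1}"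

definition sym_pos_def :: "nat \<Rightarrow> real mat \<Rightarrow> bool" where
  "sym_pos_def n A \<longleftrightarrow> A \<in> carrier_mat n n \<and> A\<^sup>T = A \<and>
     (\<forall>v\<in>carrier_vec n. v \<noteq> 0\<^sub>v n \<longrightarrow> v \<bullet> (A *\<^sub>v v) > 0)"

text \<open>Only meaningful for invertible matrices.\<close>

definition minv :: "real mat \<Rightarrow> real mat" where
  "minv A = the (mat_inverse A)"

definition is_pd_sqrt :: "real mat \<Rightarrow> real mat \<Rightarrow> bool" where
  "is_pd_sqrt A Q \<longleftrightarrow> sym_pos_def (dim_row A) Q \<and> Q * Q = A"

definition mat_image :: "real mat \<Rightarrow> real vec set" where
  "mat_image A = {A *\<^sub>v v | v. v \<in> carrier_vec (dim_col A)}"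

text \<open>The columns are linearly independent and span the subspace.\<close>

definition columns_basis :: "real mat \<Rightarrow> real vec set \<Rightarrow> bool" where
  "columns_basis A V \<longleftrightarrow> mat_kernel A = {0\<^sub>v (dim_col A)} \<and> mat_image A = V"

definition orthonormal_columns :: "real mat \<Rightarrow> bool" where
  "orthonormal_columns A \<longleftrightarrow> A\<^sup>T * A = 1\<^sub>m (dim_col A)"

definition block :: "real mat \<Rightarrow> nat \<Rightarrow> nat \<Rightarrow> nat \<Rightarrow> nat \<Rightarrow> real mat" where
  "block A i0 nr j0 nc = mat nr nc (\<lambda>(i, j). A $$ (i0 + i, j0 + j))"

definition append_cols :: "real mat \<Rightarrow> real mat \<Rightarrow> real mat" (infixr \<open>@\<^sub>c\<close> 65) where
  "A @\<^sub>c B = (A\<^sup>T @\<^sub>r B\<^sup>T)\<^sup>T"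

text \<open>The first \<open>k\<close> columns of the left factor of a singular value decomposition of \<open>S\<close>
  with nonincreasing singular values.\<close>

definition leading_left_singular_vectors :: "real mat \<Rightarrow> nat \<Rightarrow> real mat \<Rightarrow> bool" where
  "leading_left_singular_vectors S k U \<longleftrightarrow>
     (\<exists>n q W D V. S \<in> carrier_mat n q \<and> k \<le> n \<and>
        W \<in> carrier_mat n n \<and> orthonormal_columns W \<and>
        V \<in> carrier_mat q q \<and> orthonormal_columns V \<and>
        D \<in> carrier_mat n q \<and> diagonal_mat D \<and>
        (\<forall>i<min n q. D $$ (i, i) \<ge> 0) \<and>
        (\<forall>i j. i \<le> j \<and> j < min n q \<longrightarrow> D $$ (j, j) \<le> D $$ (i, i)) \<and>
        S = W * D * V\<^sup>T \<and> U = block W 0 n 0 k)"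


section \<open>Greedy DEIM indices\<close>

definition selector :: "nat \<Rightarrow> nat \<Rightarrow> (nat \<Rightarrow> nat) \<Rightarrow> real mat" where
  "selector n l \<kappa> = mat n l (\<lambda>(i, k). if i = \<kappa> k then 1 else 0)"

text \<open>Residual of interpolating column \<open>j\<close> by the columns \<open>0, \<dots>, j - 1\<close> at the indices
  \<open>\<kappa> 0, \<dots>, \<kappa> (j - 1)\<close>; for \<open>j = 0\<close> it is column 0 itself.\<close>

definition deim_residual :: "real mat \<Rightarrow> (nat \<Rightarrow> nat) \<Rightarrow> nat \<Rightarrow> real vec" where
  "deim_residual U \<kappa> j =
     (let Uj = block U 0 (dim_row U) 0 j; Sj = selector (dim_row U) j \<kappa> in
      col U j - Uj *\<^sub>v (minv (Sj\<^sup>T * Uj) *\<^sub>v (Sj\<^sup>T *\<^sub>v col U j)))"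

definition greedy_deim :: "real mat \<Rightarrow> (nat \<Rightarrow> nat) \<Rightarrow> bool" where
  "greedy_deim U \<kappa> \<longleftrightarrow>
     (\<forall>j<dim_col U. \<kappa> j < dim_row U \<and>
        (\<forall>i<dim_row U. \<bar>deim_residual U \<kappa> j $ i\<bar> \<le> \<bar>deim_residual U \<kappa> j $ \<kappa> j\<bar>))"


section \<open>Weak derivatives\<close>

text \<open>Test functions are taken in \<open>C\<^sub>c\<^sup>1\<close>; by mollification they define the same weak
  derivatives of square-integrable (or integrable) functions as \<open>C\<^sub>c\<^sup>\<infinity>\<close>.\<close>

definition test_function :: "'a::euclidean_space set \<Rightarrow> ('a \<Rightarrow> 'b::euclidean_space) \<Rightarrow> bool" where
  "test_function S \<phi> \<longleftrightarrow>
     (\<forall>x. \<phi> differentiable at x) \<and>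
     (\<forall>v. continuous_on UNIV (\<lambda>x. frechet_derivative \<phi> (at x) v)) \<and>
     (\<exists>K. compact K \<and> K \<subseteq> S \<and> (\<forall>x. x \<notin> K \<longrightarrow> \<phi> x = 0))"

definition pderiv3 :: "3 \<Rightarrow> (pt \<Rightarrow> 'b::real_normed_vector) \<Rightarrow> pt \<Rightarrow> 'b" where
  "pderiv3 i f x = frechet_derivative f (at x) (axis i 1)"

text \<open>The classical curl.  For piecewise smooth fields with tangential continuity, such as edge
  element functions, it agrees almost everywhere with the weak curl.\<close>

definition curl :: "(pt \<Rightarrow> pt) \<Rightarrow> pt \<Rightarrow> pt" where
  "curl F x = vector
     [pderiv3 2 F x $h 3 - pderiv3 3 F x $h 2,
      pderiv3 3 F x $h 1 - pderiv3 1 F x $h 3,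
      pderiv3 1 F x $h 2 - pderiv3 2 F x $h 1]"

definition square_integrable :: "'a::euclidean_space set \<Rightarrow> ('a \<Rightarrow> 'b::euclidean_space) \<Rightarrow> bool" where
  "square_integrable S f \<longleftrightarrow>
     set_borel_measurable lebesgue S f \<and> set_integrable lebesgue S (\<lambda>x. (norm (f x))\<^sup>2)"

definition in_H1 :: "pt set \<Rightarrow> (pt \<Rightarrow> real) \<Rightarrow> bool" where
  "in_H1 S f \<longleftrightarrow> square_integrable S f \<and>
     (\<forall>i. \<exists>g. square_integrable S g \<and>
        (\<forall>\<phi>::pt \<Rightarrow> real. test_function S \<phi> \<longrightarrow>
           (LINT x:S|lebesgue. f x * pderiv3 i \<phi> x) = - (LINT x:S|lebesgue. g x * \<phi> x)))"

definition weakly_divergence_free :: "pt set \<Rightarrow> (pt \<Rightarrow> pt) \<Rightarrow> bool" where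
  "weakly_divergence_free S F \<longleftrightarrow>
     (\<forall>\<phi>::pt \<Rightarrow> real. test_function S \<phi> \<longrightarrow>
        (LINT x:S|lebesgue. (\<Sum>i\<in>UNIV. F x $h i * pderiv3 i \<phi> x)) = 0)"

definition has_weak_curl :: "pt set \<Rightarrow> (pt \<Rightarrow> pt) \<Rightarrow> (pt \<Rightarrow> pt) \<Rightarrow> bool" where
  "has_weak_curl S F G \<longleftrightarrow>
     (\<forall>\<Phi>::pt \<Rightarrow> pt. test_function S \<Phi> \<longrightarrow>
        (LINT x:S|lebesgue. inner (F x) (curl \<Phi> x)) = (LINT x:S|lebesgue. inner (G x) (\<Phi> x)))"

text \<open>Support relative to \<open>S\<close>, insensitive to changes on null sets.\<close>

definition ess_support :: "pt set \<Rightarrow> (pt \<Rightarrow> pt) \<Rightarrow> pt set" where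
  "ess_support S f = {x\<in>S. \<forall>e>0. \<not> negligible {y \<in> S \<inter> ball x e. f y \<noteq> 0}}"

definition has_weak_deriv_on :: "real \<Rightarrow> (real \<Rightarrow> real) \<Rightarrow> (real \<Rightarrow> real) \<Rightarrow> bool" where
  "has_weak_deriv_on T g h \<longleftrightarrow>
     set_integrable lebesgue {0..T} g \<and> set_integrable lebesgue {0..T} h \<and>
     (\<forall>\<phi>::real \<Rightarrow> real. test_function {0<..<T} \<phi> \<longrightarrow>
        (LINT t:{0..T}|lebesgue. g t * deriv \<phi> t) = - (LINT t:{0..T}|lebesgue. h t * \<phi> t))"

definition L2_signal :: "real \<Rightarrow> nat \<Rightarrow> (real \<Rightarrow> real vec) \<Rightarrow> bool" where
  "L2_signal T m u \<longleftrightarrow>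
     (\<forall>t\<in>{0..T}. u t \<in> carrier_vec m) \<and> (\<forall>i<m. square_integrable {0..T} (\<lambda>t. u t $ i))"

definition continuous_signal :: "real \<Rightarrow> nat \<Rightarrow> (real \<Rightarrow> real vec) \<Rightarrow> bool" where
  "continuous_signal T n x \<longleftrightarrow>
     (\<forall>t\<in>{0..T}. x t \<in> carrier_vec n) \<and> (\<forall>i<n. continuous_on {0..T} (\<lambda>t. x t $ i))"


section \<open>Control systems and passivity\<close>

text \<open>\<open>x\<close> solves \<open>d/dt (E x) = f(x) + B u\<close> on \<open>[0,T]\<close>, with no condition on the initial value.\<close>

definition state_solution ::
  "real \<Rightarrow> nat \<Rightarrow> real mat \<Rightarrow> (real vec \<Rightarrow> real vec) \<Rightarrow> real mat \<Rightarrow>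
   (real \<Rightarrow> real vec) \<Rightarrow> (real \<Rightarrow> real vec) \<Rightarrow> bool" where
  "state_solution T N E f B u x \<longleftrightarrow> continuous_signal T N x \<and>
     (\<forall>i<N. has_weak_deriv_on T (\<lambda>t. (E *\<^sub>v x t) $ i) (\<lambda>t. (f (x t) + B *\<^sub>v u t) $ i))"

text \<open>The output map \<open>y\<close> takes the input \<open>u\<close> and the state trajectory \<open>x\<close>, so that it may depend
  on \<open>u\<close> in a time-nonlocal way.  The pairs \<open>(u, x)\<close> in the premise are the inputs that are
  admissible with \<open>E x(0) = 0\<close>, together with a corresponding solution.\<close>

definition input_output_passive ::
  "real \<Rightarrow> nat \<Rightarrow> nat \<Rightarrow> real mat \<Rightarrow> (real vec \<Rightarrow> real vec) \<Rightarrow> real mat \<Rightarrow>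
   ((real \<Rightarrow> real vec) \<Rightarrow> (real \<Rightarrow> real vec) \<Rightarrow> real \<Rightarrow> real vec) \<Rightarrow> bool" where
  "input_output_passive T N m E f B y \<longleftrightarrow>
     (\<forall>u x. L2_signal T m u \<and> state_solution T N E f B u x \<and> E *\<^sub>v x 0 = 0\<^sub>v N \<and>
            L2_signal T m (y u x) \<longrightarrow>
        (\<forall>t\<in>{0..T}. (LINT \<tau>:{0..t}|lebesgue. u \<tau> \<bullet> y u x \<tau>) \<ge> 0))"


section \<open>The magneto-quasistatic problem\<close>

text \<open>Near each boundary point the set is the strict hypograph of a Lipschitz function \<open>g\<close> of the
  coordinates orthogonal to some direction \<open>e\<close>.\<close>

definition bounded_lipschitz_domain :: "pt set \<Rightarrow> bool" where
  "bounded_lipschitz_domain S \<longleftrightarrow> open S \<and> connected S \<and> bounded S \<and> S \<noteq> {} \<and>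
     (\<forall>x\<in>frontier S. \<exists>e r L g. norm e = 1 \<and> r > 0 \<and> L-lipschitz_on UNIV g \<and>
        (\<forall>y\<in>ball x r. y \<in> S \<longleftrightarrow> inner y e < g (y - inner y e *\<^sub>R e)))"

record mqs_problem =
  Om :: "pt set"
  OmC :: "pt set"
  sigmaC :: real
  nuC :: "real \<Rightarrow> real"
  nuI :: real
  n_wind :: nat
  Res :: "real mat"
  chi :: "nat \<Rightarrow> pt \<Rightarrow> pt"
  gam :: "nat \<Rightarrow> pt \<Rightarrow> pt"

definition OmI :: "('z) mqs_problem_scheme \<Rightarrow> pt set" where
  "OmI P = Om P - closure (OmC P)"

definition sigma :: "('z) mqs_problem_scheme \<Rightarrow> pt \<Rightarrow> real" where
  "sigma P \<xi> = sigmaC P * indicator (OmC P) \<xi>"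

definition nu :: "('z) mqs_problem_scheme \<Rightarrow> pt \<Rightarrow> real \<Rightarrow> real" where
  "nu P \<xi> \<zeta> = nuC P \<zeta> * indicator (OmC P) \<xi> + nuI P * indicator (OmI P) \<xi>"

definition geometry_ok :: "('z) mqs_problem_scheme \<Rightarrow> bool" where
  "geometry_ok P \<longleftrightarrow>
     bounded_lipschitz_domain (Om P) \<and> simply_connected (Om P) \<and>
     open (OmC P) \<and> connected (OmC P) \<and> OmC P \<noteq> {} \<and> closure (OmC P) \<subseteq> Om P \<and>
     finite (components (OmI P)) \<and>
     (\<exists>W\<in>components (OmI P).
        components (frontier W) = {closure W \<inter> closure (OmC P), frontier (Om P)} \<and>
        closure W \<inter> closure (OmC P) \<noteq> frontier (Om P) \<and>
        (\<forall>V\<in>components (OmI P) - {W}. connected (frontier V)))"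

definition material_ok :: "('z) mqs_problem_scheme \<Rightarrow> bool" where
  "material_ok P \<longleftrightarrow>
     sigmaC P > 0 \<and> nuI P > 0 \<and>
     set_borel_measurable lebesgue {0..} (nuC P) \<and> (\<forall>\<zeta>\<ge>0. nuC P \<zeta> \<ge> 0) \<and>
     (\<exists>mC>0. \<forall>\<zeta>\<ge>0. \<forall>\<eta>\<ge>0.
        (nuC P \<zeta> * \<zeta> - nuC P \<eta> * \<eta>) * (\<zeta> - \<eta>) \<ge> mC * (\<zeta> - \<eta>)\<^sup>2) \<and>
     (\<exists>LC>0. \<forall>\<zeta>\<ge>0. \<forall>\<eta>\<ge>0. \<bar>nuC P \<zeta> * \<zeta> - nuC P \<eta> * \<eta>\<bar> \<le> LC * \<bar>\<zeta> - \<eta>\<bar>)"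

definition windings_ok :: "('z) mqs_problem_scheme \<Rightarrow> bool" where
  "windings_ok P \<longleftrightarrow>
     sym_pos_def (n_wind P) (Res P) \<and>
     (\<forall>j<n_wind P. square_integrable (Om P) (chi P j) \<and>
        weakly_divergence_free (Om P) (chi P j) \<and>
        (\<forall>i. in_H1 (Om P) (\<lambda>\<xi>. gam P j \<xi> $h i)) \<and>
        has_weak_curl (Om P) (gam P j) (chi P j)) \<and>
     (\<forall>i<n_wind P. \<forall>j<n_wind P. i \<noteq> j \<longrightarrow>
        ess_support (Om P) (chi P i) \<inter> ess_support (Om P) (chi P j) = {})"


section \<open>Finite element discretization\<close>

text \<open>Edges and faces carry the orientation given by the order of their vertices.  The first
  \<open>n_one\<close> edges are those in the closure of the conductor, the next \<open>n_two\<close> edges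
  are the remaining ones not contained in the outer boundary.\<close>

record fem_problem = mqs_problem +
  mesh :: "pt set set"
  n_one :: nat
  n_two :: nat
  n_face :: nat
  edge :: "nat \<Rightarrow> pt \<times> pt"
  face :: "nat \<Rightarrow> pt \<times> pt \<times> pt"

definition n_edge :: "('z) fem_problem_scheme \<Rightarrow> nat" where
  "n_edge P = n_one P + n_two P"

definition tets :: "('z) fem_problem_scheme \<Rightarrow> pt set set" where
  "tets P = {S\<in>mesh P. 3 simplex S}"

definition edge_set :: "('z) fem_problem_scheme \<Rightarrow> nat \<Rightarrow> pt set" where
  "edge_set P j = (case edge P j of (p, q) \<Rightarrow> convex hull {p, q})"

definition face_set :: "('z) fem_problem_scheme \<Rightarrow> nat \<Rightarrow> pt set" where
  "face_set P k = (case face P k of (p, q, s) \<Rightarrow> convex hull {p, q, s})"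

text \<open>The mesh resolves the decomposition of the domain.  Edges contained in the outer boundary carry
  no basis function because of the vanishing tangential trace.\<close>

definition mesh_ok :: "('z) fem_problem_scheme \<Rightarrow> bool" where
  "mesh_ok P \<longleftrightarrow>
     simplicial_complex (mesh P) \<and> \<Union>(mesh P) = closure (Om P) \<and>
     (\<forall>S\<in>mesh P. \<exists>T\<in>tets P. S \<subseteq> T) \<and>
     (\<forall>T\<in>tets P. interior T \<subseteq> OmC P \<or> interior T \<subseteq> OmI P) \<and>
     bij_betw (edge_set P) {..<n_one P} {S\<in>mesh P. 1 simplex S \<and> S \<subseteq> closure (OmC P)} \<and>
     bij_betw (edge_set P) {n_one P..<n_edge P}
       {S\<in>mesh P. 1 simplex S \<and> \<not> S \<subseteq> closure (OmC P) \<and> \<not> S \<subseteq> frontier (Om P)} \<and>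
     bij_betw (face_set P) {..<n_face P} {S\<in>mesh P. 2 simplex S}"

definition vertices :: "pt set \<Rightarrow> pt set" where
  "vertices T = {v. v extreme_point_of T}"

text \<open>Gradient and value of the barycentric coordinate of the tetrahedron \<open>T\<close> with value 1 at the
  vertex \<open>p\<close> and 0 at the other vertices.\<close>

definition bary_grad :: "pt set \<Rightarrow> pt \<Rightarrow> pt" where
  "bary_grad T p = (THE g. \<forall>q\<in>vertices T. \<forall>s\<in>vertices T.
     inner g (q - s) = of_bool (q = p) - of_bool (s = p))"

definition bary :: "pt set \<Rightarrow> pt \<Rightarrow> pt \<Rightarrow> real" where
  "bary T p \<xi> = 1 + inner (bary_grad T p) (\<xi> - p)"

text \<open>Lowest order Nedelec edge and face functions in barycentric (Whitney) form, with unit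
  circulation along the edge and unit flux through the face.  Both are set to 0 on the
  inter-element faces, a null set.\<close>

definition edge_fun :: "('z) fem_problem_scheme \<Rightarrow> nat \<Rightarrow> pt \<Rightarrow> pt" where
  "edge_fun P j \<xi> = (case edge P j of (p, q) \<Rightarrow>
     \<Sum>T\<in>{T\<in>tets P. {p, q} \<subseteq> vertices T}. indicator (interior T) \<xi> *\<^sub>R
       (bary T p \<xi> *\<^sub>R bary_grad T q - bary T q \<xi> *\<^sub>R bary_grad T p))"

definition face_fun :: "('z) fem_problem_scheme \<Rightarrow> nat \<Rightarrow> pt \<Rightarrow> pt" where
  "face_fun P k \<xi> = (case face P k of (p, q, s) \<Rightarrow>
     \<Sum>T\<in>{T\<in>tets P. {p, q, s} \<subseteq> vertices T}. (2 * indicator (interior T) \<xi>) *\<^sub>R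
       (bary T p \<xi> *\<^sub>R cross3 (bary_grad T q) (bary_grad T s) +
        bary T q \<xi> *\<^sub>R cross3 (bary_grad T s) (bary_grad T p) +
        bary T s \<xi> *\<^sub>R cross3 (bary_grad T p) (bary_grad T q)))"

definition Cd :: "('z) fem_problem_scheme \<Rightarrow> real mat" where
  "Cd P = mat (n_face P) (n_edge P) (\<lambda>(k, j).
     case face P k of (p, q, s) \<Rightarrow>
       if edge P j \<in> {(p, q), (q, s), (s, p)} then 1
       else if edge P j \<in> {(q, p), (s, q), (p, s)} then -1 else 0)"

definition M_sigma :: "('z) fem_problem_scheme \<Rightarrow> real mat" where
  "M_sigma P = mat (n_edge P) (n_edge P) (\<lambda>(k, l).
     LINT \<xi>:Om P|lebesgue. sigma P \<xi> * inner (edge_fun P l \<xi>) (edge_fun P k \<xi>))"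

definition Kmat :: "('z) fem_problem_scheme \<Rightarrow> real vec \<Rightarrow> real mat" where
  "Kmat P a = mat (n_edge P) (n_edge P) (\<lambda>(k, l).
     LINT \<xi>:Om P|lebesgue.
       nu P \<xi> (norm (curl (\<lambda>\<eta>. \<Sum>j<n_edge P. a $ j *\<^sub>R edge_fun P j \<eta>) \<xi>)) *
       inner (curl (edge_fun P l) \<xi>) (curl (edge_fun P k) \<xi>))"

definition Xmat :: "('z) fem_problem_scheme \<Rightarrow> real mat" where
  "Xmat P = mat (n_edge P) (n_wind P) (\<lambda>(k, j).
     LINT \<xi>:Om P|lebesgue. inner (chi P j \<xi>) (edge_fun P k \<xi>))"

definition M_nu :: "('z) fem_problem_scheme \<Rightarrow> real vec \<Rightarrow> real mat" where
  "M_nu P b = mat (n_face P) (n_face P) (\<lambda>(k, l).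
     LINT \<xi>:Om P|lebesgue.
       nu P \<xi> (norm (\<Sum>j<n_face P. b $ j *\<^sub>R face_fun P j \<xi>)) *
       inner (face_fun P l \<xi>) (face_fun P k \<xi>))"

definition Upsilon :: "('z) fem_problem_scheme \<Rightarrow> real mat" where
  "Upsilon P = mat (n_face P) (n_wind P) (\<lambda>(k, j).
     LINT \<xi>:Om P|lebesgue. inner (gam P j \<xi>) (face_fun P k \<xi>))"

definition M11 :: "('z) fem_problem_scheme \<Rightarrow> real mat" where
  "M11 P = block (M_sigma P) 0 (n_one P) 0 (n_one P)"

definition C2 :: "('z) fem_problem_scheme \<Rightarrow> real mat" where
  "C2 P = block (Cd P) 0 (n_face P) (n_one P) (n_two P)"

definition X2 :: "('z) fem_problem_scheme \<Rightarrow> real mat" where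
  "X2 P = block (Xmat P) (n_one P) (n_two P) 0 (n_wind P)"

text \<open>The blocks with index (1,2), (2,1), (2,2) of \<open>K(a)\<close> do not depend on \<open>a\<close>, because the
  functions of the last \<open>n_two\<close> edges vanish on the conductor; they are read off at \<open>a = 0\<close>.\<close>

definition K12 :: "('z) fem_problem_scheme \<Rightarrow> real mat" where
  "K12 P = block (Kmat P (0\<^sub>v (n_edge P))) 0 (n_one P) (n_one P) (n_two P)"

definition K21 :: "('z) fem_problem_scheme \<Rightarrow> real mat" where
  "K21 P = block (Kmat P (0\<^sub>v (n_edge P))) (n_one P) (n_two P) 0 (n_one P)"

definition K22 :: "('z) fem_problem_scheme \<Rightarrow> real mat" where
  "K22 P = block (Kmat P (0\<^sub>v (n_edge P))) (n_one P) (n_two P) (n_one P) (n_two P)"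

definition K11l :: "('z) fem_problem_scheme \<Rightarrow> real mat" where
  "K11l P = mat (n_one P) (n_one P) (\<lambda>(k, l).
     LINT \<xi>:OmI P|lebesgue. nuI P * inner (curl (edge_fun P l) \<xi>) (curl (edge_fun P k) \<xi>))"

definition K11n :: "('z) fem_problem_scheme \<Rightarrow> real vec \<Rightarrow> real mat" where
  "K11n P a1 = mat (n_one P) (n_one P) (\<lambda>(k, l).
     LINT \<xi>:OmC P|lebesgue.
       nuC P (norm (curl (\<lambda>\<eta>. \<Sum>j<n_one P. a1 $ j *\<^sub>R edge_fun P j \<eta>) \<xi>)) *
       inner (curl (edge_fun P l) \<xi>) (curl (edge_fun P k) \<xi>))"

definition f1 :: "('z) fem_problem_scheme \<Rightarrow> real vec \<Rightarrow> real vec" where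
  "f1 P a1 = - (K11n P a1 *\<^sub>v a1)"

definition semidiscrete_solution ::
  "real \<Rightarrow> ('z) fem_problem_scheme \<Rightarrow> (real \<Rightarrow> real vec) \<Rightarrow> (real \<Rightarrow> real vec) \<Rightarrow>
   (real \<Rightarrow> real vec) \<Rightarrow> bool" where
  "semidiscrete_solution T P u a i \<longleftrightarrow>
     L2_signal T (n_wind P) u \<and> L2_signal T (n_wind P) i \<and> continuous_signal T (n_edge P) a \<and>
     (\<forall>k<n_edge P. has_weak_deriv_on T (\<lambda>t. (M_sigma P *\<^sub>v a t) $ k)
        (\<lambda>t. (- (Kmat P (a t) *\<^sub>v a t) + Xmat P *\<^sub>v i t) $ k)) \<and>
     (\<forall>j<n_wind P. has_weak_deriv_on T (\<lambda>t. ((Xmat P)\<^sup>T *\<^sub>v a t) $ j)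
        (\<lambda>t. (- (Res P *\<^sub>v i t) + u t) $ j))"

end

theory Submission
  imports Defs
begin

text \<open>The output map of the reduced model is not arbitrary: by the block structure of the projection, the
POD-reduced equation \<open>E h = f(x) + B u\<close> with \<open>h = x'\<close> forces \<open>C x\<close> to be the coil current
\<open>i = R\<inverse> (u - X\<^sup>T U h)\<close>.  The supplied power \<open>u \<bullet> C x\<close> is therefore the sum of the ohmic losses
\<open>i \<bullet> R i\<close> in the coils, the eddy current losses \<open>U\<^sub>1 h\<^sub>1 \<bullet> M\<^sub>1\<^sub>1 U\<^sub>1 h\<^sub>1\<close> and the rate of change of the
magnetic energy.  The energy is nonnegative and vanishes at the initial state, so the POD-reduced
system is passive.  For the POD-DEIM state, the error term \<open>C \<epsilon>\<close> costs at most
\<open>\<parallel>u\<parallel> \<parallel>C\<parallel> \<parallel>\<epsilon>\<parallel>\<close> of power, and \<open>\<delta> \<parallel>u\<parallel>\<^sup>2\<close> is chosen to pay for it pointwise.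

Three points need work.  First, the bound on \<open>\<delta>\<close> says something only if the POD-reduced system has
a solution on all of \<open>[0,T]\<close> for every square-integrable input.  Its nonlinearity is globally
Lipschitz because \<open>s \<mapsto> \<nu>(s) s\<close> is, and the fixed point theorem in an exponentially weighted
norm applies (\<open>caratheodory_solution_exists\<close>).  Secondly, the balance is an algebraic
identity of the projected matrices (\<open>reduced_power_balance\<close>); it uses that the rows of \<open>K(a)\<close> that
belong to non-conducting edges do not depend on \<open>a\<close> (\<open>Kmat_nonconducting_rows\<close>).  Invertibility
of \<open>E\<close> (\<open>E_inj\<close>) makes the equation explicit and zero the only admissible initial state.  Thirdly, the
solution is only an indefinite integral of an integrable function.  A chain rule for the
energy is avoided: the energy is convex with gradient \<open>flux\<close> (\<open>energy_convex\<close>), and comparing its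
increments over short intervals with the work done is enough (\<open>energy_inequality\<close>).\<close>

section \<open>Vectors and matrices\<close>

text \<open>Variants of library rules with premises on dimensions instead of carriers.  As rewrite rules they
leave no intermediate dimension to be guessed, so the simplifier can discharge their premises.\<close>

lemma mult_mat_vec_assoc_dim:
  fixes A :: "real mat"
  assumes "dim_col A = dim_row B" "dim_col B = dim_vec v"
  shows "(A * B) *\<^sub>v v = A *\<^sub>v (B *\<^sub>v v)"
  by (rule assoc_mult_mat_vec[of _ "dim_row A" "dim_row B" _ "dim_vec v"]) (use assms in \<open>auto intro: carrier_matI\<close>)

lemma mat_vec_distrib_dim:
  fixes A :: "real mat"
  shows "dim_row A = dim_row B \<Longrightarrow> dim_col A = dim_vec v \<Longrightarrow> dim_col B = dim_vec v \<Longrightarrow> (A + B) *\<^sub>v v = A *\<^sub>v v + B *\<^sub>v v"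
    and "dim_row A = dim_row B \<Longrightarrow> dim_col A = dim_vec v \<Longrightarrow> dim_col B = dim_vec v \<Longrightarrow> (A - B) *\<^sub>v v = A *\<^sub>v v - B *\<^sub>v v"
    and "dim_col A = dim_vec v \<Longrightarrow> dim_vec w = dim_vec v \<Longrightarrow> A *\<^sub>v (v + w) = A *\<^sub>v v + A *\<^sub>v w"
    and "dim_col A = dim_vec v \<Longrightarrow> dim_vec w = dim_vec v \<Longrightarrow> A *\<^sub>v (v - w) = A *\<^sub>v v - A *\<^sub>v w"
    and "dim_col A = dim_vec v \<Longrightarrow> A *\<^sub>v (- v) = - (A *\<^sub>v v)"
  by (intro eq_vecI; auto simp: scalar_prod_def row_def algebra_simps sum.distrib sum_subtractf sum_negf)+

lemma one_zero_mult_vec_dim: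
  fixes v :: "real vec"
  shows "dim_col (A :: real mat) = n \<Longrightarrow> A *\<^sub>v 0\<^sub>v n = 0\<^sub>v (dim_row A)" and "dim_vec v = n \<Longrightarrow> 1\<^sub>m n *\<^sub>v v = v" and "dim_vec v = n \<Longrightarrow> 0\<^sub>m k n *\<^sub>v v = 0\<^sub>v k"
    and "z \<bullet> 0\<^sub>v n = 0" and "dim_vec z = n \<Longrightarrow> 0\<^sub>v n \<bullet> z = (0 :: real)"
    and "dim_vec v = n \<Longrightarrow> 0\<^sub>v n + v = v" and "dim_vec v = n \<Longrightarrow> v + 0\<^sub>v n = v"
  by (force, erule one_mult_mat_vec[OF carrier_vecI], intro eq_vecI) (auto simp: scalar_prod_def)

lemma scalar_prod_distrib_dim:
  fixes v :: "real vec"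
  shows "dim_vec v = dim_vec w \<Longrightarrow> dim_vec z = dim_vec v \<Longrightarrow> (v + w) \<bullet> z = v \<bullet> z + w \<bullet> z"
    and "dim_vec v = dim_vec w \<Longrightarrow> z \<bullet> (v + w) = z \<bullet> v + z \<bullet> w"
    and "dim_vec v = dim_vec w \<Longrightarrow> dim_vec z = dim_vec v \<Longrightarrow> (v - w) \<bullet> z = v \<bullet> z - w \<bullet> z"
    and "dim_vec v = dim_vec w \<Longrightarrow> z \<bullet> (v - w) = z \<bullet> v - z \<bullet> w"
    and "dim_vec z = dim_vec v \<Longrightarrow> (- v) \<bullet> z = - (v \<bullet> z)"
    and "z \<bullet> (- v) = - (z \<bullet> v)"
  by (auto simp: scalar_prod_def algebra_simps sum.distrib sum_subtractf sum_negf)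

lemma scalar_prod_mult_mat_vec:
  fixes A :: "real mat"
  assumes "dim_vec x = dim_row A" "dim_vec y = dim_col A"
  shows "x \<bullet> (A *\<^sub>v y) = (A\<^sup>T *\<^sub>v x) \<bullet> y"
  by (rule transpose_vec_mult_scalar[symmetric, of _ "dim_row A" "dim_col A"]) (use assms in \<open>auto intro: carrier_vecI\<close>)

lemma scalar_prod_commute_dim: "dim_vec v = dim_vec w \<Longrightarrow> v \<bullet> w = w \<bullet> (v :: real vec)"
  by (auto simp: scalar_prod_def mult.commute)

lemma vec_eqI_scalar_prod:
  fixes v w :: "real vec"
  assumes "dim_vec v = n" "dim_vec w = n" "\<And>z. dim_vec z = n \<Longrightarrow> z \<bullet> v = z \<bullet> w"
  shows "v = w"
proof (rule eq_vecI)
  fix i assume "i < dim_vec w"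
  then show "v $ i = w $ i"
    using assms(3)[of "unit_vec n i"] assms(1,2)
      scalar_prod_left_unit[OF carrier_vecI[OF assms(1)]] scalar_prod_left_unit[OF carrier_vecI[OF assms(2)]]
    by simp
qed (use assms in simp)

lemma scalar_prod_append_dim:
  "dim_vec v1 = dim_vec w1 \<Longrightarrow> dim_vec v2 = dim_vec w2 \<Longrightarrow>
     (v1 @\<^sub>v v2) \<bullet> (w1 @\<^sub>v w2) = v1 \<bullet> w1 + v2 \<bullet> (w2 :: real vec)"
  by (rule scalar_prod_append[of _ "dim_vec w1" _ "dim_vec w2"]) (auto intro: carrier_vecI)

lemma scalar_prod_self_nonneg: "v \<bullet> v \<ge> (0 :: real)"
  by (simp add: scalar_prod_def sum_nonneg)

lemma scalar_prod_self_eq_0: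
  assumes "v \<bullet> v = (0 :: real)" shows "v = 0\<^sub>v (dim_vec v)"
  using assms by (intro eq_vecI) (auto simp: scalar_prod_def sum_nonneg_eq_0_iff)

lemma append_cols_dim [simp]:
  assumes "dim_row A = dim_row B"
  shows "dim_row (A @\<^sub>c B) = dim_row A" "dim_col (A @\<^sub>c B) = dim_col A + dim_col B"
proof -
  have "A\<^sup>T @\<^sub>r B\<^sup>T \<in> carrier_mat (dim_col A + dim_col B) (dim_row A)"
    by (rule carrier_append_rows) (use assms in auto)
  then show "dim_row (A @\<^sub>c B) = dim_row A" "dim_col (A @\<^sub>c B) = dim_col A + dim_col B"
    by (auto simp: append_cols_def)
qed

lemma append_cols_mult_vec:
  assumes "dim_row A = dim_row B" "dim_vec x = dim_col A" "dim_vec y = dim_col B"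
  shows "(A @\<^sub>c B) *\<^sub>v (x @\<^sub>v y) = A *\<^sub>v x + B *\<^sub>v y"
proof (rule vec_eqI_scalar_prod)
  have c: "A\<^sup>T \<in> carrier_mat (dim_col A) (dim_row A)" "B\<^sup>T \<in> carrier_mat (dim_col B) (dim_row A)"
    using assms by auto
  have dims: "dim_row (A\<^sup>T @\<^sub>r B\<^sup>T) = dim_col A + dim_col B" "dim_col (A\<^sup>T @\<^sub>r B\<^sup>T) = dim_row A"
    using carrier_append_rows[OF c] by auto
  show "dim_vec ((A @\<^sub>c B) *\<^sub>v (x @\<^sub>v y)) = dim_row A"
    by (simp add: append_cols_def dims)
  show "dim_vec (A *\<^sub>v x + B *\<^sub>v y) = dim_row A" using assms by simp
  fix z :: "real vec" assume z: "dim_vec z = dim_row A"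
  have "z \<bullet> ((A @\<^sub>c B) *\<^sub>v (x @\<^sub>v y)) = ((A\<^sup>T @\<^sub>r B\<^sup>T) *\<^sub>v z) \<bullet> (x @\<^sub>v y)"
    using assms z by (simp add: append_cols_def scalar_prod_mult_mat_vec dims)
  also have "(A\<^sup>T @\<^sub>r B\<^sup>T) *\<^sub>v z = (A\<^sup>T *\<^sub>v z) @\<^sub>v (B\<^sup>T *\<^sub>v z)"
    using z by (intro mat_mult_append[OF c]) (auto intro: carrier_vecI)
  also have "\<dots> \<bullet> (x @\<^sub>v y) = (A\<^sup>T *\<^sub>v z) \<bullet> x + (B\<^sup>T *\<^sub>v z) \<bullet> y"
    using assms by (simp add: scalar_prod_append_dim)
  also have "\<dots> = z \<bullet> (A *\<^sub>v x + B *\<^sub>v y)"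
    using assms z by (simp add: scalar_prod_distrib_dim scalar_prod_mult_mat_vec)
  finally show "z \<bullet> ((A @\<^sub>c B) *\<^sub>v (x @\<^sub>v y)) = z \<bullet> (A *\<^sub>v x + B *\<^sub>v y)" .
qed

lemma block_dim [simp]: "dim_row (block A i nr j nc) = nr" "dim_col (block A i nr j nc) = nc"
  by (simp_all add: block_def)

lemma sum_split_add: "(\<Sum>i = 0..<a + b. f i) = (\<Sum>i = 0..<a. f i) + (\<Sum>i = 0..<b. f (a + i))" for f :: "nat \<Rightarrow> real"
  by (induction b) (auto simp: add.assoc)

lemma mult_vec_block_cols:
  fixes A :: "real mat"
  assumes "dim_row A = nr" "dim_col A = n1 + n2" "dim_vec v1 = n1" "dim_vec v2 = n2"
  shows "A *\<^sub>v (v1 @\<^sub>v v2) = block A 0 nr 0 n1 *\<^sub>v v1 + block A 0 nr n1 n2 *\<^sub>v v2"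
  using assms by (intro eq_vecI) (auto simp: scalar_prod_def sum_split_add block_def)

lemma append_vec_split:
  assumes "dim_vec v = n1 + n2"
  obtains v1 v2 where "v = v1 @\<^sub>v v2" "dim_vec v1 = n1" "dim_vec v2 = n2"
proof (rule that[of "vec_first v n1" "vec_last v n2"])
  show "v = vec_first v n1 @\<^sub>v vec_last v n2"
    by (rule vec_first_last_append[symmetric]) (rule carrier_vecI[OF assms])
qed simp_all

lemmas mat_vec_simps = one_zero_mult_vec_dim mult_mat_vec_assoc_dim mat_vec_distrib_dim scalar_prod_distrib_dim scalar_prod_append_dim

text \<open>Injective square matrices have nonzero determinant, so the elimination behind \<^const>\<open>mat_inverse\<close>
succeeds.\<close>

lemma minv_inverse:
  assumes A: "A \<in> carrier_mat n n" and inj: "\<And>v. v \<in> carrier_vec n \<Longrightarrow> A *\<^sub>v v = 0\<^sub>v n \<Longrightarrow> v = 0\<^sub>v n"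
  shows "minv A \<in> carrier_mat n n" "A * minv A = 1\<^sub>m n" "minv A * A = 1\<^sub>m n"
proof -
  have "det A \<noteq> 0" using det_0_iff_vec_prod_zero_field[OF A] inj by auto
  then obtain B where B: "mat_inverse A = Some B"
    using mat_inverse(1)[OF A, where b = "()"] det_non_zero_imp_unit[OF A, where b = "()"]
    by (cases "mat_inverse A") auto
  from mat_inverse(2)[OF A B] B
  show "minv A \<in> carrier_mat n n" "A * minv A = 1\<^sub>m n" "minv A * A = 1\<^sub>m n"
    by (auto simp: minv_def)
qed

lemma sym_pos_def_inj:
  assumes "sym_pos_def n A" "v \<in> carrier_vec n" "A *\<^sub>v v = 0\<^sub>v n"
  shows "v = 0\<^sub>v n"
  using assms unfolding sym_pos_def_def by (metis less_irrefl scalar_prod_right_zero)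

lemma sym_pos_def_minv:
  assumes "sym_pos_def n A"
  shows "minv A \<in> carrier_mat n n" "A * minv A = 1\<^sub>m n" "minv A * A = 1\<^sub>m n"
  using minv_inverse[of A n] sym_pos_def_inj[OF assms] assms by (auto simp: sym_pos_def_def)

lemma inverse_mat_unique:
  fixes A :: "real mat"
  assumes "A \<in> carrier_mat n n" "B \<in> carrier_mat n n" "C \<in> carrier_mat n n" "B * A = 1\<^sub>m n" "A * C = 1\<^sub>m n"
  shows "B = C"
proof -
  have "B * (A * C) = B * A * C" using assms(1-3) by (simp add: assoc_mult_mat[of _ n n _ n _ n])
  then show ?thesis using assms by simp
qed

lemma symmetric_inverse:
  fixes A :: "real mat"
  assumes "A \<in> carrier_mat n n" "B \<in> carrier_mat n n" "A\<^sup>T = A" "A * B = 1\<^sub>m n" "B * A = 1\<^sub>m n"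
  shows "B\<^sup>T = B"
proof -
  have "B\<^sup>T * A\<^sup>T = 1\<^sub>m n"
    using assms transpose_mult[OF assms(1,2)] by simp
  then show ?thesis using inverse_mat_unique[of A n "B\<^sup>T" B] assms by simp
qed

lemma enorm_L2: "enorm v = L2_set (\<lambda>i. v $ i) {0..<dim_vec v}"
  by (simp add: enorm_def L2_set_def scalar_prod_def power2_eq_square)

lemma enorm_nonneg: "enorm v \<ge> 0"
  by (simp add: enorm_L2)

lemma abs_scalar_prod_le: 
  assumes "dim_vec v = dim_vec w"
  shows "\<bar>v \<bullet> w\<bar> \<le> enorm v * enorm w"
proof -
  have "\<bar>v \<bullet> w\<bar> \<le> (\<Sum>i = 0..<dim_vec w. \<bar>v $ i\<bar> * \<bar>w $ i\<bar>)"
    unfolding scalar_prod_def abs_mult[symmetric] by (rule sum_abs)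
  also have "\<dots> \<le> enorm v * enorm w"
    unfolding enorm_L2 assms by (rule L2_set_mult_ineq)
  finally show ?thesis .
qed

lemma enorm_eq_0: "enorm v = 0 \<Longrightarrow> v = 0\<^sub>v (dim_vec v)"
  by (simp add: enorm_def scalar_prod_self_eq_0)

lemma enorm_smult: "enorm (c \<cdot>\<^sub>v v) = \<bar>c\<bar> * enorm v"
  by (simp add: enorm_def real_sqrt_mult flip: power2_eq_square mult.assoc)

text \<open>The supremum defining the spectral norm is finite because \<open>\<parallel>A v\<parallel>\<close> is at most the sum of the row norms
on the unit ball; the general case follows by scaling.\<close>

lemma enorm_mult_mat_vec_le:
  assumes "v \<in> carrier_vec (dim_col A)"
  shows "enorm (A *\<^sub>v v) \<le> spectral_norm A * enorm v"
proof -
  let ?S = "{enorm (A *\<^sub>v v) | v. v \<in> carrier_vec (dim_col A) \<and> enorm v \<le> 1}"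
  define K where "K = (\<Sum>i = 0..<dim_row A. enorm (row A i))"
  have "enorm (A *\<^sub>v v) \<le> K" if v: "v \<in> carrier_vec (dim_col A)" "enorm v \<le> 1" for v
  proof -
    have "enorm (A *\<^sub>v v) \<le> (\<Sum>i = 0..<dim_row A. \<bar>row A i \<bullet> v\<bar>)"
      unfolding enorm_L2 by (rule order_trans[OF L2_set_le_sum_abs]) simp
    also have "\<dots> \<le> (\<Sum>i = 0..<dim_row A. enorm (row A i) * enorm v)"
      by (intro sum_mono abs_scalar_prod_le) (use v in auto)
    also have "\<dots> \<le> K"
      unfolding K_def using v(2) by (intro sum_mono mult_left_le enorm_nonneg) auto
    finally show ?thesis .
  qed
  then have bdd: "bdd_above ?S" by (intro bdd_aboveI[of _ K]) auto
  show ?thesis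
  proof (cases "enorm v = 0")
    case True
    then have "v = 0\<^sub>v (dim_col A)" using enorm_eq_0[of v] assms by auto
    then have "A *\<^sub>v v = 0\<^sub>v (dim_row A)" by auto
    then show ?thesis using True by (simp add: enorm_def)
  next
    case False
    then have p: "enorm v > 0" using enorm_nonneg[of v] by simp
    define w where "w = inverse (enorm v) \<cdot>\<^sub>v v"
    have w: "w \<in> carrier_vec (dim_col A)" "enorm w \<le> 1"
      using assms p by (auto simp: w_def enorm_smult)
    have "enorm (A *\<^sub>v w) \<le> spectral_norm A"
      unfolding spectral_norm_def by (rule cSup_upper[OF _ bdd]) (use w in auto)
    moreover have "A *\<^sub>v w = inverse (enorm v) \<cdot>\<^sub>v (A *\<^sub>v v)"
      unfolding w_def by (rule mult_mat_vec[of _ "dim_row A" "dim_col A"]) (use assms in auto)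
    ultimately show ?thesis using p by (simp add: enorm_smult field_simps)
  qed
qed

lemma transpose_mult_dim: "dim_col A = dim_row B \<Longrightarrow> (A * B)\<^sup>T = B\<^sup>T * (A :: real mat)\<^sup>T"
  by (rule transpose_mult[of _ "dim_row A" "dim_col A" _ "dim_col B"]) auto

lemma mat_eqI_mult_vec:
  fixes A B :: "real mat"
  assumes dims: "dim_row A = nr" "dim_row B = nr" "dim_col A = nc" "dim_col B = nc"
    and eq: "\<And>v. dim_vec v = nc \<Longrightarrow> A *\<^sub>v v = B *\<^sub>v v"
  shows "A = B"
proof (rule eq_matI)
  fix i j assume ij: "i < dim_row B" "j < dim_col B"
  have "(A *\<^sub>v unit_vec nc j) $ i = (B *\<^sub>v unit_vec nc j) $ i" by (simp add: eq)
  then show "A $$ (i, j) = B $$ (i, j)"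
    using ij dims by (simp add: scalar_prod_right_unit)
qed (use dims in auto)

lemma scalar_prod_lower_block:
  fixes A :: "real mat"
  assumes "dim_row A = n1 + n2" "dim_col A = n1 + n2" "dim_vec z = n2" "dim_vec a1 = n1" "dim_vec a2 = n2"
  shows "(0\<^sub>v n1 @\<^sub>v z) \<bullet> (A *\<^sub>v (a1 @\<^sub>v a2)) = z \<bullet> (block A n1 n2 0 n1 *\<^sub>v a1 + block A n1 n2 n1 n2 *\<^sub>v a2)"
proof -
  have "A *\<^sub>v (a1 @\<^sub>v a2) = vec n1 (\<lambda>i. (A *\<^sub>v (a1 @\<^sub>v a2)) $ i) @\<^sub>v (block A n1 n2 0 n1 *\<^sub>v a1 + block A n1 n2 n1 n2 *\<^sub>v a2)"
    using assms by (intro eq_vecI) (auto simp: scalar_prod_def sum_split_add block_def)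
  then have "(0\<^sub>v n1 @\<^sub>v z) \<bullet> (A *\<^sub>v (a1 @\<^sub>v a2))
     = (0\<^sub>v n1 @\<^sub>v z) \<bullet> (vec n1 (\<lambda>i. (A *\<^sub>v (a1 @\<^sub>v a2)) $ i) @\<^sub>v (block A n1 n2 0 n1 *\<^sub>v a1 + block A n1 n2 n1 n2 *\<^sub>v a2))"
    by simp
  also have "\<dots> = z \<bullet> (block A n1 n2 0 n1 *\<^sub>v a1 + block A n1 n2 n1 n2 *\<^sub>v a2)"
    using assms by (subst scalar_prod_append_dim) (simp_all add: one_zero_mult_vec_dim)
  finally show ?thesis .
qed

lemma mult_vec_lower_rows:
  fixes A :: "real mat"
  assumes "dim_row A = n1 + n2" "dim_col A = m" "dim_vec z = n2"
  shows "A\<^sup>T *\<^sub>v (0\<^sub>v n1 @\<^sub>v z) = (block A n1 n2 0 m)\<^sup>T *\<^sub>v z"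
  using assms by (intro eq_vecI) (auto simp: scalar_prod_def sum_split_add block_def)

text \<open>Injectivity is inherited from the orthogonal factor: \<open>U v\<close> is that factor applied to \<open>v\<close> padded
with zeros.\<close>

lemma leading_left_singular_vectors_inj:
  assumes "leading_left_singular_vectors A k U"
  shows "dim_row U = dim_row A" "dim_col U = k"
    and "\<And>v. dim_vec v = k \<Longrightarrow> U *\<^sub>v v = 0\<^sub>v (dim_row A) \<Longrightarrow> v = 0\<^sub>v k"
proof -
  from assms obtain n W where k: "k \<le> n" and n: "dim_row A = n"
    and W: "W \<in> carrier_mat n n" "W\<^sup>T * W = 1\<^sub>m n" and U: "U = block W 0 n 0 k"
    unfolding leading_left_singular_vectors_def orthonormal_columns_def by auto
  show "dim_row U = dim_row A" "dim_col U = k" by (simp_all add: U n)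
  fix v :: "real vec" assume v: "dim_vec v = k" and Uv: "U *\<^sub>v v = 0\<^sub>v (dim_row A)"
  have "W *\<^sub>v (v @\<^sub>v 0\<^sub>v (n - k)) = U *\<^sub>v v + block W 0 n k (n - k) *\<^sub>v 0\<^sub>v (n - k)"
    unfolding U by (rule mult_vec_block_cols) (use W k v in auto)
  then have "W *\<^sub>v (v @\<^sub>v 0\<^sub>v (n - k)) = 0\<^sub>v n"
    by (simp add: Uv n one_zero_mult_vec_dim)
  then have "W\<^sup>T *\<^sub>v (W *\<^sub>v (v @\<^sub>v 0\<^sub>v (n - k))) = 0\<^sub>v n"
    using W(1) by (simp add: one_zero_mult_vec_dim)
  then have z: "v @\<^sub>v 0\<^sub>v (n - k) = 0\<^sub>v n"
    using W v k by (simp add: one_zero_mult_vec_dim flip: mult_mat_vec_assoc_dim)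
  show "v = 0\<^sub>v k"
  proof (rule eq_vecI)
    fix i assume "i < dim_vec (0\<^sub>v k :: real vec)"
    then show "v $ i = 0\<^sub>v k $ i"
      using arg_cong[OF z, of "\<lambda>w. w $ i"] v k by simp
  qed (use v in simp)
qed

lemma columns_basis_inj:
  assumes "columns_basis A V" "dim_vec v = dim_col A" "A *\<^sub>v v = 0\<^sub>v (dim_row A)"
  shows "v = 0\<^sub>v (dim_col A)"
proof -
  have "v \<in> mat_kernel A"
    by (rule mat_kernelI[of A "dim_row A" "dim_col A"]) (use assms in \<open>auto intro: carrier_vecI\<close>)
  then show ?thesis using assms(1) by (simp add: columns_basis_def)
qed

lemma columns_basis_mem:
  assumes "columns_basis A V" "dim_vec v = dim_col A"
  shows "A *\<^sub>v v \<in> V"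
  using assms carrier_vecI[of v] unfolding columns_basis_def mat_image_def by blast

lemma mult_mat_vec_lipschitz:
  fixes A :: "real mat"
  shows "\<exists>K\<ge>0. \<forall>p q e i. i < dim_row A \<longrightarrow> dim_vec p = dim_col A \<longrightarrow> dim_vec q = dim_col A \<longrightarrow>
      (\<forall>k<dim_col A. \<bar>p $ k - q $ k\<bar> \<le> e) \<longrightarrow> 0 \<le> e \<longrightarrow> \<bar>(A *\<^sub>v p) $ i - (A *\<^sub>v q) $ i\<bar> \<le> K * e"
proof -
  define K where "K = (\<Sum>i = 0..<dim_row A. \<Sum>k = 0..<dim_col A. \<bar>A $$ (i, k)\<bar>)"
  have "\<bar>(A *\<^sub>v p) $ i - (A *\<^sub>v q) $ i\<bar> \<le> K * e"
    if i: "i < dim_row A" and d: "dim_vec p = dim_col A" "dim_vec q = dim_col A"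
      and pq: "\<And>k. k < dim_col A \<Longrightarrow> \<bar>p $ k - q $ k\<bar> \<le> e" and e: "0 \<le> e" for p q e i
  proof -
    have "(A *\<^sub>v p) $ i - (A *\<^sub>v q) $ i = (\<Sum>k = 0..<dim_col A. A $$ (i, k) * (p $ k - q $ k))"
      using i d by (simp add: scalar_prod_def right_diff_distrib sum_subtractf)
    also have "\<bar>\<dots>\<bar> \<le> (\<Sum>k = 0..<dim_col A. \<bar>A $$ (i, k) * (p $ k - q $ k)\<bar>)" by (rule sum_abs)
    also have "\<dots> \<le> (\<Sum>k = 0..<dim_col A. \<bar>A $$ (i, k)\<bar> * e)"
      unfolding abs_mult by (intro sum_mono mult_left_mono pq) auto
    also have "\<dots> = (\<Sum>k = 0..<dim_col A. \<bar>A $$ (i, k)\<bar>) * e" by (simp add: sum_distrib_right)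
    also have "\<dots> \<le> K * e"
      unfolding K_def using i e
      by (intro mult_right_mono member_le_sum[of i "{0..<dim_row A}" "\<lambda>i. \<Sum>k = 0..<dim_col A. \<bar>A $$ (i, k)\<bar>"]) (auto intro: sum_nonneg)
    finally show ?thesis .
  qed
  moreover have "0 \<le> K" unfolding K_def by (intro sum_nonneg) auto
  ultimately show ?thesis by blast
qed

section \<open>Power balance of the projected system\<close>

text \<open>The algebra shared by positivity of \<open>E\<close> and the power balance.  The identities \<open>X\<^sub>2\<^sup>T Y\<^sub>2 = 0\<close> and
\<open>X\<^sub>2\<^sup>T Z\<^sub>2 = Q\<close> express that \<open>Y\<^sub>2\<close> spans the directions invisible to the windings and \<open>Z\<^sub>2\<close> a complement;
\<open>W\<close> is the inverse with which the unknowns along \<open>Y\<^sub>2\<close> are eliminated.\<close>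

locale projected_mqs =
  fixes n1 n2 r s m :: nat
    and U1 Y2 Z2 W K21 K22 X2 X M11 R Ri Q Qi U E C :: "real mat"
  assumes dims [simp]: "dim_row U1 = n1" "dim_col U1 = r" "dim_row Y2 = n2" "dim_col Y2 = s"
      "dim_row Z2 = n2" "dim_col Z2 = m" "dim_row W = s" "dim_col W = s"
      "dim_row K21 = n2" "dim_col K21 = n1" "dim_row K22 = n2" "dim_col K22 = n2"
      "dim_row X2 = n2" "dim_col X2 = m" "dim_row X = n1 + n2" "dim_col X = m"
      "dim_row Q = m" "dim_col Q = m" "dim_row Qi = m" "dim_col Qi = m"
      "dim_row Ri = m" "dim_col Ri = m" "dim_row R = m" "dim_col R = m"
      "dim_row M11 = n1" "dim_col M11 = n1"
    and W: "W\<^sup>T = W" "W * (Y2\<^sup>T * K22 * Y2) = 1\<^sub>m s" and K22: "K22\<^sup>T = K22"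
    and X2: "\<And>z. dim_vec z = n2 \<Longrightarrow> X\<^sup>T *\<^sub>v (0\<^sub>v n1 @\<^sub>v z) = X2\<^sup>T *\<^sub>v z"
    and X2Y2: "X2\<^sup>T * Y2 = 0\<^sub>m m s" and X2Z2: "X2\<^sup>T * Z2 = Q"
    and Q: "Q\<^sup>T = Q" "Qi * Q = 1\<^sub>m m" and R: "R * Ri = 1\<^sub>m m"
    and R_pos: "\<And>v. dim_vec v = m \<Longrightarrow> v \<noteq> 0\<^sub>v m \<Longrightarrow> 0 < v \<bullet> (R *\<^sub>v v)"
    and M11_pos: "\<And>v. dim_vec v = n1 \<Longrightarrow> v \<noteq> 0\<^sub>v n1 \<Longrightarrow> 0 < v \<bullet> (M11 *\<^sub>v v)"
    and U1_inj: "\<And>v. dim_vec v = r \<Longrightarrow> U1 *\<^sub>v v = 0\<^sub>v n1 \<Longrightarrow> v = 0\<^sub>v r"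
    and U: "U = four_block_mat U1 (0\<^sub>m n1 m)
                  (- (Y2 * W * Y2\<^sup>T * K21 * U1)) ((1\<^sub>m n2 - Y2 * W * Y2\<^sup>T * K22) * Z2)"
    and E: "E = four_block_mat (U1\<^sup>T * M11 * U1) (0\<^sub>m r m) (0\<^sub>m m r) (0\<^sub>m m m)
                + U\<^sup>T * X * Ri * X\<^sup>T * U"
    and C: "C = Qi * Z2\<^sup>T * (1\<^sub>m n2 - K22 * Y2 * W * Y2\<^sup>T) * (K21 * U1 @\<^sub>c K22 * Z2)"
begin

lemma U_dim [simp]: "dim_row U = n1 + n2" "dim_col U = r + m"
  by (simp_all add: U)

lemma E_C_dim [simp]: "dim_row E = r + m" "dim_col E = r + m" "dim_row C = m" "dim_col C = r + m"
  by (simp_all add: E C)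

lemma U_mult_append:
  assumes v: "dim_vec v1 = r" "dim_vec v2 = m"
  shows "U *\<^sub>v (v1 @\<^sub>v v2) = (U1 *\<^sub>v v1) @\<^sub>v
      (Z2 *\<^sub>v v2 - Y2 *\<^sub>v (W *\<^sub>v (Y2\<^sup>T *\<^sub>v (K21 *\<^sub>v (U1 *\<^sub>v v1) + K22 *\<^sub>v (Z2 *\<^sub>v v2)))))"
proof -
  have "U *\<^sub>v (v1 @\<^sub>v v2) = (U1 *\<^sub>v v1 + 0\<^sub>m n1 m *\<^sub>v v2) @\<^sub>v
     (- (Y2 * W * Y2\<^sup>T * K21 * U1) *\<^sub>v v1 + ((1\<^sub>m n2 - Y2 * W * Y2\<^sup>T * K22) * Z2) *\<^sub>v v2)"
    unfolding U by (rule four_block_mat_mult_vec[of _ n1 r _ m _ n2])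
      ((rule carrier_matI carrier_vecI; simp add: v)+)
  also have "U1 *\<^sub>v v1 + 0\<^sub>m n1 m *\<^sub>v v2 = U1 *\<^sub>v v1"
    using v by (simp add: one_zero_mult_vec_dim right_zero_vec carrier_vecI[of "U1 *\<^sub>v v1" n1] del: index_mult_mat_vec)
  also have "- (Y2 * W * Y2\<^sup>T * K21 * U1) *\<^sub>v v1 + ((1\<^sub>m n2 - Y2 * W * Y2\<^sup>T * K22) * Z2) *\<^sub>v v2
    = Z2 *\<^sub>v v2 - Y2 *\<^sub>v (W *\<^sub>v (Y2\<^sup>T *\<^sub>v (K21 *\<^sub>v (U1 *\<^sub>v v1) + K22 *\<^sub>v (Z2 *\<^sub>v v2))))"
    using v by (intro eq_vecI) (simp_all add: mat_vec_simps del: index_mult_mat_vec)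
  finally show ?thesis .
qed

lemma E_scalar_prod:
  assumes v: "v = v1 @\<^sub>v v2" "dim_vec v1 = r" "dim_vec v2 = m"
    and h: "h = h1 @\<^sub>v h2" "dim_vec h1 = r" "dim_vec h2 = m"
  shows "v \<bullet> (E *\<^sub>v h) = (U1 *\<^sub>v v1) \<bullet> (M11 *\<^sub>v (U1 *\<^sub>v h1))
    + (X\<^sup>T *\<^sub>v (U *\<^sub>v v)) \<bullet> (Ri *\<^sub>v (X\<^sup>T *\<^sub>v (U *\<^sub>v h)))"
proof -
  have dimv: "dim_vec v = r + m" "dim_vec h = r + m" using v h by simp_all
  have "four_block_mat (U1\<^sup>T * M11 * U1) (0\<^sub>m r m) (0\<^sub>m m r) (0\<^sub>m m m) *\<^sub>v h
      = ((U1\<^sup>T * M11 * U1) *\<^sub>v h1 + 0\<^sub>m r m *\<^sub>v h2) @\<^sub>v (0\<^sub>m m r *\<^sub>v h1 + 0\<^sub>m m m *\<^sub>v h2)"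
    unfolding h(1) by (rule four_block_mat_mult_vec[of _ r r _ m _ m])
      ((rule carrier_matI carrier_vecI; simp add: h)+)
  then have "E *\<^sub>v h = (U1\<^sup>T *\<^sub>v (M11 *\<^sub>v (U1 *\<^sub>v h1)) @\<^sub>v 0\<^sub>v m) + U\<^sup>T *\<^sub>v (X *\<^sub>v (Ri *\<^sub>v (X\<^sup>T *\<^sub>v (U *\<^sub>v h))))"
    by (simp add: E mat_vec_simps dimv h(2,3))
  then show ?thesis
    using v dimv by (simp add: mat_vec_simps scalar_prod_mult_mat_vec[of _ "U1\<^sup>T"]
        scalar_prod_mult_mat_vec[of _ "U\<^sup>T"] scalar_prod_mult_mat_vec[of _ X])
qed

lemma R_nonneg: "dim_vec v = m \<Longrightarrow> 0 \<le> v \<bullet> (R *\<^sub>v v)"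
  using R_pos[of v] by (cases "v = 0\<^sub>v m") (simp_all add: one_zero_mult_vec_dim)

lemma M11_nonneg: "dim_vec v = n1 \<Longrightarrow> 0 \<le> v \<bullet> (M11 *\<^sub>v v)"
  using M11_pos[of v] by (cases "v = 0\<^sub>v n1") (simp_all add: one_zero_mult_vec_dim)

lemma Ri_pos:
  assumes "dim_vec z = m"
  shows "0 \<le> z \<bullet> (Ri *\<^sub>v z)" and "z \<bullet> (Ri *\<^sub>v z) = 0 \<Longrightarrow> z = 0\<^sub>v m"
proof -
  define w where "w = Ri *\<^sub>v z"
  have w: "dim_vec w = m" by (simp add: w_def)
  have z: "z = R *\<^sub>v w"
    unfolding w_def using R assms by (simp add: one_zero_mult_vec_dim flip: mult_mat_vec_assoc_dim[of R Ri])
  have eq: "z \<bullet> (Ri *\<^sub>v z) = w \<bullet> (R *\<^sub>v w)"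
    using scalar_prod_commute_dim[of z w] assms w by (simp add: z[symmetric] w_def[symmetric])
  show "0 \<le> z \<bullet> (Ri *\<^sub>v z)" unfolding eq by (rule R_nonneg[OF w])
  assume "z \<bullet> (Ri *\<^sub>v z) = 0"
  then have "w = 0\<^sub>v m" using R_pos[OF w] by (auto simp: eq)
  then show "z = 0\<^sub>v m" using z by (simp add: one_zero_mult_vec_dim)
qed

text \<open>The elimination term in the second block column of \<open>U\<close> lies in the range of \<open>Y\<^sub>2\<close>, which the windings
do not see.\<close>

lemma X_trans_U_lower:
  assumes "dim_vec w = m"
  shows "X\<^sup>T *\<^sub>v (U *\<^sub>v (0\<^sub>v r @\<^sub>v w)) = Q *\<^sub>v w"
proof -
  define t where "t = W *\<^sub>v (Y2\<^sup>T *\<^sub>v (K22 *\<^sub>v (Z2 *\<^sub>v w)))"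
  have t: "dim_vec t = s" by (simp add: t_def)
  have "X2\<^sup>T *\<^sub>v (Y2 *\<^sub>v t) = 0\<^sub>v m"
    using t X2Y2 by (simp add: one_zero_mult_vec_dim flip: mult_mat_vec_assoc_dim)
  moreover have "X2\<^sup>T *\<^sub>v (Z2 *\<^sub>v w) = Q *\<^sub>v w" using assms X2Z2 by (simp flip: mult_mat_vec_assoc_dim)
  moreover have "U *\<^sub>v (0\<^sub>v r @\<^sub>v w) = 0\<^sub>v n1 @\<^sub>v (Z2 *\<^sub>v w - Y2 *\<^sub>v t)"
    using U_mult_append[of "0\<^sub>v r" w] assms by (simp add: t_def mat_vec_simps)
  ultimately show ?thesis
    using assms t by (simp add: X2 mat_vec_simps) (intro eq_vecI, simp_all del: index_mult_mat_vec)
qed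

text \<open>\<open>v \<bullet> E v\<close> is a sum of two nonnegative terms.  The first controls the conducting part of \<open>v\<close>; once
that vanishes, the second controls the rest through the invertible \<open>Q\<close>.\<close>

lemma E_inj:
  assumes v: "dim_vec v = r + m" and Ev: "E *\<^sub>v v = 0\<^sub>v (r + m)"
  shows "v = 0\<^sub>v (r + m)"
proof -
  obtain v1 v2 where v12: "v = v1 @\<^sub>v v2" "dim_vec v1 = r" "dim_vec v2 = m"
    using append_vec_split[OF v] by blast
  have "v \<bullet> (E *\<^sub>v v) = 0" using v by (simp add: Ev one_zero_mult_vec_dim)
  then have "(U1 *\<^sub>v v1) \<bullet> (M11 *\<^sub>v (U1 *\<^sub>v v1)) = 0"
    and 2: "(X\<^sup>T *\<^sub>v (U *\<^sub>v v)) \<bullet> (Ri *\<^sub>v (X\<^sup>T *\<^sub>v (U *\<^sub>v v))) = 0"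
    using E_scalar_prod[OF v12 v12] M11_nonneg[of "U1 *\<^sub>v v1"] Ri_pos(1)[of "X\<^sup>T *\<^sub>v (U *\<^sub>v v)"]
    by simp_all
  then have "U1 *\<^sub>v v1 = 0\<^sub>v n1" using M11_pos[of "U1 *\<^sub>v v1"] by force
  then have v1: "v1 = 0\<^sub>v r" by (rule U1_inj[OF v12(2)])
  have "X\<^sup>T *\<^sub>v (U *\<^sub>v v) = 0\<^sub>v m" by (rule Ri_pos(2)[OF _ 2]) simp
  then have "Q *\<^sub>v v2 = 0\<^sub>v m" using X_trans_U_lower[OF v12(3)] by (simp add: v12(1) v1)
  then have "Qi *\<^sub>v (Q *\<^sub>v v2) = 0\<^sub>v m" by (simp add: one_zero_mult_vec_dim)
  then have "v2 = 0\<^sub>v m" using Q(2) v12(3) by (simp add: one_zero_mult_vec_dim flip: mult_mat_vec_assoc_dim)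
  then show ?thesis by (auto simp: v12(1) v1)
qed

text \<open>Testing the equation with \<open>(0, w)\<close> isolates the coil currents: with \<open>i = R\<inverse> (u - X\<^sup>T U h)\<close> it says
\<open>Q i = Z\<^sub>2\<^sup>T P (K\<^sub>2\<^sub>1 a\<^sub>1 + K\<^sub>2\<^sub>2 a\<^sub>2)\<close>, where \<open>P\<close> is the transposed projection along \<open>Y\<^sub>2\<close>.  The operator \<open>P\<close>
annihilates the eliminated component, so the right-hand side is \<open>Q C x\<close> and \<open>i = C x\<close>.  Testing
with \<open>h\<close> then turns \<open>u \<bullet> C x\<close> into losses plus \<open>U h \<bullet> p\<close>.\<close>

lemma reduced_power_balance:
  assumes x: "dim_vec x = r + m" and h: "dim_vec h = r + m" and u: "dim_vec u = m" and p: "dim_vec p = n1 + n2"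
    and a: "U *\<^sub>v x = a1 @\<^sub>v a2" "dim_vec a1 = n1" "dim_vec a2 = n2"
    and p2: "\<And>z. dim_vec z = n2 \<Longrightarrow> (0\<^sub>v n1 @\<^sub>v z) \<bullet> p = z \<bullet> (K21 *\<^sub>v a1 + K22 *\<^sub>v a2)"
    and ode: "E *\<^sub>v h = - (U\<^sup>T *\<^sub>v p) + U\<^sup>T * X * Ri *\<^sub>v u"
  shows "(U *\<^sub>v h) \<bullet> p \<le> u \<bullet> (C *\<^sub>v x)"
proof -
  obtain x1 x2 where x12: "x = x1 @\<^sub>v x2" "dim_vec x1 = r" "dim_vec x2 = m"
    using append_vec_split[OF x] by blast
  obtain h1 h2 where h12: "h = h1 @\<^sub>v h2" "dim_vec h1 = r" "dim_vec h2 = m"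
    using append_vec_split[OF h] by blast
  define P where "P = (\<lambda>q. q - K22 *\<^sub>v (Y2 *\<^sub>v (W *\<^sub>v (Y2\<^sup>T *\<^sub>v q))))"
  have Pdim [simp]: "dim_vec (P q) = n2" for q by (simp add: P_def)
  define q where "q = K21 *\<^sub>v (U1 *\<^sub>v x1) + K22 *\<^sub>v (Z2 *\<^sub>v x2)"
  have qdim [simp]: "dim_vec q = n2" by (simp add: q_def)
  have Wi: "W *\<^sub>v (Y2\<^sup>T *\<^sub>v (K22 *\<^sub>v (Y2 *\<^sub>v v))) = v" if "dim_vec v = s" for v
  proof -
    have "(W * (Y2\<^sup>T * K22 * Y2)) *\<^sub>v v = v"
      unfolding W(2) using that by (rule one_zero_mult_vec_dim)
    then show ?thesis using that by (simp add: mult_mat_vec_assoc_dim)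
  qed
  have "a1 @\<^sub>v a2 = (U1 *\<^sub>v x1) @\<^sub>v (Z2 *\<^sub>v x2 - Y2 *\<^sub>v (W *\<^sub>v (Y2\<^sup>T *\<^sub>v q)))"
    using a(1) U_mult_append[OF x12(2,3)] by (simp add: q_def x12(1))
  then have a12: "a1 = U1 *\<^sub>v x1" "a2 = Z2 *\<^sub>v x2 - Y2 *\<^sub>v (W *\<^sub>v (Y2\<^sup>T *\<^sub>v q))"
    using append_vec_eq[OF carrier_vecI[OF a(2)] carrier_vecI[of "U1 *\<^sub>v x1"]] by simp_all
  \<comment> \<open>the component of \<open>a2\<close> along \<open>Y2\<close> was chosen to satisfy the Schur complement equation, so \<open>P\<close>
    removes it\<close>
  have force: "P (K21 *\<^sub>v a1 + K22 *\<^sub>v a2) = P q"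
    proof -
    define z where "z = W *\<^sub>v (Y2\<^sup>T *\<^sub>v q)"
    have z: "dim_vec z = s" by (simp add: z_def)
    have "K21 *\<^sub>v a1 + K22 *\<^sub>v a2 = q - K22 *\<^sub>v (Y2 *\<^sub>v z)"
      by (intro eq_vecI) (simp_all add: a12 q_def z_def mat_vec_simps del: index_mult_mat_vec)
    then have "P (K21 *\<^sub>v a1 + K22 *\<^sub>v a2) = q - K22 *\<^sub>v (Y2 *\<^sub>v z) - (K22 *\<^sub>v (Y2 *\<^sub>v z) - K22 *\<^sub>v (Y2 *\<^sub>v z))"
      by (simp add: P_def mat_vec_simps Wi z flip: z_def)
    also have "\<dots> = P q"
      by (intro eq_vecI) (simp_all add: P_def z_def del: index_mult_mat_vec)
    finally show ?thesis .
  qed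
  define y where "y = C *\<^sub>v x"
  have y: "y = Qi *\<^sub>v (Z2\<^sup>T *\<^sub>v P q)"
    proof -
    have "y = Qi *\<^sub>v (Z2\<^sup>T *\<^sub>v ((1\<^sub>m n2 - K22 * Y2 * W * Y2\<^sup>T) *\<^sub>v q))"
      by (simp add: y_def C x12 mult_mat_vec_assoc_dim append_cols_mult_vec q_def)
    also have "(1\<^sub>m n2 - K22 * Y2 * W * Y2\<^sup>T) *\<^sub>v q = P q"
      by (simp add: mat_vec_simps P_def)
    finally show ?thesis .
  qed
  have ydim [simp]: "dim_vec y = m" by (simp add: y)
  define i where "i = Ri *\<^sub>v (u - X\<^sup>T *\<^sub>v (U *\<^sub>v h))"
  have idim [simp]: "dim_vec i = m" by (simp add: i_def)
  have balance: "(U *\<^sub>v v) \<bullet> p = (X\<^sup>T *\<^sub>v (U *\<^sub>v v)) \<bullet> i - (U1 *\<^sub>v v1) \<bullet> (M11 *\<^sub>v (U1 *\<^sub>v h1))"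
    if v: "v = v1 @\<^sub>v v2" "dim_vec v1 = r" "dim_vec v2 = m" for v v1 v2
    proof -
    have dimv: "dim_vec v = r + m" using v by simp
    have "v \<bullet> (E *\<^sub>v h) = (U1 *\<^sub>v v1) \<bullet> (M11 *\<^sub>v (U1 *\<^sub>v h1)) + (X\<^sup>T *\<^sub>v (U *\<^sub>v v)) \<bullet> (Ri *\<^sub>v (X\<^sup>T *\<^sub>v (U *\<^sub>v h)))"
      by (rule E_scalar_prod[OF v h12])
    moreover have "v \<bullet> (E *\<^sub>v h) = - ((U *\<^sub>v v) \<bullet> p) + (X\<^sup>T *\<^sub>v (U *\<^sub>v v)) \<bullet> (Ri *\<^sub>v u)"
      using dimv p u by (simp add: ode mat_vec_simps
          scalar_prod_mult_mat_vec[of _ "U\<^sup>T"] scalar_prod_mult_mat_vec[of _ X])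
    ultimately show ?thesis
      using u by (simp add: i_def mat_vec_simps)
  qed
  have "Q *\<^sub>v i = Z2\<^sup>T *\<^sub>v P q"
  proof (rule vec_eqI_scalar_prod[of _ m])
    fix w :: "real vec" assume w: "dim_vec w = m"
    define z where "z = Z2 *\<^sub>v w - Y2 *\<^sub>v (W *\<^sub>v (Y2\<^sup>T *\<^sub>v (K22 *\<^sub>v (Z2 *\<^sub>v w))))"
    have zdim: "dim_vec z = n2" by (simp add: z_def)
    have Uw: "U *\<^sub>v (0\<^sub>v r @\<^sub>v w) = 0\<^sub>v n1 @\<^sub>v z"
      by (simp add: U_mult_append w z_def mat_vec_simps)
    have "w \<bullet> (Q *\<^sub>v i) = (Q *\<^sub>v w) \<bullet> i"
      using w Q(1) by (simp add: scalar_prod_mult_mat_vec)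
    also have "\<dots> = (0\<^sub>v n1 @\<^sub>v z) \<bullet> p"
      using balance[of "0\<^sub>v r @\<^sub>v w" "0\<^sub>v r" w] w
      X_trans_U_lower[OF w]
      by (simp add: Uw one_zero_mult_vec_dim)
    also have "\<dots> = z \<bullet> (K21 *\<^sub>v a1 + K22 *\<^sub>v a2)" by (rule p2[OF zdim])
    also have "\<dots> = w \<bullet> (Z2\<^sup>T *\<^sub>v P (K21 *\<^sub>v a1 + K22 *\<^sub>v a2))"
      using w a(2,3) by (simp add: z_def P_def mat_vec_simps scalar_prod_mult_mat_vec W(1) K22)
    finally show "w \<bullet> (Q *\<^sub>v i) = w \<bullet> (Z2\<^sup>T *\<^sub>v P q)" by (simp only: force)
  qed simp_all
  then have iy: "i = y"
    proof -
    have "Qi *\<^sub>v (Q *\<^sub>v i) = i"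
      using Q(2) by (simp add: one_zero_mult_vec_dim flip: mult_mat_vec_assoc_dim)
    with \<open>Q *\<^sub>v i = Z2\<^sup>T *\<^sub>v P q\<close> show ?thesis by (simp add: y)
  qed
  have "u = R *\<^sub>v i + X\<^sup>T *\<^sub>v (U *\<^sub>v h)"
    proof -
    have "R *\<^sub>v i = u - X\<^sup>T *\<^sub>v (U *\<^sub>v h)"
      unfolding i_def using R u by (simp add: one_zero_mult_vec_dim flip: mult_mat_vec_assoc_dim[of R Ri])
    then show ?thesis
      using u by (intro eq_vecI) (simp_all del: index_mult_mat_vec)
  qed
  then have "u \<bullet> y = (R *\<^sub>v i) \<bullet> y + (X\<^sup>T *\<^sub>v (U *\<^sub>v h)) \<bullet> y"
    by (simp add: scalar_prod_distrib_dim)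
  also have "\<dots> = i \<bullet> (R *\<^sub>v i) + (U *\<^sub>v h) \<bullet> p + (U1 *\<^sub>v h1) \<bullet> (M11 *\<^sub>v (U1 *\<^sub>v h1))"
    using balance[OF h12] by (simp add: iy scalar_prod_commute_dim[of "R *\<^sub>v y"])
  finally show ?thesis
    using R_nonneg[of i] M11_nonneg[of "U1 *\<^sub>v h1"] by (simp add: y_def)
qed

end

section \<open>Indefinite integrals and the energy inequality\<close>

text \<open>Replaces differentiation: \<open>k\<close> need not be differentiable anywhere, provided that a decrease on short
intervals is of smaller order than the increment of a fixed function \<open>W\<close>.\<close>

lemma le_by_small_increments:
  fixes k W :: "real \<Rightarrow> real"
  assumes ab: "a \<le> b"
    and inc: "\<And>e. e > 0 \<Longrightarrow> \<exists>d>0. \<forall>s t. a \<le> s \<and> s \<le> t \<and> t \<le> b \<and> t - s \<le> d \<longrightarrow>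
                  k t - k s \<ge> - e * (W t - W s)"
  shows "k a \<le> k b"
proof (rule ccontr)
  assume "\<not> k a \<le> k b"
  then have neg: "k b - k a < 0" by simp
  define c where "c = \<bar>W b - W a\<bar> + 1"
  have c: "c > 0" "W b - W a \<le> c" by (auto simp: c_def intro: add_nonneg_pos)
  define e where "e = (k a - k b) / (2 * c)"
  have e: "e > 0" using neg c(1) by (simp add: e_def)
  obtain d where d: "d > 0"
    "\<And>s t. a \<le> s \<Longrightarrow> s \<le> t \<Longrightarrow> t \<le> b \<Longrightarrow> t - s \<le> d \<Longrightarrow> k t - k s \<ge> - e * (W t - W s)"
    using inc[OF e] by blast
  obtain n :: nat where n: "(b - a) / d < real n" using reals_Archimedean2 by blast
  have n0: "real n > 0" using n ab d(1) by (meson divide_nonneg_pos diff_ge_0_iff_ge le_less_trans)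
  define p where "p = (\<lambda>i. a + real i * (b - a) / real n)"
  have step: "p (Suc i) - p i = (b - a) / real n" for i
    by (simp add: p_def add_divide_distrib distrib_right)
  have small: "(b - a) / real n \<le> d"
    using n n0 d(1) by (simp add: field_simps)
  have pn: "p i \<le> b" if "i \<le> n" for i
  proof -
    have "real i * (b - a) / real n \<le> real n * (b - a) / real n"
      using that ab by (intro divide_right_mono mult_right_mono) auto
    then show ?thesis using n0 by (simp add: p_def)
  qed
  have pa: "a \<le> p i" for i using ab by (simp add: p_def)
  have "k (p i) - k (p 0) \<ge> - e * (W (p i) - W (p 0))" if "i \<le> n" for i
    using that
  proof (induction i)
    case (Suc i)
    have "k (p (Suc i)) - k (p i) \<ge> - e * (W (p (Suc i)) - W (p i))"
    proof (rule d(2))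
      have "0 \<le> (b - a) / real n" using ab by simp
      then show "p i \<le> p (Suc i)" using step[of i] by linarith
    qed (use step[of i] small pa[of i] pn[OF Suc.prems] in auto)
    with Suc show ?case by (simp add: algebra_simps)
  qed simp
  from this[of n] have "k b - k a \<ge> - e * (W b - W a)"
    using n0 by (simp add: p_def)
  moreover have "e * (W b - W a) \<le> e * c" using e c(2) by simp
  moreover have "e * c = (k a - k b) / 2"
    using c(1) by (simp add: e_def)
  ultimately show False using neg by simp
qed

lemma abs_integrable_mult_continuous:
  fixes h c :: "real \<Rightarrow> real"
  assumes "h absolutely_integrable_on {a..b}" "continuous_on {a..b} c"
  shows "(\<lambda>t. c t * h t) absolutely_integrable_on {a..b}"
proof (rule absolutely_integrable_bounded_measurable_product_real)
  show "c \<in> borel_measurable (lebesgue_on {a..b})"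
    by (rule continuous_imp_measurable_on_sets_lebesgue[OF assms(2)]) simp
  show "bounded (c ` {a..b})"
    by (intro compact_imp_bounded compact_continuous_image assms) simp
qed (use assms in auto)

lemma integral_diff_interval:
  fixes h :: "real \<Rightarrow> real"
  assumes "h integrable_on {a..b}" "a \<le> s" "s \<le> t" "t \<le> b"
  shows "integral {a..t} h - integral {a..s} h = integral {s..t} h"
proof -
  have "h integrable_on {a..t}"
    using assms by (intro integrable_subinterval_real[OF assms(1)]) auto
  from Henstock_Kurzweil_Integration.integral_combine[OF assms(2,3) this] show ?thesis by simp
qed

text \<open>The defect \<open>\<integral>(h c + g c') - g c\<close> has increments of smaller order than those of
\<open>\<integral>(\<bar>h\<bar> + \<bar>c'\<bar>)\<close>, by uniform continuity of \<open>c\<close> and \<open>g\<close>; hence it is constant.\<close>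

lemma integral_by_parts_indefinite:
  fixes h c c' :: "real \<Rightarrow> real"
  assumes ab: "a \<le> b" and h: "h absolutely_integrable_on {a..b}"
    and g: "\<And>t. t \<in> {a..b} \<Longrightarrow> g t = g a + integral {a..t} h"
    and c: "\<And>t. t \<in> {a..b} \<Longrightarrow> (c has_real_derivative c' t) (at t)"
    and c': "continuous_on {a..b} c'"
  shows "integral {a..b} (\<lambda>t. h t * c t + g t * c' t) = g b * c b - g a * c a"
proof -
  have hi: "h integrable_on {a..b}" using h by (simp add: absolutely_integrable_on_def)
  have cc: "continuous_on {a..b} c"
    by (intro continuous_at_imp_continuous_on ballI) (rule DERIV_isCont[OF c])
  have "continuous_on {a..b} (\<lambda>t. g a + integral {a..t} h)"
    by (rule continuous_on_add[OF continuous_on_const indefinite_integral_continuous_1[OF hi]])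
  then have gc: "continuous_on {a..b} g"
    by (rule continuous_on_eq) (rule g[symmetric])
  have hc: "(\<lambda>t. h t * c t) absolutely_integrable_on {a..b}"
    using abs_integrable_mult_continuous[OF h cc] by (simp add: mult.commute)
  then have hc': "(\<lambda>t. h t * c t) integrable_on {a..b}" by (simp add: absolutely_integrable_on_def)
  have gc'': "(\<lambda>t. g t * c' t) integrable_on {a..b}"
    by (intro integrable_continuous_real continuous_intros gc c')
  define k where "k = (\<lambda>t. integral {a..t} (\<lambda>t. h t * c t + g t * c' t) - g t * c t)"
  define W where "W = (\<lambda>t. integral {a..t} (\<lambda>t. \<bar>h t\<bar> + \<bar>c' t\<bar>))"
  have Wi: "(\<lambda>t. \<bar>h t\<bar>) integrable_on {a..b}" "(\<lambda>t. \<bar>c' t\<bar>) integrable_on {a..b}"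
    using h by (auto simp: absolutely_integrable_on_def intro!: integrable_continuous_real continuous_intros c')
  have key: "\<exists>d>0. \<forall>s t. a \<le> s \<and> s \<le> t \<and> t \<le> b \<and> t - s \<le> d \<longrightarrow> \<bar>k t - k s\<bar> \<le> e * (W t - W s)"
    if e: "e > 0" for e
  proof -
    have uc: "uniformly_continuous_on {a..b} c" and ug: "uniformly_continuous_on {a..b} g"
      using cc gc by (auto intro: compact_uniformly_continuous)
    obtain d1 where d1: "d1 > 0"
      "\<And>x y. x \<in> {a..b} \<Longrightarrow> y \<in> {a..b} \<Longrightarrow> dist y x < d1 \<Longrightarrow> dist (c y) (c x) < e"
      using uniformly_continuous_onE[OF uc e] by blast
    obtain d2 where d2: "d2 > 0"
      "\<And>x y. x \<in> {a..b} \<Longrightarrow> y \<in> {a..b} \<Longrightarrow> dist y x < d2 \<Longrightarrow> dist (g y) (g x) < e"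
      using uniformly_continuous_onE[OF ug e] by blast
    show ?thesis
    proof (rule exI[of _ "min d1 d2 / 2"], intro conjI allI impI)
      fix s t assume A: "a \<le> s \<and> s \<le> t \<and> t \<le> b \<and> t - s \<le> min d1 d2 / 2"
      have sub: "{s..t} \<subseteq> {a..b}" using A by auto
      note i = integrable_subinterval_real[OF _ sub]
      have i1: "h integrable_on {s..t}" "c' integrable_on {s..t}" "(\<lambda>\<tau>. h \<tau> * c \<tau>) integrable_on {s..t}"
        "(\<lambda>\<tau>. g \<tau> * c' \<tau>) integrable_on {s..t}"
        "(\<lambda>t. \<bar>h t\<bar>) integrable_on {s..t}" "(\<lambda>t. \<bar>c' t\<bar>) integrable_on {s..t}"
        by (rule i, rule hi integrable_continuous_real[OF c'] hc' gc'' Wi)+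
      have i2: "(\<lambda>\<tau>. h \<tau> * c \<tau> + g \<tau> * c' \<tau>) integrable_on {s..t}"
        by (rule integrable_add[OF i1(3,4)])
      have i4: "(\<lambda>\<tau>. c t * h \<tau>) integrable_on {s..t}" "(\<lambda>\<tau>. g s * c' \<tau>) integrable_on {s..t}"
        by (rule integrable_on_mult_right, rule i1)+
      have i3: "(\<lambda>\<tau>. c t * h \<tau> + g s * c' \<tau>) integrable_on {s..t}"
        by (rule integrable_add[OF i4])
      have c'd: "integral {s..t} c' = c t - c s"
        by (intro integral_unique fundamental_theorem_of_calculus)
          (use A in \<open>auto simp: has_real_derivative_iff_has_vector_derivative[symmetric]
             intro!: has_field_derivative_at_within[OF c]\<close>)
      have gd: "g t - g s = integral {s..t} h"
        using integral_diff_interval[OF hi, of s t] g[of s] g[of t] A by (metis (no_types) add_diff_cancel_left atLeastAtMost_iff order_trans)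
      have "k t - k s = integral {s..t} (\<lambda>\<tau>. h \<tau> * c \<tau> + g \<tau> * c' \<tau>) - (g t * c t - g s * c s)"
        using A integral_diff_interval[OF integrable_add[OF hc' gc''], of s t] by (simp add: k_def)
      also have "g t * c t - g s * c s = c t * (g t - g s) + g s * (c t - c s)"
        by (simp add: algebra_simps)
      also have "\<dots> = integral {s..t} (\<lambda>\<tau>. c t * h \<tau> + g s * c' \<tau>)"
        unfolding gd c'd[symmetric]
        by (simp add: integral_add[OF i4])
      also have "integral {s..t} (\<lambda>\<tau>. h \<tau> * c \<tau> + g \<tau> * c' \<tau>) - \<dots>
          = integral {s..t} (\<lambda>\<tau>. (h \<tau> * c \<tau> + g \<tau> * c' \<tau>) - (c t * h \<tau> + g s * c' \<tau>))"
        by (rule integral_diff[OF i2 i3, symmetric])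
      finally have eq: "k t - k s = \<dots>" .
      have "\<bar>\<dots>\<bar> \<le> integral {s..t} (\<lambda>\<tau>. e * (\<bar>h \<tau>\<bar> + \<bar>c' \<tau>\<bar>))"
      proof (rule integral_norm_bound_integral[where f = "\<lambda>\<tau>. (h \<tau> * c \<tau> + g \<tau> * c' \<tau>) - (c t * h \<tau> + g s * c' \<tau>)", unfolded real_norm_def])
        show "(\<lambda>\<tau>. (h \<tau> * c \<tau> + g \<tau> * c' \<tau>) - (c t * h \<tau> + g s * c' \<tau>)) integrable_on {s..t}"
          by (rule integrable_diff[OF i2 i3])
        show "(\<lambda>\<tau>. e * (\<bar>h \<tau>\<bar> + \<bar>c' \<tau>\<bar>)) integrable_on {s..t}"
          by (intro integrable_on_mult_right integrable_add i1)
        fix \<tau> assume \<tau>: "\<tau> \<in> {s..t}"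
        have "\<bar>c \<tau> - c t\<bar> \<le> e"
          using d1(2)[of t \<tau>] \<tau> A d1(1) by (auto simp: dist_real_def)
        then have 1: "\<bar>(c \<tau> - c t) * h \<tau>\<bar> \<le> e * \<bar>h \<tau>\<bar>"
          unfolding abs_mult by (rule mult_right_mono) simp
        have "\<bar>g \<tau> - g s\<bar> \<le> e"
          using d2(2)[of s \<tau>] \<tau> A d2(1) by (auto simp: dist_real_def)
        then have 2: "\<bar>(g \<tau> - g s) * c' \<tau>\<bar> \<le> e * \<bar>c' \<tau>\<bar>"
          unfolding abs_mult by (rule mult_right_mono) simp
        have "(h \<tau> * c \<tau> + g \<tau> * c' \<tau>) - (c t * h \<tau> + g s * c' \<tau>)
           = (c \<tau> - c t) * h \<tau> + (g \<tau> - g s) * c' \<tau>" by (simp add: algebra_simps)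
        with 1 2 show "\<bar>(h \<tau> * c \<tau> + g \<tau> * c' \<tau>) - (c t * h \<tau> + g s * c' \<tau>)\<bar> \<le> e * (\<bar>h \<tau>\<bar> + \<bar>c' \<tau>\<bar>)"
          by (simp add: distrib_left)
      qed
      also have "\<dots> = e * (W t - W s)"
        using A integral_diff_interval[OF integrable_add[OF Wi], of s t] by (simp add: W_def)
      finally show "\<bar>k t - k s\<bar> \<le> e * (W t - W s)" using eq by simp
    qed (use d1 d2 in auto)
  qed
  have "k a \<le> k b"
  proof (rule le_by_small_increments[where W = W, OF ab])
    fix e :: real assume "e > 0"
    from key[OF this] obtain d where "d > 0"
      and d: "\<And>s t. a \<le> s \<and> s \<le> t \<and> t \<le> b \<and> t - s \<le> d \<Longrightarrow> \<bar>k t - k s\<bar> \<le> e * (W t - W s)" by blast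
    have "- e * (W t - W s) \<le> k t - k s" if "a \<le> s \<and> s \<le> t \<and> t \<le> b \<and> t - s \<le> d" for s t
      using d[OF that] by (simp add: abs_le_iff)
    with \<open>d > 0\<close> show "\<exists>d>0. \<forall>s t. a \<le> s \<and> s \<le> t \<and> t \<le> b \<and> t - s \<le> d \<longrightarrow> - e * (W t - W s) \<le> k t - k s"
      by blast
  qed
  moreover have "- k a \<le> - k b"
  proof (rule le_by_small_increments[where W = W, OF ab])
    fix e :: real assume "e > 0"
    from key[OF this] obtain d where "d > 0"
      and d: "\<And>s t. a \<le> s \<and> s \<le> t \<and> t \<le> b \<and> t - s \<le> d \<Longrightarrow> \<bar>k t - k s\<bar> \<le> e * (W t - W s)" by blast
    have "- e * (W t - W s) \<le> - k t - - k s" if "a \<le> s \<and> s \<le> t \<and> t \<le> b \<and> t - s \<le> d" for s t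
      using d[OF that] by (simp add: abs_le_iff)
    with \<open>d > 0\<close> show "\<exists>d>0. \<forall>s t. a \<le> s \<and> s \<le> t \<and> t \<le> b \<and> t - s \<le> d \<longrightarrow> - e * (W t - W s) \<le> - k t - - k s"
      by blast
  qed
  ultimately show ?thesis by (simp add: k_def)
qed

lemma has_weak_deriv_on_indefinite_integral:
  assumes T: "0 \<le> T" and h: "h absolutely_integrable_on {0..T}"
    and g: "\<And>t. t \<in> {0..T} \<Longrightarrow> g t = g 0 + integral {0..t} h"
  shows "has_weak_deriv_on T g h"
  unfolding has_weak_deriv_on_def
proof (intro conjI allI impI)
  have hi: "h integrable_on {0..T}" using h by (simp add: absolutely_integrable_on_def)
  have "continuous_on {0..T} (\<lambda>t. g 0 + integral {0..t} h)"
    by (rule continuous_on_add[OF continuous_on_const indefinite_integral_continuous_1[OF hi]])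
  then have gc: "continuous_on {0..T} g"
    by (rule continuous_on_eq) (rule g[symmetric])
  then show gi: "set_integrable lebesgue {0..T} g"
    by (rule absolutely_integrable_continuous_real)
  fix \<phi> :: "real \<Rightarrow> real" assume \<phi>: "test_function {0<..<T} \<phi>"
  have d: "(\<phi> has_real_derivative deriv \<phi> t) (at t)" for t
    using \<phi> unfolding test_function_def by (simp add: DERIV_deriv_iff_real_differentiable)
  have fd: "frechet_derivative \<phi> (at t) 1 = deriv \<phi> t" for t
    using frechet_derivative_at[OF d[of t, unfolded has_field_derivative_def]]
    by (metis mult.right_neutral)
  have dc: "continuous_on S (deriv \<phi>)" for S
    using \<phi> continuous_on_subset unfolding test_function_def fd[symmetric] by blast
  have z: "\<phi> 0 = 0" "\<phi> T = 0"
    using \<phi> unfolding test_function_def by force+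
  have cc: "continuous_on {0..T} \<phi>"
    by (intro continuous_at_imp_continuous_on ballI) (rule DERIV_isCont[OF d])
  have a1: "(\<lambda>t. g t * deriv \<phi> t) absolutely_integrable_on {0..T}"
    by (intro absolutely_integrable_continuous_real continuous_intros gc dc)
  have a2: "(\<lambda>t. h t * \<phi> t) absolutely_integrable_on {0..T}"
    using abs_integrable_mult_continuous[OF h cc] by (simp add: mult.commute)
  have "integral {0..T} (\<lambda>t. h t * \<phi> t + g t * deriv \<phi> t) = 0"
    using integral_by_parts_indefinite[OF T h g d dc] z by simp
  then have "integral {0..T} (\<lambda>t. h t * \<phi> t) + integral {0..T} (\<lambda>t. g t * deriv \<phi> t) = 0"
    using a1 a2 by (subst (asm) integral_add) (auto simp: absolutely_integrable_on_def)
  then show "(LINT t:{0..T}|lebesgue. g t * deriv \<phi> t) = - (LINT t:{0..T}|lebesgue. h t * \<phi> t)"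
    using set_lebesgue_integral_eq_integral(2)[OF a1] set_lebesgue_integral_eq_integral(2)[OF a2]
    by simp
qed (use h in simp)

text \<open>Here \<open>b'\<close> is the velocity, \<open>c\<close> the force along the trajectory and \<open>H\<close> the energy.  The hypothesis on
\<open>H\<close> is the subgradient inequality of a convex energy: over \<open>{s..t}\<close> the gain of energy is at most the
work of the force frozen at the right end point, and on short intervals freezing costs little
because the force is continuous in time.\<close>

lemma energy_inequality:
  fixes b b' c :: "real \<Rightarrow> nat \<Rightarrow> real" and H :: "real \<Rightarrow> real"
  assumes T: "0 \<le> T"
    and b': "\<And>k. k < M \<Longrightarrow> (\<lambda>t. b' t k) absolutely_integrable_on {0..T}"
    and b: "\<And>k t. k < M \<Longrightarrow> t \<in> {0..T} \<Longrightarrow> b t k = integral {0..t} (\<lambda>s. b' s k)"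
    and c: "\<And>k. k < M \<Longrightarrow> continuous_on {0..T} (\<lambda>t. c t k)"
    and H: "\<And>s t. s \<in> {0..T} \<Longrightarrow> t \<in> {0..T} \<Longrightarrow> H t - H s \<le> (\<Sum>k<M. c t k * (b t k - b s k))"
  shows "H T - H 0 \<le> integral {0..T} (\<lambda>t. \<Sum>k<M. c t k * b' t k)"
proof -
  have b'i: "(\<lambda>t. b' t k) integrable_on {0..T}" "(\<lambda>t. \<bar>b' t k\<bar>) integrable_on {0..T}" if "k < M" for k
    using b'[OF that] by (auto simp: absolutely_integrable_on_def)
  have ci: "(\<lambda>t. c t k * b' t k) integrable_on {0..T}" if "k < M" for k
    using abs_integrable_mult_continuous[OF b'[OF that] c[OF that]]
    by (simp add: absolutely_integrable_on_def)
  have power: "(\<lambda>t. \<Sum>k<M. c t k * b' t k) integrable_on {0..T}"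
    by (intro integrable_sum ci) auto
  have total: "(\<lambda>t. \<Sum>k<M. \<bar>b' t k\<bar>) integrable_on {0..T}"
    by (intro integrable_sum b'i) auto
  define k where "k = (\<lambda>t. integral {0..t} (\<lambda>t. \<Sum>k<M. c t k * b' t k) - H t)"
  define W where "W = (\<lambda>t. integral {0..t} (\<lambda>t. \<Sum>k<M. \<bar>b' t k\<bar>))"
  have "k 0 \<le> k T"
  proof (rule le_by_small_increments[where W = W, OF T])
    fix e :: real assume e: "e > 0"
    have "\<exists>d>0. \<forall>s\<in>{0..T}. \<forall>t\<in>{0..T}. \<bar>s - t\<bar> < d \<longrightarrow> \<bar>c s j - c t j\<bar> \<le> e" if "j < M" for j
    proof -
      have "uniformly_continuous_on {0..T} (\<lambda>t. c t j)"
        using c[OF that] by (auto intro: compact_uniformly_continuous)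
      from uniformly_continuous_onE[OF this e] show ?thesis
        by (metis dist_real_def less_imp_le)
    qed
    then obtain d where d: "\<And>j. j < M \<Longrightarrow> d j > 0"
      "\<And>j s t. j < M \<Longrightarrow> s \<in> {0..T} \<Longrightarrow> t \<in> {0..T} \<Longrightarrow> \<bar>s - t\<bar> < d j \<Longrightarrow> \<bar>c s j - c t j\<bar> \<le> e"
      by metis
    define D where "D = Min (insert 1 (d ` {..<M}))"
    have D: "D > 0" "\<And>j. j < M \<Longrightarrow> D \<le> d j" using d(1) by (auto simp: D_def)
    have "- e * (W t - W s) \<le> k t - k s" if A: "0 \<le> s \<and> s \<le> t \<and> t \<le> T \<and> t - s \<le> D / 2" for s t
    proof -
      have sub: "{s..t} \<subseteq> {0..T}" using A by auto
      note i = integrable_subinterval_real[OF _ sub]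
      have ic: "(\<lambda>\<tau>. \<Sum>j<M. c t j * b' \<tau> j) integrable_on {s..t}"
        by (intro integrable_sum integrable_on_mult_right i b'i) auto
      have "H t - H s \<le> (\<Sum>j<M. c t j * (b t j - b s j))"
        using A by (intro H) auto
      also have "\<dots> = (\<Sum>j<M. c t j * integral {s..t} (\<lambda>\<tau>. b' \<tau> j))"
        using A by (intro sum.cong refl) (simp add: b integral_diff_interval[OF b'i(1), of _ s t])
      also have "\<dots> = integral {s..t} (\<lambda>\<tau>. \<Sum>j<M. c t j * b' \<tau> j)"
        by (subst integral_sum) (auto intro!: integrable_on_mult_right i b'i)
      finally have *: "H t - H s \<le> integral {s..t} (\<lambda>\<tau>. \<Sum>j<M. c t j * b' \<tau> j)" .
      have "- e * (W t - W s) = integral {s..t} (\<lambda>\<tau>. - e * (\<Sum>j<M. \<bar>b' \<tau> j\<bar>))"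
        using integral_diff_interval[OF total, of s t] A by (simp add: W_def)
      also have "\<dots> \<le> integral {s..t} (\<lambda>\<tau>. (\<Sum>j<M. c \<tau> j * b' \<tau> j) - (\<Sum>j<M. c t j * b' \<tau> j))"
      proof (rule integral_le)
        fix \<tau> assume \<tau>: "\<tau> \<in> {s..t}"
        have "- (e * \<bar>b' \<tau> j\<bar>) \<le> c \<tau> j * b' \<tau> j - c t j * b' \<tau> j" if "j < M" for j
        proof -
          have "\<bar>c \<tau> j - c t j\<bar> \<le> e" using that \<tau> A D(1) D(2)[OF that] by (intro d(2)) auto
          then have "\<bar>(c \<tau> j - c t j) * b' \<tau> j\<bar> \<le> e * \<bar>b' \<tau> j\<bar>"
            unfolding abs_mult by (rule mult_right_mono) simp
          then show ?thesis by (simp add: left_diff_distrib abs_le_iff)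
        qed
        then have "(\<Sum>j<M. - (e * \<bar>b' \<tau> j\<bar>)) \<le> (\<Sum>j<M. c \<tau> j * b' \<tau> j - c t j * b' \<tau> j)"
          by (intro sum_mono) auto
        then show "- e * (\<Sum>j<M. \<bar>b' \<tau> j\<bar>) \<le> (\<Sum>j<M. c \<tau> j * b' \<tau> j) - (\<Sum>j<M. c t j * b' \<tau> j)"
          by (simp add: sum_negf sum_subtractf sum_distrib_left)
      qed (intro integrable_on_mult_right integrable_diff i[OF total] i[OF power] ic)+
      also have "\<dots> = integral {s..t} (\<lambda>\<tau>. \<Sum>j<M. c \<tau> j * b' \<tau> j) - integral {s..t} (\<lambda>\<tau>. \<Sum>j<M. c t j * b' \<tau> j)"
        by (rule integral_diff[OF i[OF power] ic])
      also have "\<dots> \<le> k t - k s"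
        using integral_diff_interval[OF power, of s t] A * by (simp add: k_def)
      finally show ?thesis .
    qed
    with D(1) show "\<exists>d>0. \<forall>s t. 0 \<le> s \<and> s \<le> t \<and> t \<le> T \<and> t - s \<le> d \<longrightarrow> - e * (W t - W s) \<le> k t - k s"
      by (intro exI[of _ "D / 2"]) auto
  qed
  then show ?thesis by (simp add: k_def)
qed

section \<open>Global solutions of differential equations with integrable forcing\<close>

lemma continuous_on_componentwise_lipschitz:
  fixes F :: "(nat \<Rightarrow> real) \<Rightarrow> real" and x :: "real \<Rightarrow> nat \<Rightarrow> real"
  assumes L: "\<And>v w e. (\<And>j. j < N \<Longrightarrow> \<bar>v j - w j\<bar> \<le> e) \<Longrightarrow> 0 \<le> e \<Longrightarrow> \<bar>F v - F w\<bar> \<le> L * e"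
    and x: "\<And>j. j < N \<Longrightarrow> continuous_on S (\<lambda>t. x t j)"
  shows "continuous_on S (\<lambda>t. F (x t))"
  unfolding continuous_on_def
proof
  fix s assume s: "s \<in> S"
  have "((\<lambda>t. L * (\<Sum>j<N. \<bar>x t j - x s j\<bar>)) \<longlongrightarrow> L * (\<Sum>j<N. \<bar>x s j - x s j\<bar>)) (at s within S)"
    using x s by (intro tendsto_intros) (auto simp: continuous_on_def)
  then have lim: "((\<lambda>t. L * (\<Sum>j<N. \<bar>x t j - x s j\<bar>)) \<longlongrightarrow> 0) (at s within S)" by simp
  have "\<bar>F (x t) - F (x s)\<bar> \<le> L * (\<Sum>j<N. \<bar>x t j - x s j\<bar>)" for t
    by (intro L member_le_sum[of _ "{..<N}" "\<lambda>j. \<bar>x t j - x s j\<bar>"] sum_nonneg) auto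
  then have "((\<lambda>t. F (x t) - F (x s)) \<longlongrightarrow> 0) (at s within S)"
    by (intro Lim_null_comparison[OF _ lim]) auto
  then show "((\<lambda>t. F (x t)) \<longlongrightarrow> F (x s)) (at s within S)"
    by (simp add: LIM_zero_iff)
qed

text \<open>Banach's fixed point theorem for \<open>z(t) = exp (- l t) x(t)\<close>: with weight \<open>l\<close> large compared with the
Lipschitz constant the integral operator halves distances on the whole interval, so that no
continuation of local solutions is needed.  The number \<open>N\<close> of components is a variable and not a
type, so a system is encoded as one bounded continuous function on \<open>real \<times> real\<close> whose second
argument is the component index; between the integers it is interpolated by tent functions.\<close>

lemma caratheodory_solution_exists:
  fixes F :: "(nat \<Rightarrow> real) \<Rightarrow> nat \<Rightarrow> real" and g :: "real \<Rightarrow> nat \<Rightarrow> real"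
  assumes T: "0 \<le> T"
    and L: "\<And>v w i e. i < N \<Longrightarrow> (\<And>j. j < N \<Longrightarrow> \<bar>v j - w j\<bar> \<le> e) \<Longrightarrow> 0 \<le> e \<Longrightarrow> \<bar>F v i - F w i\<bar> \<le> L * e"
    and g: "\<And>i. i < N \<Longrightarrow> (\<lambda>t. g t i) integrable_on {0..T}"
  obtains x where "\<And>i. i < N \<Longrightarrow> continuous_on {0..T} (\<lambda>t. x t i)"
    and "\<And>i t. i < N \<Longrightarrow> t \<in> {0..T} \<Longrightarrow> x t i = integral {0..t} (\<lambda>s. F (x s) i + g s i)"
proof -
  \<comment> \<open>the contraction constant is \<open>N * \<bar>L\<bar> / l\<close>; the summand 1 keeps \<open>l\<close> positive\<close>
  define l where "l = 2 * real N * \<bar>L\<bar> + 1"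
  have l: "l > 0" by (simp add: l_def add_nonneg_pos)
  define v where "v = (\<lambda>(z :: (real \<times> real) \<Rightarrow>\<^sub>C real) s j. exp (l * s) * z (s, real j))"
  define cl where "cl = (\<lambda>t. max 0 (min t T))"
  have cl: "cl t \<in> {0..T}" for t using T by (auto simp: cl_def)
  define tent where "tent = (\<lambda>r i. max 0 (1 - \<bar>r - real i\<bar>))"
  have tent: "0 \<le> tent r i" "tent r i \<le> 1" "tent (real j) i = of_bool (i = j)" for r i j
    by (auto simp: tent_def)
  define J where "J = (\<lambda>z i t. exp (- l * t) * integral {0..t} (\<lambda>s. F (v z s) i + g s i))"
  define Psi where "Psi = (\<lambda>z p. \<Sum>i<N. tent (snd p) i * J z i (cl (fst p)))"
  have vc: "continuous_on S (\<lambda>s. v z s j)" for z j S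
    unfolding v_def
    by (intro continuous_intros continuous_on_compose2[OF continuous_on_apply_bcontfun[of UNIV]]) auto
  have Fc: "continuous_on S (\<lambda>s. F (v z s) i)" if "i < N" for z i S
    by (rule continuous_on_componentwise_lipschitz[where N = N and L = L]) (use L that vc in auto)
  have Fi: "(\<lambda>s. F (v z s) i) integrable_on {0..t}" if "i < N" for z i t
    by (intro integrable_continuous_real Fc that)
  have gi: "(\<lambda>s. g s i) integrable_on {0..t}" if "i < N" "t \<in> {0..T}" for i t
    using that by (intro integrable_subinterval_real[OF g]) auto
  have int: "(\<lambda>s. F (v z s) i + g s i) integrable_on {0..t}" if "i < N" "t \<in> {0..T}" for z i t
    by (intro integrable_add Fi gi that)
  have J: "continuous_on {0..T} (J z i)" if "i < N" for z i
    unfolding J_def using that T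
    by (intro continuous_on_mult continuous_on_exp continuous_on_id continuous_on_const
        indefinite_integral_continuous_1 int) auto
  have Jb: "\<exists>B. \<forall>t\<in>{0..T}. \<bar>J z i t\<bar> \<le> B" if "i < N" for z i
    using compact_imp_bounded[OF compact_continuous_image[OF J[OF that, of z] compact_Icc]]
    by (auto simp: bounded_iff)
  have Psi: "Psi z \<in> bcontfun" for z
    unfolding bcontfun_def
  proof safe
    have "continuous_on UNIV (\<lambda>p::real \<times> real. cl (fst p))"
      unfolding cl_def by (intro continuous_intros)
    then have "continuous_on UNIV (\<lambda>p::real \<times> real. J z i (cl (fst p)))" if "i < N" for i
      using continuous_on_compose2[OF J[OF that, of z]] cl by blast
    moreover have "continuous_on UNIV (\<lambda>p::real \<times> real. tent (snd p) i)" for i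
      unfolding tent_def by (intro continuous_intros)
    ultimately show "continuous_on UNIV (Psi z)"
      unfolding Psi_def by (intro continuous_on_sum continuous_on_mult) auto
    obtain B where B: "\<And>i t. i < N \<Longrightarrow> t \<in> {0..T} \<Longrightarrow> \<bar>J z i t\<bar> \<le> B i"
      using Jb[of _ z] by metis
    have "norm (Psi z p) \<le> (\<Sum>i<N. 1 * B i)" for p
      unfolding Psi_def
      by (rule sum_norm_le, unfold norm_mult, intro mult_mono) (use B cl tent(1,2) in auto)
    then show "bounded (range (Psi z))" by (auto simp: bounded_iff)
  qed
  define \<Phi> where "\<Phi> = (\<lambda>z. Bcontfun (Psi z))"
  have \<Phi>: "apply_bcontfun (\<Phi> z) = Psi z" for z
    unfolding \<Phi>_def by (rule Bcontfun_inverse[OF Psi])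
  have Jcontr: "\<bar>J z i t - J z' i t\<bar> \<le> \<bar>L\<bar> / l * dist z z'" if i: "i < N" and t: "t \<in> {0..T}" for z z' i t
  proof -
    have "\<bar>J z i t - J z' i t\<bar> = exp (- l * t) * \<bar>integral {0..t} (\<lambda>s. F (v z s) i + g s i)
             - integral {0..t} (\<lambda>s. F (v z' s) i + g s i)\<bar>"
      by (simp add: J_def abs_mult flip: right_diff_distrib)
    also have "integral {0..t} (\<lambda>s. F (v z s) i + g s i) - integral {0..t} (\<lambda>s. F (v z' s) i + g s i)
        = integral {0..t} (\<lambda>s. F (v z s) i - F (v z' s) i)"
      by (subst integral_diff[symmetric, OF int[OF i t] int[OF i t]]) simp
    also have "\<bar>\<dots>\<bar> \<le> integral {0..t} (\<lambda>s. \<bar>L\<bar> * dist z z' * exp (l * s))"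
    proof (rule integral_norm_bound_integral[where f = "\<lambda>s. F (v z s) i - F (v z' s) i", unfolded real_norm_def])
      fix s assume s: "s \<in> {0..t}"
      have "\<bar>v z s j - v z' s j\<bar> \<le> exp (l * s) * dist z z'" for j
        using dist_bounded[of z "(s, real j)" z']
        by (simp add: v_def abs_mult dist_real_def flip: right_diff_distrib)
      then have "\<bar>F (v z s) i - F (v z' s) i\<bar> \<le> L * (exp (l * s) * dist z z')"
        by (intro L i) auto
      also have "\<dots> \<le> \<bar>L\<bar> * (exp (l * s) * dist z z')"
        by (intro mult_right_mono) auto
      finally show "\<bar>F (v z s) i - F (v z' s) i\<bar> \<le> \<bar>L\<bar> * dist z z' * exp (l * s)"
        by (simp add: mult_ac)
    qed (intro integrable_diff Fi i integrable_continuous_real continuous_intros)+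
    also have "integral {0..t} (\<lambda>s. \<bar>L\<bar> * dist z z' * exp (l * s)) = \<bar>L\<bar> * dist z z' * ((exp (l * t) - 1) / l)"
    proof -
      have "((\<lambda>s. exp (l * s)) has_integral (exp (l * t) / l - exp (l * 0) / l)) {0..t}"
        using t l by (intro fundamental_theorem_of_calculus)
          (auto simp flip: has_real_derivative_iff_has_vector_derivative intro!: derivative_eq_intros)
      then have "integral {0..t} (\<lambda>s. exp (l * s)) = (exp (l * t) - 1) / l"
        using integral_unique[of "\<lambda>s. exp (l * s)"] by (simp add: diff_divide_distrib)
      then show ?thesis by simp
    qed
    finally have "\<bar>J z i t - J z' i t\<bar> \<le> exp (- l * t) * (\<bar>L\<bar> * dist z z' * ((exp (l * t) - 1) / l))"
      by simp
    also have "\<dots> = \<bar>L\<bar> / l * dist z z' * (1 - exp (- l * t))"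
      using l by (simp add: field_simps exp_minus)
    also have "\<dots> \<le> \<bar>L\<bar> / l * dist z z' * 1"
      using l by (intro mult_left_mono) auto
    finally show ?thesis by simp
  qed
  have contr: "dist (\<Phi> z) (\<Phi> z') \<le> 1/2 * dist z z'" for z z'
  proof (rule dist_bound)
    fix p :: "real \<times> real"
    have "dist (\<Phi> z p) (\<Phi> z' p) = \<bar>\<Sum>i<N. tent (snd p) i * (J z i (cl (fst p)) - J z' i (cl (fst p)))\<bar>"
      by (simp add: \<Phi> Psi_def dist_real_def right_diff_distrib sum_subtractf)
    also have "\<dots> \<le> (\<Sum>i<N. 1 * (\<bar>L\<bar> / l * dist z z'))"
      by (rule sum_norm_le[where 'a = real, unfolded real_norm_def], unfold abs_mult, intro mult_mono)
        (use Jcontr cl tent(1,2) in auto)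
    also have "\<dots> = (real N * \<bar>L\<bar> / l) * dist z z'" by simp
    also have "\<dots> \<le> 1/2 * dist z z'"
    proof (rule mult_right_mono)
      show "real N * \<bar>L\<bar> / l \<le> 1/2" using l by (simp add: field_simps) (simp add: l_def)
    qed simp
    finally show "dist (\<Phi> z p) (\<Phi> z' p) \<le> 1/2 * dist z z'" .
  qed
  obtain z where z: "\<Phi> z = z"
    using banach_fix_type[of "1/2" \<Phi>] contr by auto
  show thesis
  proof (rule that[of "v z"])
    fix i t assume i: "i < N" and t: "t \<in> {0..T}"
    have "cl t = t" using t by (auto simp: cl_def)
    then have "z (t, real i) = (\<Sum>j<N. of_bool (j = i) * J z j t)"
      using fun_cong[OF \<Phi>[of z], of "(t, real i)"] by (simp add: z Psi_def tent(3))
    also have "\<dots> = J z i t"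
      using i by (simp add: of_bool_def if_distrib[of "\<lambda>x. x * _"] sum.delta cong: if_cong)
    finally have "v z t i = exp (l * t) * J z i t"
      by (simp add: v_def)
    then show "v z t i = integral {0..t} (\<lambda>s. F (v z s) i + g s i)"
      by (simp add: J_def flip: mult.assoc exp_add)
  qed (rule vc)
qed

section \<open>Magnetic energy as a convex potential\<close>

text \<open>The constant 3 is the sum of three contributions: the change of the vector at fixed factor, the change
of \<open>n s * s\<close>, and the change of \<open>s\<close> at fixed factor.  The vector \<open>v = 0\<close> is treated separately because
\<open>n 0\<close> is not controlled by the Lipschitz constant.\<close>

lemma scaling_lipschitz:
  fixes v w :: "'a::real_inner" and n :: "real \<Rightarrow> real"
  assumes nonneg: "\<And>s. 0 \<le> s \<Longrightarrow> 0 \<le> n s"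
    and lip: "\<And>s t. 0 \<le> s \<Longrightarrow> 0 \<le> t \<Longrightarrow> \<bar>n s * s - n t * t\<bar> \<le> L * \<bar>s - t\<bar>"
  shows "norm (n (norm v) *\<^sub>R v - n (norm w) *\<^sub>R w) \<le> 3 * L * norm (v - w)"
proof (cases "v = 0")
  case True
  have "norm (n (norm w) *\<^sub>R w) \<le> L * norm w"
    using lip[of "norm w" 0] nonneg[of "norm w"] by (simp add: abs_mult)
  moreover have "0 \<le> L * norm w" using order_trans[OF abs_ge_zero lip[of "norm w" 0]] by simp
  ultimately show ?thesis using True by simp
next
  case False
  let ?a = "n (norm v)" and ?b = "n (norm w)"
  have a: "?a \<le> L"
    using lip[of "norm v" 0] nonneg[of "norm v"] False by (simp add: abs_mult)
  have L: "0 \<le> L" using a nonneg[of "norm v"] by simp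
  have d: "\<bar>norm w - norm v\<bar> \<le> norm (v - w)"
    by (metis norm_minus_commute norm_triangle_ineq3)
  have "?a *\<^sub>R v - ?b *\<^sub>R w = ?a *\<^sub>R (v - w) + (?a - ?b) *\<^sub>R w"
    by (simp add: algebra_simps)
  then have "norm (?a *\<^sub>R v - ?b *\<^sub>R w) \<le> norm (?a *\<^sub>R (v - w)) + norm ((?a - ?b) *\<^sub>R w)"
    using norm_triangle_ineq by metis
  also have "norm ((?a - ?b) *\<^sub>R w) = \<bar>(?a * norm v - ?b * norm w) + ?a * (norm w - norm v)\<bar>"
  proof -
    have "norm ((?a - ?b) *\<^sub>R w) = \<bar>(?a - ?b) * norm w\<bar>" by (simp add: abs_mult)
    then show ?thesis by (simp add: algebra_simps)
  qed
  also have "\<dots> \<le> \<bar>?a * norm v - ?b * norm w\<bar> + \<bar>?a * (norm w - norm v)\<bar>"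
    by (rule abs_triangle_ineq)
  also have "\<bar>?a * norm v - ?b * norm w\<bar> \<le> L * norm (v - w)"
    by (rule order_trans[OF lip]) (use d L in \<open>auto intro!: mult_left_mono simp: abs_minus_commute\<close>)
  also have "\<bar>?a * (norm w - norm v)\<bar> \<le> L * norm (v - w)"
    unfolding abs_mult using a d L nonneg[of "norm v"] by (intro mult_mono) auto
  also have "norm (?a *\<^sub>R (v - w)) \<le> L * norm (v - w)"
    using a nonneg[of "norm v"] by (simp add: mult_right_mono)
  finally show ?thesis by simp
qed

text \<open>The form \<open>(\<nu>(\<bar>F\<bar>) F, \<phi>)\<close> on fields \<open>F\<close> spanned by \<open>\<phi> 0, \<dots>, \<phi> (M - 1)\<close>.  The assumption on \<open>\<Theta>\<close> is the
subgradient inequality; it makes \<open>\<Theta> x\<close> a convex potential of \<open>s \<mapsto> nu x s * s\<close> without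
mentioning derivatives or integrals.\<close>

locale reluctivity_form =
  fixes S :: "'a::euclidean_space set" and nu \<Theta> :: "'a \<Rightarrow> real \<Rightarrow> real"
    and \<phi> :: "nat \<Rightarrow> 'a \<Rightarrow> 'b::euclidean_space" and M :: nat and L N0 :: real
  assumes S: "S \<in> lmeasurable"
    and nu_nonneg: "\<And>x s. 0 \<le> s \<Longrightarrow> 0 \<le> nu x s"
    and nu_le: "\<And>x s. 0 \<le> s \<Longrightarrow> nu x s \<le> N0"
    and nu_lip: "\<And>x s t. 0 \<le> s \<Longrightarrow> 0 \<le> t \<Longrightarrow> \<bar>nu x s * s - nu x t * t\<bar> \<le> L * \<bar>s - t\<bar>"
    and \<Theta>_convex: "\<And>x s t. 0 \<le> s \<Longrightarrow> 0 \<le> t \<Longrightarrow> nu x s * s * (t - s) \<le> \<Theta> x t - \<Theta> x s"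
    and \<Theta>_0: "\<And>x. \<Theta> x 0 = 0"
    and nu_meas: "\<And>w :: 'a \<Rightarrow> 'b. w \<in> borel_measurable borel \<Longrightarrow> (\<lambda>x. nu x (norm (w x))) \<in> borel_measurable borel"
    and \<Theta>_meas: "\<And>w :: 'a \<Rightarrow> 'b. w \<in> borel_measurable borel \<Longrightarrow> (\<lambda>x. \<Theta> x (norm (w x))) \<in> borel_measurable borel"
    and \<phi>_meas [measurable]: "\<And>k. \<phi> k \<in> borel_measurable borel"
    and \<phi>_bounded: "\<And>k. \<exists>B. \<forall>x\<in>S. norm (\<phi> k x) \<le> B"
begin

definition field :: "(nat \<Rightarrow> real) \<Rightarrow> 'a \<Rightarrow> 'b" where
  "field b x = (\<Sum>j<M. b j *\<^sub>R \<phi> j x)"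

definition flux :: "(nat \<Rightarrow> real) \<Rightarrow> nat \<Rightarrow> real" where
  "flux b k = (LINT x:S|lebesgue. nu x (norm (field b x)) * inner (field b x) (\<phi> k x))"

definition energy :: "(nat \<Rightarrow> real) \<Rightarrow> real" where
  "energy b = (LINT x:S|lebesgue. \<Theta> x (norm (field b x)))"

lemma L_nonneg: "0 \<le> L"
  using order_trans[OF abs_ge_zero nu_lip[of 1 0 undefined]] by simp

lemma set_integrable_bounded:
  assumes "f \<in> borel_measurable borel" "\<And>x. x \<in> S \<Longrightarrow> \<bar>f x\<bar> \<le> B"
  shows "set_integrable lebesgue S (f :: 'a \<Rightarrow> real)"
  unfolding set_integrable_def
  by (rule integrableI_bounded_set_indicator[where B = B])
    (use S assms in \<open>auto simp: fmeasurable_def intro: measurable_completion\<close>)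

lemma field_meas [measurable]: "field b \<in> borel_measurable borel"
  unfolding field_def[abs_def] by measurable

lemma field_diff: "field b x - field c x = field (\<lambda>j. b j - c j) x"
  by (simp add: field_def scaleR_diff_left sum_subtractf)

lemma \<phi>_bound:
  obtains B where "\<And>k x. k < M \<Longrightarrow> x \<in> S \<Longrightarrow> norm (\<phi> k x) \<le> B" "0 \<le> B"
proof -
  obtain B where B: "\<And>k x. x \<in> S \<Longrightarrow> norm (\<phi> k x) \<le> B k" using \<phi>_bounded by metis
  have "norm (\<phi> k x) \<le> (\<Sum>k<M. \<bar>B k\<bar>)" if "k < M" "x \<in> S" for k x
  proof -
    have "norm (\<phi> k x) \<le> \<bar>B k\<bar>" using B[OF that(2), of k] by simp
    also have "\<dots> \<le> (\<Sum>k<M. \<bar>B k\<bar>)"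
      using that by (intro member_le_sum[of _ "{..<M}" "\<lambda>k. \<bar>B k\<bar>"]) auto
    finally show ?thesis .
  qed
  then show thesis by (rule that) (auto intro: sum_nonneg)
qed

lemma field_bound:
  assumes "\<And>k x. k < M \<Longrightarrow> x \<in> S \<Longrightarrow> norm (\<phi> k x) \<le> B" "0 \<le> B" "x \<in> S"
    and "\<And>j. j < M \<Longrightarrow> \<bar>b j\<bar> \<le> e" "0 \<le> e"
  shows "norm (field b x) \<le> real M * (e * B)"
proof -
  have "norm (field b x) \<le> (\<Sum>j<M. e * B)"
    unfolding field_def
    by (rule sum_norm_le, unfold norm_scaleR, intro mult_mono) (use assms in auto)
  then show ?thesis by simp
qed

lemma field_bounded: "\<exists>B\<ge>0. \<forall>x\<in>S. norm (field b x) \<le> B"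
proof -
  obtain B where B: "\<And>k x. k < M \<Longrightarrow> x \<in> S \<Longrightarrow> norm (\<phi> k x) \<le> B" "0 \<le> B"
    using \<phi>_bound by blast
  have "\<bar>b j\<bar> \<le> (\<Sum>j<M. \<bar>b j\<bar>)" if "j < M" for j
    using that by (intro member_le_sum[of _ "{..<M}" "\<lambda>j. \<bar>b j\<bar>"]) auto
  then have "norm (field b x) \<le> real M * ((\<Sum>j<M. \<bar>b j\<bar>) * B)" if "x \<in> S" for x
    by (intro field_bound[OF B that]) (auto intro: sum_nonneg)
  then show ?thesis using B(2) by (intro exI[of _ "real M * ((\<Sum>j<M. \<bar>b j\<bar>) * B)"]) (auto intro!: mult_nonneg_nonneg sum_nonneg)
qed

lemma form_integrable:
  fixes f g :: "'a \<Rightarrow> 'b"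
  assumes [measurable]: "f \<in> borel_measurable borel" "g \<in> borel_measurable borel"
    and f: "\<exists>B\<ge>0. \<forall>x\<in>S. norm (f x) \<le> B" and g: "\<exists>B. \<forall>x\<in>S. norm (g x) \<le> B"
  shows "set_integrable lebesgue S (\<lambda>x. nu x (norm (field b x)) * inner (f x) (g x))"
proof -
  obtain B1 B2 where B: "B1 \<ge> 0" "\<And>x. x \<in> S \<Longrightarrow> norm (f x) \<le> B1" "\<And>x. x \<in> S \<Longrightarrow> norm (g x) \<le> B2"
    using f g by blast
  have [measurable]: "(\<lambda>x. nu x (norm (field b x))) \<in> borel_measurable borel"
    by (rule nu_meas) simp
  show ?thesis
  proof (rule set_integrable_bounded[where B = "N0 * (B1 * B2)"])
    show "(\<lambda>x. nu x (norm (field b x)) * inner (f x) (g x)) \<in> borel_measurable borel" by measurable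
    fix x assume x: "x \<in> S"
    have "\<bar>inner (f x) (g x)\<bar> \<le> norm (f x) * norm (g x)" by (rule Cauchy_Schwarz_ineq2)
    also have "\<dots> \<le> B1 * B2" using B x by (intro mult_mono) auto
    finally show "\<bar>nu x (norm (field b x)) * inner (f x) (g x)\<bar> \<le> N0 * (B1 * B2)"
      unfolding abs_mult using nu_nonneg[of "norm (field b x)" x] nu_le[of "norm (field b x)" x]
      by (intro mult_mono) auto
  qed
qed

lemma flux_sum:
  assumes "k < M"
  shows "(\<Sum>l<M. (LINT x:S|lebesgue. nu x (norm (field b x)) * inner (\<phi> l x) (\<phi> k x)) * b l) = flux b k"
proof -
  have i: "set_integrable lebesgue S (\<lambda>x. nu x (norm (field b x)) * inner (\<phi> l x) (\<phi> k x))" for l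
  proof (rule form_integrable)
    obtain B where "\<forall>x\<in>S. norm (\<phi> l x) \<le> B" using \<phi>_bounded by blast
    then show "\<exists>B\<ge>0. \<forall>x\<in>S. norm (\<phi> l x) \<le> B" by (intro exI[of _ "max 0 B"]) auto
  qed (use \<phi>_bounded in auto)
  have "(LINT x:S|lebesgue. (\<Sum>l<n. nu x (norm (field b x)) * inner (\<phi> l x) (\<phi> k x) * b l))
     = (\<Sum>l<n. (LINT x:S|lebesgue. nu x (norm (field b x)) * inner (\<phi> l x) (\<phi> k x)) * b l)
    \<and> set_integrable lebesgue S (\<lambda>x. \<Sum>l<n. nu x (norm (field b x)) * inner (\<phi> l x) (\<phi> k x) * b l)" for n
  proof (induction n)
    case 0
    show ?case by (simp add: set_lebesgue_integral_def set_integrable_def)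
  next
    case (Suc n)
    have "set_integrable lebesgue S (\<lambda>x. nu x (norm (field b x)) * inner (\<phi> n x) (\<phi> k x) * b n)"
      using i[of n] by (simp add: set_integrable_mult_left)
    with Suc show ?case by (simp add: set_integral_add)
  qed
  then have "(\<Sum>l<M. (LINT x:S|lebesgue. nu x (norm (field b x)) * inner (\<phi> l x) (\<phi> k x)) * b l)
     = (LINT x:S|lebesgue. (\<Sum>l<M. nu x (norm (field b x)) * inner (\<phi> l x) (\<phi> k x) * b l))"
    by simp
  also have "\<dots> = flux b k"
    unfolding flux_def field_def
    by (simp add: inner_sum_left sum_distrib_left mult_ac)
  finally show ?thesis .
qed

lemma flux_integrable:
  "set_integrable lebesgue S (\<lambda>x. nu x (norm (field b x)) * inner (field b x) (\<phi> k x))"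
  by (rule form_integrable) (use field_bounded \<phi>_bounded in auto)

lemma flux_lipschitz:
  "\<exists>K. \<forall>k<M. \<forall>b c e. (\<forall>j<M. \<bar>b j - c j\<bar> \<le> e) \<longrightarrow> 0 \<le> e \<longrightarrow> \<bar>flux b k - flux c k\<bar> \<le> K * e"
proof -
  obtain B where B: "\<And>k x. k < M \<Longrightarrow> x \<in> S \<Longrightarrow> norm (\<phi> k x) \<le> B" "0 \<le> B"
    using \<phi>_bound by blast
  define K where "K = 3 * L * (real M * B) * B * measure lebesgue S"
  have "\<bar>flux b k - flux c k\<bar> \<le> K * e"
    if k: "k < M" and bc: "\<And>j. j < M \<Longrightarrow> \<bar>b j - c j\<bar> \<le> e" and e: "0 \<le> e" for b c k e
  proof -
    let ?D = "\<lambda>x. nu x (norm (field b x)) * inner (field b x) (\<phi> k x) - nu x (norm (field c x)) * inner (field c x) (\<phi> k x)"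
    have i: "set_integrable lebesgue S ?D"
      by (intro set_integral_diff(1) flux_integrable)
    have "flux b k - flux c k = (LINT x:S|lebesgue. ?D x)"
      unfolding flux_def by (rule set_integral_diff(2)[symmetric]) (rule flux_integrable)+
    then have "\<bar>flux b k - flux c k\<bar> = \<bar>LINT x:S|lebesgue. ?D x\<bar>" by simp
    also have "\<dots> \<le> (LINT x:S|lebesgue. \<bar>?D x\<bar>)"
      using set_integral_norm_bound[OF i] by simp
    also have "\<dots> \<le> (LINT x:S|lebesgue. 3 * L * (real M * (e * B)) * B)"
    proof (rule set_integral_mono)
      show "set_integrable lebesgue S (\<lambda>x. \<bar>?D x\<bar>)" using i by (rule set_integrable_abs)
      show "set_integrable lebesgue S (\<lambda>x. 3 * L * (real M * (e * B)) * B)"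
        by (rule set_integrable_bounded[where B = "\<bar>3 * L * (real M * (e * B)) * B\<bar>"]) auto
      fix x assume x: "x \<in> S"
      have "?D x = inner (nu x (norm (field b x)) *\<^sub>R field b x - nu x (norm (field c x)) *\<^sub>R field c x) (\<phi> k x)"
        by (simp add: inner_diff_left)
      also have "\<bar>\<dots>\<bar> \<le> norm (nu x (norm (field b x)) *\<^sub>R field b x - nu x (norm (field c x)) *\<^sub>R field c x) * norm (\<phi> k x)"
        by (rule Cauchy_Schwarz_ineq2)
      also have "\<dots> \<le> 3 * L * (real M * (e * B)) * B"
      proof (rule mult_mono)
        have "norm (nu x (norm (field b x)) *\<^sub>R field b x - nu x (norm (field c x)) *\<^sub>R field c x) \<le> 3 * L * norm (field b x - field c x)"
          by (rule scaling_lipschitz[of "nu x"]) (use nu_nonneg nu_lip in auto)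
        also have "\<dots> \<le> 3 * L * (real M * (e * B))"
          unfolding field_diff using L_nonneg field_bound[OF B x bc e] by (intro mult_left_mono) auto
        finally show "norm (nu x (norm (field b x)) *\<^sub>R field b x - nu x (norm (field c x)) *\<^sub>R field c x) \<le> \<dots>" .
      qed (use B k x L_nonneg e in auto)
      finally show "\<bar>?D x\<bar> \<le> 3 * L * (real M * (e * B)) * B" .
    qed
    also have "\<dots> = K * e"
      using S by (simp add: K_def set_lebesgue_integral_def fmeasurable_def)
    finally show ?thesis .
  qed
  then show ?thesis by blast
qed

lemma energy_integrable: "set_integrable lebesgue S (\<lambda>x. \<Theta> x (norm (field b x)))"
proof -
  obtain B where B: "0 \<le> B" "\<And>x. x \<in> S \<Longrightarrow> norm (field b x) \<le> B" using field_bounded by blast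
  show ?thesis
  proof (rule set_integrable_bounded[where B = "N0 * B * B"])
    show "(\<lambda>x. \<Theta> x (norm (field b x))) \<in> borel_measurable borel" by (rule \<Theta>_meas) simp
    fix x assume x: "x \<in> S"
    let ?s = "norm (field b x)"
    have "0 \<le> \<Theta> x ?s" using \<Theta>_convex[of 0 ?s x] by (simp add: \<Theta>_0)
    moreover have "\<Theta> x ?s \<le> nu x ?s * ?s * ?s" using \<Theta>_convex[of ?s 0 x] by (simp add: \<Theta>_0)
    moreover have "nu x ?s * ?s * ?s \<le> N0 * B * B"
      using nu_nonneg[of ?s x] nu_le[of ?s x] B x by (intro mult_mono mult_nonneg_nonneg) auto
    ultimately show "\<bar>\<Theta> x ?s\<bar> \<le> N0 * B * B" by simp
  qed
qed

lemma energy_nonneg: "0 \<le> energy b"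
  unfolding energy_def set_lebesgue_integral_def
  using \<Theta>_convex[of 0] by (intro integral_nonneg_AE) (auto simp: \<Theta>_0)

lemma energy_0: "energy (\<lambda>_. 0) = 0"
  by (simp add: energy_def field_def \<Theta>_0 set_lebesgue_integral_def)

text \<open>Pointwise, the one-dimensional subgradient inequality between \<open>\<bar>F\<^sub>c\<bar>\<close> and \<open>\<bar>F\<^sub>b\<bar>\<close> implies the one between the
vectors, since \<open>F\<^sub>c \<bullet> F\<^sub>b \<le> \<bar>F\<^sub>c\<bar> \<bar>F\<^sub>b\<bar>\<close> and the reluctivity is nonnegative.\<close>

lemma energy_convex: "energy c - energy b \<le> (\<Sum>k<M. flux c k * (c k - b k))"
proof -
  let ?p = "\<lambda>x. nu x (norm (field c x)) * inner (field c x) (field (\<lambda>j. c j - b j) x)"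
  have i: "set_integrable lebesgue S ?p"
    by (rule form_integrable) (use field_bounded[of c] field_bounded[of "\<lambda>j. c j - b j"] in auto)
  have "energy c - energy b = (LINT x:S|lebesgue. \<Theta> x (norm (field c x)) - \<Theta> x (norm (field b x)))"
    unfolding energy_def by (rule set_integral_diff(2)[symmetric]) (rule energy_integrable)+
  also have "\<dots> \<le> (LINT x:S|lebesgue. ?p x)"
  proof (rule set_integral_mono)
    fix x
    let ?c = "field c x" and ?b = "field b x"
    have "inner ?c ?b \<le> norm ?c * norm ?b" by (rule norm_cauchy_schwarz)
    then have "nu x (norm ?c) * inner ?c ?b \<le> nu x (norm ?c) * (norm ?c * norm ?b)"
      by (intro mult_left_mono nu_nonneg) auto
    moreover have "inner ?c ?c = norm ?c * norm ?c"
      by (simp add: dot_square_norm power2_eq_square)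
    ultimately show "\<Theta> x (norm ?c) - \<Theta> x (norm ?b) \<le> ?p x"
      using \<Theta>_convex[of "norm ?c" "norm ?b" x]
      by (simp add: inner_diff_right right_diff_distrib mult.assoc flip: field_diff)
  qed (intro set_integral_diff(1) energy_integrable i)+
  also have "\<dots> = (\<Sum>k<M. flux c k * (c k - b k))"
  proof -
    have "(LINT x:S|lebesgue. (\<Sum>k<n. nu x (norm (field c x)) * inner (field c x) (\<phi> k x) * (c k - b k)))
       = (\<Sum>k<n. flux c k * (c k - b k))
      \<and> set_integrable lebesgue S (\<lambda>x. \<Sum>k<n. nu x (norm (field c x)) * inner (field c x) (\<phi> k x) * (c k - b k))" for n
    proof (induction n)
      case 0
      show ?case by (simp add: set_lebesgue_integral_def set_integrable_def)
    next
      case (Suc n)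
      have "set_integrable lebesgue S (\<lambda>x. nu x (norm (field c x)) * inner (field c x) (\<phi> n x) * (c n - b n))"
        using flux_integrable[of c n] by (simp add: set_integrable_mult_left)
      with Suc show ?case by (simp add: set_integral_add flux_def)
    qed
    then have "(\<Sum>k<M. flux c k * (c k - b k))
      = (LINT x:S|lebesgue. (\<Sum>k<M. nu x (norm (field c x)) * inner (field c x) (\<phi> k x) * (c k - b k)))" by simp
    also have "\<dots> = (LINT x:S|lebesgue. ?p x)"
      by (simp add: field_def[of "\<lambda>j. c j - b j"] inner_sum_right sum_distrib_left mult_ac)
    finally show ?thesis by simp
  qed
  finally show ?thesis .
qed

end

section \<open>Face functions and the non-conducting rows of the stiffness matrix\<close>

lemma reluctivity_bounds:
  assumes "material_ok P"
  obtains LC where "0 < LC" "\<And>s. 0 \<le> s \<Longrightarrow> 0 \<le> nuC P s"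
    "\<And>s. 0 \<le> s \<Longrightarrow> nuC P s \<le> LC + nuC P 0"
    "\<And>s t. 0 \<le> s \<Longrightarrow> 0 \<le> t \<Longrightarrow> \<bar>nuC P s * s - nuC P t * t\<bar> \<le> LC * \<bar>s - t\<bar>"
    "\<And>s t. 0 \<le> s \<Longrightarrow> s \<le> t \<Longrightarrow> nuC P s * s \<le> nuC P t * t"
    "0 < nuI P"
proof -
  have "\<exists>mC>0. \<forall>\<zeta>\<ge>0. \<forall>\<eta>\<ge>0. (nuC P \<zeta> * \<zeta> - nuC P \<eta> * \<eta>) * (\<zeta> - \<eta>) \<ge> mC * (\<zeta> - \<eta>)\<^sup>2"
    and "\<exists>LC>0. \<forall>\<zeta>\<ge>0. \<forall>\<eta>\<ge>0. \<bar>nuC P \<zeta> * \<zeta> - nuC P \<eta> * \<eta>\<bar> \<le> LC * \<bar>\<zeta> - \<eta>\<bar>"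
    using assms by (simp_all only: material_ok_def)
  then obtain mC LC where mC: "mC > 0 \<and> (\<forall>\<zeta>\<ge>0. \<forall>\<eta>\<ge>0. (nuC P \<zeta> * \<zeta> - nuC P \<eta> * \<eta>) * (\<zeta> - \<eta>) \<ge> mC * (\<zeta> - \<eta>)\<^sup>2)"
    and LC: "LC > 0 \<and> (\<forall>\<zeta>\<ge>0. \<forall>\<eta>\<ge>0. \<bar>nuC P \<zeta> * \<zeta> - nuC P \<eta> * \<eta>\<bar> \<le> LC * \<bar>\<zeta> - \<eta>\<bar>)"
    by (elim exE)
  note m = conjunct1[OF mC] conjunct2[OF mC, rule_format]
  note L = conjunct1[OF LC] conjunct2[OF LC, rule_format]
  have p: "\<And>s. 0 \<le> s \<Longrightarrow> 0 \<le> nuC P s" "nuI P > 0"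
    using assms by (simp_all add: material_ok_def)
  have "nuC P s \<le> LC + nuC P 0" if "0 \<le> s" for s
  proof (cases "s = 0")
    case False
    then have "nuC P s \<le> LC" using L(2)[of s 0] that p(1)[of s] by (simp add: abs_mult)
    then show ?thesis using p(1)[of 0] by simp
  qed (use L in simp)
  moreover have "nuC P s * s \<le> nuC P t * t" if "0 \<le> s" "s \<le> t" for s t
  proof (cases "s = t")
    case False
    have "0 \<le> mC * (t - s)\<^sup>2" using m(1) by simp
    then have "0 \<le> (nuC P t * t - nuC P s * s) * (t - s)"
      using m(2)[of t s] that by linarith
    then show ?thesis using that False by (simp add: zero_le_mult_iff)
  qed simp
  ultimately show thesis using that[OF L(1) p(1) _ L(2) _ p(2)] by simp
qed

text \<open>The magnitude of the magnetic field strength in the conductor for a flux density of magnitude \<open>s\<close>.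
Truncation at 0 makes it monotone and Lipschitz on the whole line.\<close>

definition field_strength :: "('z) mqs_problem_scheme \<Rightarrow> real \<Rightarrow> real" where
  "field_strength P s = nuC P (max 0 s) * max 0 s"

definition energy_density :: "('z) mqs_problem_scheme \<Rightarrow> pt \<Rightarrow> real \<Rightarrow> real" where
  "energy_density P \<xi> \<zeta> = indicator (OmC P) \<xi> * integral {0..\<zeta>} (field_strength P) + nuI P * indicator (OmI P) \<xi> * \<zeta>\<^sup>2 / 2"

text \<open>Measurability of \<open>\<nu>\<close> along a field needs care, because \<^const>\<open>nuC\<close> is only Lebesgue measurable and a
composition with it might not be; however, \<open>nuC P s\<close> is a quotient of a Lipschitz function by \<open>s\<close>,
except at \<open>s = 0\<close>, and is therefore Borel.\<close>

lemma reluctivity_form_faces: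
  fixes P :: fem_problem
  assumes geo: "geometry_ok P" and mat: "material_ok P"
  obtains L N0 where "reluctivity_form (Om P) (nu P) (energy_density P) (face_fun P) L N0"
proof -
  obtain LC where L: "0 < LC" and nonneg: "\<And>s. 0 \<le> s \<Longrightarrow> 0 \<le> nuC P s"
    and bound: "\<And>s. 0 \<le> s \<Longrightarrow> nuC P s \<le> LC + nuC P 0"
    and lip: "\<And>s t. 0 \<le> s \<Longrightarrow> 0 \<le> t \<Longrightarrow> \<bar>nuC P s * s - nuC P t * t\<bar> \<le> LC * \<bar>s - t\<bar>"
    and mono: "\<And>s t. 0 \<le> s \<Longrightarrow> s \<le> t \<Longrightarrow> nuC P s * s \<le> nuC P t * t"
    and I: "0 < nuI P"
    by (rule reluctivity_bounds[OF mat]) (rule that; assumption)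
  have bdd: "bounded (Om P)" and op: "open (Om P)" "open (OmC P)"
    using geo by (auto simp: geometry_ok_def bounded_lipschitz_domain_def)
  then have [measurable]: "OmC P \<in> sets borel" "OmI P \<in> sets borel"
    by (auto simp: OmI_def)
  have hlip: "\<bar>field_strength P s - field_strength P t\<bar> \<le> LC * \<bar>s - t\<bar>" for s t
  proof -
    have "\<bar>field_strength P s - field_strength P t\<bar> \<le> LC * \<bar>max 0 s - max 0 t\<bar>" unfolding field_strength_def by (rule lip) auto
    also have "\<dots> \<le> LC * \<bar>s - t\<bar>" using L by (intro mult_left_mono) (auto simp: max_def)
    finally show ?thesis .
  qed
  have "LC-lipschitz_on UNIV (field_strength P)"
    using hlip L by (intro lipschitz_onI) (auto simp: dist_real_def)
  then have hcont: "continuous_on A (field_strength P)" for A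
    by (rule lipschitz_on_continuous_on[OF lipschitz_on_subset]) simp
  have hint: "field_strength P integrable_on {a..b}" for a b
    by (rule integrable_continuous_real[OF hcont])
  have hmono: "field_strength P s \<le> field_strength P t" if "s \<le> t" for s t
    unfolding field_strength_def using that by (intro mono) auto
  have h0: "field_strength P 0 = 0" by (simp add: field_strength_def)
  have hpos: "0 \<le> field_strength P s" for s using hmono[of 0 "max 0 s"] by (auto simp: h0 field_strength_def)
  have nuC_eq: "nuC P s = (if s = 0 then nuC P 0 else field_strength P s / s)" if "0 \<le> s" for s
    using that by (simp add: field_strength_def)
  have [measurable]: "field_strength P \<in> borel_measurable borel"
    by (rule borel_measurable_continuous_onI[OF hcont])
  have "mono (\<lambda>s. integral {0..s} (field_strength P))"
  proof (rule monoI)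
    fix s t :: real assume "s \<le> t"
    then show "integral {0..s} (field_strength P) \<le> integral {0..t} (field_strength P)"
      by (intro integral_subset_le hint) (auto simp: hpos)
  qed
  then have [measurable]: "(\<lambda>s. integral {0..s} (field_strength P)) \<in> borel_measurable borel"
    by (rule borel_measurable_mono)
  have hconvex: "field_strength P s * (t - s) \<le> integral {0..t} (field_strength P) - integral {0..s} (field_strength P)"
    if "0 \<le> s" "0 \<le> t" for s t
  proof (cases "s \<le> t")
    case True
    have "integral {s..t} (\<lambda>_. field_strength P s) \<le> integral {s..t} (field_strength P)"
      by (intro integral_le hint) (auto intro: hmono)
    then show ?thesis
      using Henstock_Kurzweil_Integration.integral_combine[OF that(1) True hint] True by (simp add: mult.commute)
  next
    case False
    have "integral {t..s} (field_strength P) \<le> integral {t..s} (\<lambda>_. field_strength P s)"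
      by (intro integral_le hint) (auto intro: hmono)
    then show ?thesis
      using Henstock_Kurzweil_Integration.integral_combine[OF that(2) _ hint, of s] False
      by (simp add: algebra_simps)
  qed
  have "reluctivity_form (Om P) (nu P) (energy_density P) (face_fun P) (LC + nuI P) (LC + nuC P 0 + nuI P)"
  proof
    show "Om P \<in> lmeasurable" using bdd op(1) by (rule lmeasurable_open)
  next
    fix \<xi> :: pt and s :: real assume s: "0 \<le> s"
    show "0 \<le> nu P \<xi> s" using nonneg[OF s] I by (simp add: nu_def)
    show "nu P \<xi> s \<le> LC + nuC P 0 + nuI P"
      unfolding nu_def using nonneg[OF s] bound[OF s] I
      by (intro add_mono) (auto simp: indicator_def intro: order_trans[OF nonneg[OF s]])
    fix t :: real assume t: "0 \<le> t"
    have "\<bar>nu P \<xi> s * s - nu P \<xi> t * t\<bar>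
        = \<bar>indicator (OmC P) \<xi> * (nuC P s * s - nuC P t * t) + indicator (OmI P) \<xi> * (nuI P * (s - t))\<bar>"
      by (simp add: nu_def algebra_simps)
    also have "\<dots> \<le> \<bar>nuC P s * s - nuC P t * t\<bar> + \<bar>nuI P * (s - t)\<bar>"
      by (auto simp: indicator_def)
    also have "\<dots> \<le> LC * \<bar>s - t\<bar> + nuI P * \<bar>s - t\<bar>"
      using lip[OF s t] I by (simp add: abs_mult)
    finally show "\<bar>nu P \<xi> s * s - nu P \<xi> t * t\<bar> \<le> (LC + nuI P) * \<bar>s - t\<bar>"
      by (simp add: distrib_right)
    have "indicator (OmC P) \<xi> * (nuC P s * s * (t - s)) \<le> indicator (OmC P) \<xi> * (integral {0..t} (field_strength P) - integral {0..s} (field_strength P))"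
      using hconvex[OF s t] s by (intro mult_left_mono) (auto simp: field_strength_def)
    moreover have "nuI P * indicator (OmI P) \<xi> * (s * (t - s)) \<le> nuI P * indicator (OmI P) \<xi> * (t\<^sup>2 / 2 - s\<^sup>2 / 2)"
      using I zero_le_power2[of "t - s"]
      by (intro mult_left_mono) (auto simp: power2_eq_square algebra_simps)
    ultimately show "nu P \<xi> s * s * (t - s) \<le> energy_density P \<xi> t - energy_density P \<xi> s"
      by (simp add: nu_def energy_density_def algebra_simps)
  next
    show "energy_density P \<xi> 0 = 0" for \<xi> by (simp add: energy_density_def)
  next
    fix w :: "pt \<Rightarrow> pt" assume [measurable]: "w \<in> borel_measurable borel"
    have "(\<lambda>x. nu P x (norm (w x))) = (\<lambda>x. (if norm (w x) = 0 then nuC P 0 else field_strength P (norm (w x)) / norm (w x))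
       * indicator (OmC P) x + nuI P * indicator (OmI P) x)"
      unfolding nu_def by (subst nuC_eq) auto
    also have "\<dots> \<in> borel_measurable borel" by measurable
    finally show "(\<lambda>x. nu P x (norm (w x))) \<in> borel_measurable borel" .
    show "(\<lambda>x. energy_density P x (norm (w x))) \<in> borel_measurable borel"
      unfolding energy_density_def by measurable
  next
    fix k
    obtain p q s where f: "face P k = (p, q, s)" by (cases "face P k")
    define g where "g = (\<lambda>T \<xi>. bary T p \<xi> *\<^sub>R cross3 (bary_grad T q) (bary_grad T s) +
        bary T q \<xi> *\<^sub>R cross3 (bary_grad T s) (bary_grad T p) +
        bary T s \<xi> *\<^sub>R cross3 (bary_grad T p) (bary_grad T q))"
    have face: "face_fun P k = (\<lambda>\<xi>. \<Sum>T\<in>{T\<in>tets P. {p, q, s} \<subseteq> vertices T}. (2 * indicator (interior T) \<xi>) *\<^sub>R g T \<xi>)"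
      by (rule ext) (simp add: face_fun_def f g_def)
    have gc: "continuous_on A (g T)" for A T
      unfolding g_def bary_def by (intro continuous_intros)
    have [measurable]: "g T \<in> borel_measurable borel" for T
      by (rule borel_measurable_continuous_onI[OF gc])
    have [measurable]: "interior T \<in> sets borel" for T :: "pt set" by (simp add: borel_open)
    show "face_fun P k \<in> borel_measurable borel"
      unfolding face by measurable
    have "continuous_on (closure (Om P)) (\<lambda>\<xi>. \<Sum>T\<in>{T\<in>tets P. {p, q, s} \<subseteq> vertices T}. 2 * norm (g T \<xi>))"
      by (intro continuous_on_sum continuous_on_mult continuous_on_const continuous_on_norm gc)
    then have "bounded ((\<lambda>\<xi>. \<Sum>T\<in>{T\<in>tets P. {p, q, s} \<subseteq> vertices T}. 2 * norm (g T \<xi>)) ` closure (Om P))"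
      using bdd by (intro compact_imp_bounded compact_continuous_image) (auto simp: compact_closure)
    then obtain B where "\<forall>y\<in>(\<lambda>\<xi>. \<Sum>T\<in>{T\<in>tets P. {p, q, s} \<subseteq> vertices T}. 2 * norm (g T \<xi>)) ` closure (Om P). norm y \<le> B"
      by (auto simp only: bounded_iff)
    then have B: "(\<Sum>T\<in>{T\<in>tets P. {p, q, s} \<subseteq> vertices T}. 2 * norm (g T \<xi>)) \<le> B" if "\<xi> \<in> Om P" for \<xi>
      using closure_subset[THEN subsetD, OF that] abs_le_D1 by (simp only: ball_simps real_norm_def) blast
    have "norm (face_fun P k \<xi>) \<le> B" if "\<xi> \<in> Om P" for \<xi>
    proof -
      have "norm (face_fun P k \<xi>) \<le> (\<Sum>T\<in>{T\<in>tets P. {p, q, s} \<subseteq> vertices T}. 2 * norm (g T \<xi>))"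
        unfolding face by (rule sum_norm_le) (auto simp: indicator_def)
      also have "\<dots> \<le> B" by (rule B[OF that])
      finally show ?thesis .
    qed
    then show "\<exists>B. \<forall>x\<in>Om P. norm (face_fun P k x) \<le> B" by blast
  qed
  then show thesis by (rule that)
qed

text \<open>A tetrahedron that meets the conductor with its interior lies in the closure of the conductor, and
then so do its edges.\<close>

lemma edge_fun_zero_on_conductor:
  fixes P :: fem_problem
  assumes mesh: "mesh_ok P"
    and k: "n_one P \<le> k" "k < n_edge P" and \<xi>: "\<xi> \<in> OmC P"
  shows "edge_fun P k \<xi> = 0"
proof -
  obtain p q where e: "edge P k = (p, q)" by (cases "edge P k")
  have "edge_set P k \<in> {S\<in>mesh P. 1 simplex S \<and> \<not> S \<subseteq> closure (OmC P) \<and> \<not> S \<subseteq> frontier (Om P)}"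
  proof -
    have "edge_set P ` {n_one P..<n_edge P} = {S\<in>mesh P. 1 simplex S \<and> \<not> S \<subseteq> closure (OmC P) \<and> \<not> S \<subseteq> frontier (Om P)}"
      using mesh by (simp only: mesh_ok_def bij_betw_def)
    then show ?thesis using k by (metis (no_types, lifting) imageI atLeastLessThan_iff)
  qed
  then have out: "\<not> convex hull {p, q} \<subseteq> closure (OmC P)"
    by (simp add: edge_set_def e)
  have "\<xi> \<notin> interior T" if T: "T \<in> tets P" "{p, q} \<subseteq> vertices T" for T
  proof
    assume in_T: "\<xi> \<in> interior T"
    have conv: "convex T" using T(1) by (auto simp: tets_def intro: convex_simplex)
    have "interior T \<subseteq> OmC P"
      using mesh T(1) in_T \<xi> closure_subset[of "OmC P"] unfolding mesh_ok_def OmI_def by blast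
    then have "closure (interior T) \<subseteq> closure (OmC P)" by (rule closure_mono)
    moreover have "closure (interior T) = closure T"
      using in_T by (intro convex_closure_interior[OF conv]) auto
    moreover have "convex hull {p, q} \<subseteq> T"
      using T(2) conv by (intro hull_minimal) (auto simp: vertices_def extreme_point_of_def)
    ultimately show False using out closure_subset[of T] by blast
  qed
  then show ?thesis by (simp add: edge_fun_def e indicator_def)
qed

lemma curl_edge_fun_zero_on_conductor:
  fixes P :: fem_problem
  assumes mesh: "mesh_ok P" and geo: "geometry_ok P"
    and k: "n_one P \<le> k" "k < n_edge P" and \<xi>: "\<xi> \<in> OmC P"
  shows "curl (edge_fun P k) \<xi> = 0"
proof -
  have "open (OmC P)" using geo by (simp add: geometry_ok_def)
  have "((\<lambda>_. 0) has_derivative (\<lambda>_. 0 :: pt)) (at \<xi>)" by simp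
  then have "(edge_fun P k has_derivative (\<lambda>_. 0)) (at \<xi>)"
    by (rule has_derivative_transform_within_open[OF _ \<open>open (OmC P)\<close> \<xi>])
      (simp add: edge_fun_zero_on_conductor[OF mesh k])
  from frechet_derivative_at[OF this, symmetric] have "pderiv3 i (edge_fun P k) \<xi> = 0" for i
    by (simp add: pderiv3_def)
  then show ?thesis by (simp add: curl_def Finite_Cartesian_Product.vec_eq_iff forall_3 vector_3)
qed

lemma Kmat_nonconducting_rows:
  fixes P :: fem_problem
  assumes mesh: "mesh_ok P" and geo: "geometry_ok P"
    and k: "n_one P \<le> k" "k < n_edge P" and l: "l < n_edge P"
  shows "Kmat P a $$ (k, l) = Kmat P b $$ (k, l)"
proof -
  have "nu P \<xi> s * inner (curl (edge_fun P l) \<xi>) (curl (edge_fun P k) \<xi>)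
      = nu P \<xi> t * inner (curl (edge_fun P l) \<xi>) (curl (edge_fun P k) \<xi>)" for \<xi> s t
    using curl_edge_fun_zero_on_conductor[OF mesh geo k, of \<xi>]
    by (cases "\<xi> \<in> OmC P") (simp_all add: nu_def)
  note * = this
  show ?thesis
    using k l by (simp add: Kmat_def) (intro arg_cong[where f = "set_lebesgue_integral lebesgue (Om P)"] ext *)
qed

section \<open>Vector-valued signals\<close>

text \<open>Like the inputs, such a signal is constrained on \<open>{0..T}\<close> only; elsewhere even its dimension is arbitrary.\<close>

definition integrable_signal :: "real \<Rightarrow> nat \<Rightarrow> (real \<Rightarrow> real vec) \<Rightarrow> bool" where
  "integrable_signal T n w \<longleftrightarrow> (\<forall>t\<in>{0..T}. dim_vec (w t) = n) \<and> (\<forall>j<n. (\<lambda>t. w t $ j) absolutely_integrable_on {0..T})"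

lemma integrable_signal_mult:
  assumes w: "integrable_signal T n w" and A: "dim_col A = n"
  shows "integrable_signal T (dim_row A) (\<lambda>t. A *\<^sub>v w t)"
    and "i < dim_row A \<Longrightarrow> t \<in> {0..T} \<Longrightarrow>
      integral {0..t} (\<lambda>s. (A *\<^sub>v w s) $ i) = (A *\<^sub>v vec n (\<lambda>j. integral {0..t} (\<lambda>s. w s $ j))) $ i"
proof -
  have eq: "(A *\<^sub>v w t) $ i = (\<Sum>j = 0..<n. A $$ (i, j) * w t $ j)" if "t \<in> {0..T}" "i < dim_row A" for t i
    using w A that by (auto simp: integrable_signal_def scalar_prod_def)
  show "integrable_signal T (dim_row A) (\<lambda>t. A *\<^sub>v w t)"
    unfolding integrable_signal_def
  proof (intro conjI allI impI ballI)
    fix i assume i: "i < dim_row A"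
    have "(\<lambda>t. \<Sum>j = 0..<n. A $$ (i, j) * w t $ j) absolutely_integrable_on {0..T}"
      using w by (intro absolutely_integrable_sum set_integrable_mult_right) (auto simp: integrable_signal_def)
    then show "(\<lambda>t. (A *\<^sub>v w t) $ i) absolutely_integrable_on {0..T}"
      by (rule absolutely_integrable_spike[OF _ negligible_empty]) (use eq i in auto)
  qed simp
  assume i: "i < dim_row A" and t: "t \<in> {0..T}"
  have "integral {0..t} (\<lambda>s. (A *\<^sub>v w s) $ i) = integral {0..t} (\<lambda>s. \<Sum>j = 0..<n. A $$ (i, j) * w s $ j)"
    by (rule integral_cong) (use eq i t in auto)
  also have "\<dots> = (\<Sum>j = 0..<n. integral {0..t} (\<lambda>s. A $$ (i, j) * w s $ j))"
  proof (rule integral_sum)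
    fix j assume "j \<in> {0..<n}"
    then have "(\<lambda>s. w s $ j) integrable_on {0..T}" using w by (auto simp: integrable_signal_def absolutely_integrable_on_def)
    then have "(\<lambda>s. w s $ j) integrable_on {0..t}"
      by (rule integrable_subinterval_real) (use t in auto)
    then show "(\<lambda>s. A $$ (i, j) * w s $ j) integrable_on {0..t}" by (rule integrable_on_mult_right)
  qed simp
  also have "\<dots> = (A *\<^sub>v vec n (\<lambda>j. integral {0..t} (\<lambda>s. w s $ j))) $ i"
    using i A by (simp add: scalar_prod_def)
  finally show "integral {0..t} (\<lambda>s. (A *\<^sub>v w s) $ i) = \<dots>" .
qed

lemma square_integrable_mult:
  fixes f g :: "real \<Rightarrow> real"
  assumes f: "square_integrable A f" and g: "square_integrable A g"
  shows "set_integrable lebesgue A (\<lambda>t. f t * g t)"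
proof (rule set_integrable_bound)
  show "set_integrable lebesgue A (\<lambda>t. (norm (f t))\<^sup>2 + (norm (g t))\<^sup>2)"
    using f g by (intro set_integral_add) (auto simp: square_integrable_def)
  have "(\<lambda>x. (indicator A x *\<^sub>R f x) * (indicator A x *\<^sub>R g x)) \<in> borel_measurable lebesgue"
    using f g unfolding square_integrable_def set_borel_measurable_def by (intro borel_measurable_times) auto
  also have "(\<lambda>x. (indicator A x *\<^sub>R f x) * (indicator A x *\<^sub>R g x)) = (\<lambda>x. indicator A x *\<^sub>R (f x * g x))"
    by (auto simp: indicator_def)
  finally show "set_borel_measurable lebesgue A (\<lambda>t. f t * g t)"
    by (simp add: set_borel_measurable_def)
  have "\<bar>f x * g x\<bar> \<le> (norm (f x))\<^sup>2 + (norm (g x))\<^sup>2" for x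
  proof -
    have "2 * (\<bar>f x\<bar> * \<bar>g x\<bar>) \<le> \<bar>f x\<bar>\<^sup>2 + \<bar>g x\<bar>\<^sup>2"
      using zero_le_power2[of "\<bar>f x\<bar> - \<bar>g x\<bar>"] by (simp add: power2_eq_square algebra_simps)
    moreover have "0 \<le> \<bar>f x\<bar> * \<bar>g x\<bar>" by simp
    ultimately show ?thesis unfolding abs_mult real_norm_def by linarith
  qed
  then show "AE x in lebesgue. x \<in> A \<longrightarrow> norm (f x * g x) \<le> norm ((norm (f x))\<^sup>2 + (norm (g x))\<^sup>2)"
    by (simp add: abs_of_nonneg)
qed

lemma square_integrable_one: "square_integrable {0..T::real} (\<lambda>_. 1 :: real)"
  unfolding square_integrable_def
  using absolutely_integrable_continuous_real[of 0 T "\<lambda>_. 1 :: real"]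
  by (auto simp: set_borel_measurable_def set_integrable_def borel_measurable_integrable)

lemma L2_signal_integrable:
  assumes "L2_signal T m u"
  shows "integrable_signal T m u"
  using assms square_integrable_mult[OF _ square_integrable_one]
  by (auto simp: L2_signal_def integrable_signal_def)

lemma L2_signal_scalar_prod:
  assumes u: "L2_signal T m u" and y: "L2_signal T m y"
  shows "(\<lambda>t. u t \<bullet> y t) absolutely_integrable_on {0..T}"
proof (rule absolutely_integrable_spike[OF _ negligible_empty])
  show "(\<lambda>t. \<Sum>i = 0..<m. u t $ i * y t $ i) absolutely_integrable_on {0..T}"
    using u y by (intro absolutely_integrable_sum square_integrable_mult) (auto simp: L2_signal_def)
  fix t assume "t \<in> {0..T} - {}"
  then have "dim_vec (y t) = m" using y by (auto simp: L2_signal_def)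
  then show "u t \<bullet> y t = (\<Sum>i = 0..<m. u t $ i * y t $ i)" by (simp add: scalar_prod_def)
qed

lemma integrable_signal_scalar_prod_continuous:
  assumes u: "integrable_signal T m u" and y: "\<And>t. t \<in> {0..T} \<Longrightarrow> dim_vec (y t) = m"
    "\<And>i. i < m \<Longrightarrow> continuous_on {0..T} (\<lambda>t. y t $ i)"
  shows "(\<lambda>t. u t \<bullet> y t) absolutely_integrable_on {0..T}"
proof (rule absolutely_integrable_spike[OF _ negligible_empty])
  have "(\<lambda>t. u t $ i * y t $ i) absolutely_integrable_on {0..T}" if "i < m" for i
    using abs_integrable_mult_continuous[OF _ y(2)[OF that]] u that by (auto simp: integrable_signal_def mult.commute)
  then show "(\<lambda>t. \<Sum>i = 0..<m. u t $ i * y t $ i) absolutely_integrable_on {0..T}"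
    by (intro absolutely_integrable_sum) auto
qed (use y in \<open>auto simp: scalar_prod_def\<close>)


section \<open>Passivity of gradient systems\<close>

context reluctivity_form
begin

lemma energy_cong: "(\<And>j. j < M \<Longrightarrow> b j = c j) \<Longrightarrow> energy b = energy c"
  by (simp add: energy_def field_def)

text \<open>The solution is constructed from \<open>x' = E\<inverse> (f x + B u)\<close>, so its velocity \<open>h\<close> satisfies the differential
equation pointwise and the balance can be applied at every time.\<close>

lemma passive_solution:
  fixes D E Ei B C :: "real mat"
  assumes T: "0 \<le> T"
    and dims [simp]: "dim_row D = M" "dim_col D = N" "dim_row E = N" "dim_col E = N" "dim_row Ei = N" "dim_col Ei = N"
      "dim_row B = N" "dim_col B = m" "dim_row C = m" "dim_col C = N"
    and Ei: "E * Ei = 1\<^sub>m N"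
    and f: "\<And>x. dim_vec x = N \<Longrightarrow> f x = - (D\<^sup>T *\<^sub>v vec M (flux (\<lambda>j. (D *\<^sub>v x) $ j)))"
    and balance: "\<And>x h v. dim_vec x = N \<Longrightarrow> dim_vec h = N \<Longrightarrow> dim_vec v = m \<Longrightarrow> E *\<^sub>v h = f x + B *\<^sub>v v \<Longrightarrow>
        (D *\<^sub>v h) \<bullet> vec M (flux (\<lambda>j. (D *\<^sub>v x) $ j)) \<le> v \<bullet> (C *\<^sub>v x)"
    and u: "L2_signal T m u"
  obtains x where "state_solution T N E f B u x" "x 0 = 0\<^sub>v N"
    and "\<And>t. t \<in> {0..T} \<Longrightarrow> 0 \<le> integral {0..t} (\<lambda>s. u s \<bullet> (C *\<^sub>v x s))"
proof -
  note u1 = L2_signal_integrable[OF u]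
  have fdim: "dim_vec (f x) = N" if "dim_vec x = N" for x by (simp add: f[OF that])
  obtain K where "\<forall>k<M. \<forall>b c e. (\<forall>j<M. \<bar>b j - c j\<bar> \<le> e) \<longrightarrow> 0 \<le> e \<longrightarrow> \<bar>flux b k - flux c k\<bar> \<le> K * e"
    using flux_lipschitz by (rule exE)
  note K = this[rule_format]
  define F where "F = (\<lambda>v i. (Ei *\<^sub>v f (vec N v)) $ i)"
  have "\<exists>L. \<forall>i<N. \<forall>v w e. (\<forall>j<N. \<bar>v j - w j\<bar> \<le> e) \<longrightarrow> 0 \<le> e \<longrightarrow> \<bar>F v i - F w i\<bar> \<le> L * e"
  proof -
    obtain K1 where K1: "0 \<le> K1 \<and> (\<forall>p q e i. i < dim_row D \<longrightarrow> dim_vec p = dim_col D \<longrightarrow> dim_vec q = dim_col D \<longrightarrow>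
      (\<forall>k<dim_col D. \<bar>p $ k - q $ k\<bar> \<le> e) \<longrightarrow> 0 \<le> e \<longrightarrow> \<bar>(D *\<^sub>v p) $ i - (D *\<^sub>v q) $ i\<bar> \<le> K1 * e)"
      using mult_mat_vec_lipschitz[of D] by (rule exE)
    note K1 = conjunct2[OF K1, rule_format] conjunct1[OF K1]
    let ?A = "- (Ei * D\<^sup>T)"
    obtain K2 where K2: "0 \<le> K2 \<and> (\<forall>p q e i. i < dim_row ?A \<longrightarrow> dim_vec p = dim_col ?A \<longrightarrow> dim_vec q = dim_col ?A \<longrightarrow>
      (\<forall>k<dim_col ?A. \<bar>p $ k - q $ k\<bar> \<le> e) \<longrightarrow> 0 \<le> e \<longrightarrow> \<bar>(?A *\<^sub>v p) $ i - (?A *\<^sub>v q) $ i\<bar> \<le> K2 * e)"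
      using mult_mat_vec_lipschitz[of ?A] by (rule exE)
    note K2 = conjunct2[OF K2, rule_format] conjunct1[OF K2]
    have F_eq: "F v i = (?A *\<^sub>v vec M (flux (\<lambda>j. (D *\<^sub>v vec N v) $ j))) $ i" for v i
      by (simp add: F_def f mat_vec_simps del: index_mult_mat_vec)
    have "\<bar>F v i - F w i\<bar> \<le> (K2 * (\<bar>K\<bar> * K1)) * e"
      if i: "i < N" and vw: "\<And>j. j < N \<Longrightarrow> \<bar>v j - w j\<bar> \<le> e" and e: "0 \<le> e" for v w i e
    proof -
      have 1: "\<bar>(D *\<^sub>v vec N v) $ j - (D *\<^sub>v vec N w) $ j\<bar> \<le> K1 * e" if "j < M" for j
        by (rule K1(1)) (use that vw e in auto)
      have 2: "\<bar>flux (\<lambda>j. (D *\<^sub>v vec N v) $ j) k - flux (\<lambda>j. (D *\<^sub>v vec N w) $ j) k\<bar> \<le> \<bar>K\<bar> * (K1 * e)" if "k < M" for k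
      proof -
        have "\<bar>flux (\<lambda>j. (D *\<^sub>v vec N v) $ j) k - flux (\<lambda>j. (D *\<^sub>v vec N w) $ j) k\<bar> \<le> K * (K1 * e)"
          by (rule K[OF that 1]) (use K1(2) e in auto)
        also have "\<dots> \<le> \<bar>K\<bar> * (K1 * e)" using K1(2) e by (intro mult_right_mono) auto
        finally show ?thesis .
      qed
      have "\<bar>F v i - F w i\<bar> \<le> K2 * (\<bar>K\<bar> * (K1 * e))"
        unfolding F_eq by (rule K2(1)) (use i 2 K1(2) e in auto)
      then show ?thesis by (simp add: mult_ac)
    qed
    then show ?thesis by blast
  qed
  then obtain L where "\<forall>i<N. \<forall>v w e. (\<forall>j<N. \<bar>v j - w j\<bar> \<le> e) \<longrightarrow> 0 \<le> e \<longrightarrow> \<bar>F v i - F w i\<bar> \<le> L * e"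
    by (rule exE)
  note Lip = this[rule_format]
  define g where "g = (\<lambda>t i. ((Ei * B) *\<^sub>v u t) $ i)"
  have gs: "integrable_signal T N (\<lambda>t. (Ei * B) *\<^sub>v u t)"
    using integrable_signal_mult(1)[OF u1, of "Ei * B"] by simp
  have gi: "(\<lambda>t. g t i) absolutely_integrable_on {0..T}" if "i < N" for i
    using gs that by (simp add: g_def integrable_signal_def)
  have gint: "(\<lambda>t. g t i) integrable_on {0..T}" if "i < N" for i
    using gi[OF that] by (simp add: absolutely_integrable_on_def)
  obtain xs where xc: "\<And>i. i < N \<Longrightarrow> continuous_on {0..T} (\<lambda>t. xs t i)"
    and xi: "\<And>i t. i < N \<Longrightarrow> t \<in> {0..T} \<Longrightarrow> xs t i = integral {0..t} (\<lambda>s. F (xs s) i + g s i)"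
  proof (rule caratheodory_solution_exists[where F = F and g = g and N = N and L = L, OF T])
    show "\<bar>F v i - F w i\<bar> \<le> L * e" if "i < N" "\<And>j. j < N \<Longrightarrow> \<bar>v j - w j\<bar> \<le> e" "0 \<le> e" for v w i e
      by (rule Lip[OF that])
    show "(\<lambda>t. g t i) integrable_on {0..T}" if "i < N" for i by (rule gint[OF that])
  qed (rule that; assumption)
  define x where "x = (\<lambda>t. vec N (xs t))"
  define h where "h = (\<lambda>t. vec N (\<lambda>i. F (xs t) i + g t i))"
  have xdim [simp]: "dim_vec (x t) = N" and hdim [simp]: "dim_vec (h t) = N" for t
    by (simp_all add: x_def h_def)
  have "continuous_on {0..T} (\<lambda>t. F (xs t) i)" if "i < N" for i
    by (rule continuous_on_componentwise_lipschitz[where N = N and L = L]) (use Lip that xc in auto)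
  then have hs: "integrable_signal T N h"
    unfolding integrable_signal_def using gi
    by (auto simp: h_def intro!: set_integral_add(1)[OF absolutely_integrable_continuous_real])
  have x_int: "x t = vec N (\<lambda>j. integral {0..t} (\<lambda>s. h s $ j))" if "t \<in> {0..T}" for t
    using xi[OF _ that] by (intro eq_vecI) (auto simp: x_def h_def)
  have x0: "x 0 = 0\<^sub>v N"
    using x_int[of 0] T by auto
  have udim: "dim_vec (u t) = m" if "t \<in> {0..T}" for t using u that by (auto simp: L2_signal_def)
  have Eh: "E *\<^sub>v h t = f (x t) + B *\<^sub>v u t" if "t \<in> {0..T}" for t
  proof -
    have "h t = Ei *\<^sub>v (f (x t) + B *\<^sub>v u t)"
      using udim[OF that] fdim[of "x t"]
      by (intro eq_vecI) (simp_all add: h_def F_def g_def x_def mat_vec_simps del: index_mult_mat_vec)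
    then show ?thesis
      using Ei udim[OF that] fdim[of "x t"] by (simp add: one_zero_mult_vec_dim flip: mult_mat_vec_assoc_dim)
  qed
  have xcont: "continuous_on {0..T} (\<lambda>t. x t $ i)" if "i < N" for i
    using xc[OF that] that by (simp add: x_def)
  have sol: "state_solution T N E f B u x"
    unfolding state_solution_def
  proof (intro conjI allI impI)
    show "continuous_signal T N x"
      using xcont by (auto simp: continuous_signal_def intro: carrier_vecI)
    fix i assume i: "i < N"
    have Ehs: "integrable_signal T N (\<lambda>t. E *\<^sub>v h t)" using integrable_signal_mult(1)[OF hs, of E] by simp
    have "(\<lambda>t. (E *\<^sub>v h t) $ i) absolutely_integrable_on {0..T}"
      using Ehs i by (simp add: integrable_signal_def del: index_mult_mat_vec)
    then have a: "(\<lambda>t. (f (x t) + B *\<^sub>v u t) $ i) absolutely_integrable_on {0..T}"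
      by (rule absolutely_integrable_spike[OF _ negligible_empty]) (simp add: Eh del: index_mult_mat_vec)
    show "has_weak_deriv_on T (\<lambda>t. (E *\<^sub>v x t) $ i) (\<lambda>t. (f (x t) + B *\<^sub>v u t) $ i)"
    proof (rule has_weak_deriv_on_indefinite_integral[OF T a])
      fix t assume t: "t \<in> {0..T}"
      have "(E *\<^sub>v x t) $ i = integral {0..t} (\<lambda>s. (E *\<^sub>v h s) $ i)"
        using integrable_signal_mult(2)[OF hs, of E i t] i t by (simp add: x_int[OF t] del: index_mult_mat_vec)
      also have "\<dots> = integral {0..t} (\<lambda>s. (f (x s) + B *\<^sub>v u s) $ i)"
        using t by (intro integral_cong) (simp add: Eh del: index_mult_mat_vec)
      finally show "(E *\<^sub>v x t) $ i = (E *\<^sub>v x 0) $ i + integral {0..t} (\<lambda>s. (f (x s) + B *\<^sub>v u s) $ i)"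
        using i by (simp add: x0 one_zero_mult_vec_dim del: index_mult_mat_vec)
    qed
  qed
  define b where "b = (\<lambda>t j. (D *\<^sub>v x t) $ j)"
  define b' where "b' = (\<lambda>t j. (D *\<^sub>v h t) $ j)"
  have b's: "integrable_signal T M (\<lambda>t. D *\<^sub>v h t)" using integrable_signal_mult(1)[OF hs, of D] by simp
  have bi: "b t k = integral {0..t} (\<lambda>s. b' s k)" if "k < M" "t \<in> {0..T}" for k t
    using integrable_signal_mult(2)[OF hs, of D k t] that by (simp add: b_def b'_def x_int[OF that(2)] del: index_mult_mat_vec)
  have bc: "continuous_on {0..T} (\<lambda>t. b t k)" if "k < M" for k
  proof -
    have "continuous_on {0..T} (\<lambda>t. \<Sum>j = 0..<N. D $$ (k, j) * x t $ j)"
      using xcont by (intro continuous_intros) auto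
    then show ?thesis using that by (simp add: b_def scalar_prod_def)
  qed
  have fc: "continuous_on {0..T} (\<lambda>t. flux (b t) k)" if "k < M" for k
    by (rule continuous_on_componentwise_lipschitz[where N = M and L = K]) (use K that bc in auto)
  have Cc: "continuous_on {0..T} (\<lambda>t. (C *\<^sub>v x t) $ i)" if "i < m" for i
  proof -
    have "continuous_on {0..T} (\<lambda>t. \<Sum>j = 0..<N. C $$ (i, j) * x t $ j)"
      using xcont by (intro continuous_intros) auto
    then show ?thesis using that by (simp add: scalar_prod_def)
  qed
  have power: "(\<lambda>t. u t \<bullet> (C *\<^sub>v x t)) integrable_on {0..T}"
    using integrable_signal_scalar_prod_continuous[OF u1 _ Cc] by (simp add: absolutely_integrable_on_def)
  have "0 \<le> integral {0..t} (\<lambda>s. u s \<bullet> (C *\<^sub>v x s))" if t: "t \<in> {0..T}" for t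
  proof -
    have sub: "{0..t} \<subseteq> {0..T}" using t by auto
    have b'a: "(\<lambda>s. b' s k) absolutely_integrable_on {0..T}" if "k < M" for k
      using b's that by (simp add: integrable_signal_def b'_def del: index_mult_mat_vec)
    have "energy (b 0) = 0"
      using energy_cong[of "b 0" "\<lambda>_. 0"] energy_0 by (simp add: b_def x0 one_zero_mult_vec_dim del: index_mult_mat_vec)
    then have "0 \<le> energy (b t) - energy (b 0)" using energy_nonneg[of "b t"] by simp
    also have "\<dots> \<le> integral {0..t} (\<lambda>s. \<Sum>k<M. flux (b s) k * b' s k)"
    proof (rule energy_inequality[where H = "\<lambda>s. energy (b s)" and b = b])
      show "(\<lambda>s. b' s k) absolutely_integrable_on {0..t}" if "k < M" for k
        by (rule set_integrable_subset[OF b'a[OF that]]) (use sub in auto)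
      show "continuous_on {0..t} (\<lambda>t. flux (b t) k)" if "k < M" for k
        by (rule continuous_on_subset[OF fc[OF that] sub])
      show "b s k = integral {0..s} (\<lambda>s. b' s k)" if "k < M" "s \<in> {0..t}" for k s
        using that sub by (intro bi) auto
    qed (use t energy_convex in auto)
    also have "\<dots> \<le> integral {0..t} (\<lambda>s. u s \<bullet> (C *\<^sub>v x s))"
    proof (rule integral_le)
      have "(\<lambda>s. flux (b s) k * b' s k) integrable_on {0..T}" if "k < M" for k
        using abs_integrable_mult_continuous[OF b'a[OF that] fc[OF that]] by (simp add: absolutely_integrable_on_def)
      then have "(\<lambda>s. \<Sum>k<M. flux (b s) k * b' s k) integrable_on {0..T}"
        by (intro integrable_sum) auto
      then show "(\<lambda>s. \<Sum>k<M. flux (b s) k * b' s k) integrable_on {0..t}"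
        using sub by (rule integrable_subinterval_real)
      show "(\<lambda>s. u s \<bullet> (C *\<^sub>v x s)) integrable_on {0..t}"
        using power sub by (rule integrable_subinterval_real)
      fix s assume "s \<in> {0..t}"
      then have s: "s \<in> {0..T}" using sub by blast
      have "(\<Sum>k<M. flux (b s) k * b' s k) = (D *\<^sub>v h s) \<bullet> vec M (flux (\<lambda>j. (D *\<^sub>v x s) $ j))"
        by (simp add: scalar_prod_def b_def b'_def lessThan_atLeast0 mult.commute del: index_mult_mat_vec)
      also have "\<dots> \<le> u s \<bullet> (C *\<^sub>v x s)"
        by (rule balance[OF _ _ _ Eh]) (use s udim in auto)
      finally show "(\<Sum>k<M. flux (b s) k * b' s k) \<le> u s \<bullet> (C *\<^sub>v x s)" .
    qed
    finally show ?thesis .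
  qed
  then show thesis by (rule that[OF sol x0])
qed

end

section \<open>The projected finite element system\<close>

lemma fem_dims [simp]:
  "dim_row (Cd P) = n_face P" "dim_col (Cd P) = n_edge P"
  "dim_row (Kmat P a) = n_edge P" "dim_col (Kmat P a) = n_edge P"
  "dim_row (Xmat P) = n_edge P" "dim_col (Xmat P) = n_wind P"
  "dim_row (M_nu P b) = n_face P" "dim_col (M_nu P b) = n_face P"
  "dim_row (M11 P) = n_one P" "dim_col (M11 P) = n_one P"
  "dim_row (C2 P) = n_face P" "dim_col (C2 P) = n_two P"
  "dim_row (X2 P) = n_two P" "dim_col (X2 P) = n_wind P"
  "dim_row (K21 P) = n_two P" "dim_col (K21 P) = n_one P"
  "dim_row (K22 P) = n_two P" "dim_col (K22 P) = n_two P"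
  by (simp_all add: Cd_def Kmat_def Xmat_def M_nu_def M11_def C2_def X2_def K21_def K22_def)

lemma Kmat_lower_rows:
  fixes P :: fem_problem
  assumes mesh: "mesh_ok P" and geo: "geometry_ok P"
    and z: "dim_vec z = n_two P" and a: "dim_vec a1 = n_one P" "dim_vec a2 = n_two P"
  shows "(0\<^sub>v (n_one P) @\<^sub>v z) \<bullet> (Kmat P a *\<^sub>v (a1 @\<^sub>v a2)) = z \<bullet> (K21 P *\<^sub>v a1 + K22 P *\<^sub>v a2)"
proof -
  have "block (Kmat P a) (n_one P) (n_two P) 0 (n_one P) = K21 P"
    and "block (Kmat P a) (n_one P) (n_two P) (n_one P) (n_two P) = K22 P"
    unfolding K21_def K22_def block_def
    by (intro cong_mat refl, simp, rule Kmat_nonconducting_rows[OF mesh geo], simp_all add: n_edge_def)+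
  then show ?thesis
    using scalar_prod_lower_block[of "Kmat P a" "n_one P" "n_two P" z a1 a2] z a by (simp add: n_edge_def)
qed

lemma K22_sym: "(K22 P)\<^sup>T = K22 P"
  unfolding K22_def block_def Kmat_def
  by (intro eq_matI) (auto simp: n_edge_def inner_commute)

text \<open>The inverses exist for two reasons.  The columns of \<open>Y\<^sub>2\<close> lie in the range of \<open>C\<^sub>2\<^sup>T\<close>, which meets
the kernel of \<open>C\<^sub>2\<close> only in 0, so \<open>K\<^sub>2\<^sub>2 = C\<^sub>2\<^sup>T M C\<^sub>2\<close> is definite on the range of \<open>Y\<^sub>2\<close>; and the Gram
matrix of the windings is the square of the definite matrix \<open>Q\<close>.\<close>

lemma projected_mqs_fem:
  fixes P :: fem_problem
  assumes problem: "geometry_ok P" "windings_ok P" "mesh_ok P"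
    and dims: "m = n_wind P" "n1 = n_one P" "n2 = n_two P"
    and K_factor: "\<And>a. a \<in> carrier_vec (n_edge P) \<Longrightarrow>
          Kmat P a = (Cd P)\<^sup>T * M_nu P (Cd P *\<^sub>v a) * Cd P"
    and M_nu_spd: "\<And>a. a \<in> carrier_vec (n_edge P) \<Longrightarrow>
          sym_pos_def (n_face P) (M_nu P (Cd P *\<^sub>v a))"
    and M11_spd: "sym_pos_def n1 (M11 P)"
    and Yhat: "Yhat \<in> carrier_mat n2 k" "columns_basis Yhat (mat_image ((C2 P)\<^sup>T))"
    and Y: "Y \<in> carrier_mat k s" "columns_basis Y (mat_kernel ((X2 P)\<^sup>T * Yhat))"
    and Q: "is_pd_sqrt ((X2 P)\<^sup>T * Yhat * Yhat\<^sup>T * X2 P) Q"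
    and Z: "Z = Yhat\<^sup>T * X2 P * minv Q"
    and Zhat: "Zhat = Yhat\<^sup>T * X2 P * minv ((X2 P)\<^sup>T * Yhat * Yhat\<^sup>T * X2 P)"
    and Y2: "Y2 = Yhat * Y"
    and Z2: "Z2 = Yhat * Z"
    and W: "W = minv (Y2\<^sup>T * K22 P * Y2)"
    and U1: "leading_left_singular_vectors A r U1" "dim_row A = n1"
    and U: "U = four_block_mat U1 (0\<^sub>m n1 m)
                  (- (Y2 * W * Y2\<^sup>T * K21 P * U1)) ((1\<^sub>m n2 - Y2 * W * Y2\<^sup>T * K22 P) * Z2)"
    and E: "E = four_block_mat (U1\<^sup>T * M11 P * U1) (0\<^sub>m r m) (0\<^sub>m m r) (0\<^sub>m m m)
                + U\<^sup>T * Xmat P * minv (Res P) * (Xmat P)\<^sup>T * U"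
    and C: "C = Zhat\<^sup>T * Yhat\<^sup>T * (1\<^sub>m n2 - K22 P * Y2 * W * Y2\<^sup>T)
                * (K21 P * U1 @\<^sub>c K22 P * Z2)"
  shows "projected_mqs n1 n2 r s m U1 Y2 Z2 W (K21 P) (K22 P) (X2 P) (Xmat P) (M11 P)
           (Res P) (minv (Res P)) Q (minv Q) U E C"
proof -
  have ne: "n_edge P = n1 + n2" by (simp add: n_edge_def dims)
  note ndims = dims[symmetric]
  have Ydims [simp]: "dim_row Yhat = n2" "dim_col Yhat = k" "dim_row Y = k" "dim_col Y = s"
      "dim_row Y2 = n2" "dim_col Y2 = s"
    using Yhat(1) Y(1) by (auto simp: Y2)
  note U1dims = leading_left_singular_vectors_inj[OF U1(1)]
  define Gq where "Gq = (X2 P)\<^sup>T * Yhat * Yhat\<^sup>T * X2 P"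
  have Gq [simp]: "dim_row Gq = m" "dim_col Gq = m" by (simp_all add: Gq_def ndims)
  have Qspd: "sym_pos_def m Q" and QQ: "Q * Q = Gq"
    using Q by (simp_all add: is_pd_sqrt_def Gq_def ndims)
  have Qc: "Q \<in> carrier_mat m m" and Qt: "Q\<^sup>T = Q" using Qspd by (auto simp: sym_pos_def_def)
  note Qi = sym_pos_def_minv[OF Qspd]
  have Qdims [simp]: "dim_row Q = m" "dim_col Q = m" "dim_row (minv Q) = m" "dim_col (minv Q) = m"
    using Qc Qi(1) by auto
  have Qit: "(minv Q)\<^sup>T = minv Q" by (rule symmetric_inverse[OF Qc Qi(1) Qt Qi(2,3)])
  have QiQ: "minv Q *\<^sub>v (Q *\<^sub>v v) = v" "Q *\<^sub>v (minv Q *\<^sub>v v) = v" if "dim_vec v = m" for v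
    using that Qi(2,3) by (simp_all add: one_zero_mult_vec_dim flip: mult_mat_vec_assoc_dim)
  have Gqv: "Gq *\<^sub>v v = Q *\<^sub>v (Q *\<^sub>v v)" if "dim_vec v = m" for v
    using that by (simp add: mult_mat_vec_assoc_dim flip: QQ)
  have Gqi: "minv Gq \<in> carrier_mat m m" "Gq * minv Gq = 1\<^sub>m m" "minv Gq * Gq = 1\<^sub>m m"
  proof -
    have inj: "v = 0\<^sub>v m" if "v \<in> carrier_vec m" "Gq *\<^sub>v v = 0\<^sub>v m" for v
    proof -
      have v: "dim_vec v = m" using that by auto
      have "v = minv Q *\<^sub>v (minv Q *\<^sub>v (Gq *\<^sub>v v))" using v by (simp add: Gqv QiQ)
      also have "\<dots> = 0\<^sub>v m" by (simp add: that(2) one_zero_mult_vec_dim)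
      finally show ?thesis .
    qed
    have "Gq \<in> carrier_mat m m" by (rule carrier_matI) simp_all
    from minv_inverse[OF this inj]
    show "minv Gq \<in> carrier_mat m m" "Gq * minv Gq = 1\<^sub>m m" "minv Gq * Gq = 1\<^sub>m m" by simp_all
  qed
  have Gqi_eq: "minv Gq = minv Q * minv Q"
  proof (rule mat_eqI_mult_vec)
    fix v :: "real vec" assume v: "dim_vec v = m"
    define w where "w = minv Gq *\<^sub>v v"
    have w: "dim_vec w = m" using Gqi(1) by (simp add: w_def)
    have "Gq *\<^sub>v w = v"
      unfolding w_def using v Gqi(1,2) by (simp add: one_zero_mult_vec_dim flip: mult_mat_vec_assoc_dim)
    then have "w = minv Q *\<^sub>v (minv Q *\<^sub>v v)" using w by (simp add: Gqv QiQ flip: \<open>Gq *\<^sub>v w = v\<close>)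
    then show "minv Gq *\<^sub>v v = (minv Q * minv Q) *\<^sub>v v" using v by (simp add: w_def mult_mat_vec_assoc_dim)
  qed (use Gqi(1) in auto)
  have Zdims [simp]: "dim_row Z2 = n2" "dim_col Z2 = m" "dim_row Z = k" "dim_col Z = m"
    by (simp_all add: Z2 Z)
  have X2Z2: "(X2 P)\<^sup>T * Z2 = Q"
  proof (rule mat_eqI_mult_vec[of _ m _ m])
    fix v :: "real vec" assume v: "dim_vec v = m"
    have "((X2 P)\<^sup>T * Z2) *\<^sub>v v = Gq *\<^sub>v (minv Q *\<^sub>v v)"
      using v by (simp add: Z2 Z Gq_def mult_mat_vec_assoc_dim ndims)
    then show "((X2 P)\<^sup>T * Z2) *\<^sub>v v = Q *\<^sub>v v" using v by (simp add: Gqv QiQ)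
  qed (simp_all add: ndims)
  have Zhat_eq: "Zhat\<^sup>T * Yhat\<^sup>T = minv Q * Z2\<^sup>T"
  proof (rule mat_eqI_mult_vec[of _ m _ n2])
    fix v :: "real vec" assume v: "dim_vec v = n2"
    show "(Zhat\<^sup>T * Yhat\<^sup>T) *\<^sub>v v = (minv Q * Z2\<^sup>T) *\<^sub>v v"
      using v unfolding Zhat Z2 Z Gq_def[symmetric] Gqi_eq
      by (simp add: transpose_mult_dim mult_mat_vec_assoc_dim ndims Qit)
  qed (use Gqi(1) in \<open>simp_all add: ndims Zhat flip: Gq_def\<close>)
  have X2Y2: "(X2 P)\<^sup>T * Y2 = 0\<^sub>m m s"
  proof (rule mat_eqI_mult_vec[of _ m _ s])
    fix v :: "real vec" assume v: "dim_vec v = s"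
    have "Y *\<^sub>v v \<in> mat_kernel ((X2 P)\<^sup>T * Yhat)"
      by (rule columns_basis_mem[OF Y(2)]) (simp add: v)
    then have "((X2 P)\<^sup>T * Yhat) *\<^sub>v (Y *\<^sub>v v) = 0\<^sub>v m"
      by (simp add: mat_kernel_def ndims)
    then show "((X2 P)\<^sup>T * Y2) *\<^sub>v v = 0\<^sub>m m s *\<^sub>v v"
      using v by (simp add: Y2 mult_mat_vec_assoc_dim one_zero_mult_vec_dim ndims)
  qed (simp_all add: ndims)
  have C2z: "Cd P *\<^sub>v (0\<^sub>v n1 @\<^sub>v z) = C2 P *\<^sub>v z" if z: "dim_vec z = n2" for z
  proof -
    have "Cd P *\<^sub>v (0\<^sub>v n1 @\<^sub>v z) = block (Cd P) 0 (n_face P) 0 n1 *\<^sub>v 0\<^sub>v n1 + block (Cd P) 0 (n_face P) n1 n2 *\<^sub>v z"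
      by (rule mult_vec_block_cols) (simp_all add: z ne)
    then show ?thesis by (simp add: C2_def ndims one_zero_mult_vec_dim)
  qed
  define M0 where "M0 = M_nu P (Cd P *\<^sub>v 0\<^sub>v (n_edge P))"
  have M0: "sym_pos_def (n_face P) M0" unfolding M0_def by (rule M_nu_spd) simp
  have M0dims [simp]: "dim_row M0 = n_face P" "dim_col M0 = n_face P" by (simp_all add: M0_def)
  have K22_form: "z \<bullet> (K22 P *\<^sub>v z) = (C2 P *\<^sub>v z) \<bullet> (M0 *\<^sub>v (C2 P *\<^sub>v z))" if z: "dim_vec z = n2" for z
  proof -
    let ?z = "0\<^sub>v n1 @\<^sub>v z"
    have "z \<bullet> (K22 P *\<^sub>v z) = ?z \<bullet> (Kmat P (0\<^sub>v (n_edge P)) *\<^sub>v ?z)"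
      using Kmat_lower_rows[OF problem(3,1), of z "0\<^sub>v n1" z] z by (simp add: ndims one_zero_mult_vec_dim)
    also have "\<dots> = ?z \<bullet> ((Cd P)\<^sup>T *\<^sub>v (M0 *\<^sub>v (Cd P *\<^sub>v ?z)))"
      unfolding K_factor[OF zero_carrier_vec] M0_def[symmetric]
      using z by (simp add: mult_mat_vec_assoc_dim ne)
    also have "\<dots> = (Cd P *\<^sub>v ?z) \<bullet> (M0 *\<^sub>v (Cd P *\<^sub>v ?z))"
      using z by (subst scalar_prod_mult_mat_vec) (simp_all add: ne)
    finally show ?thesis by (simp add: C2z z)
  qed
  define Gk where "Gk = Y2\<^sup>T * K22 P * Y2"
  have Gkdims [simp]: "dim_row Gk = s" "dim_col Gk = s" by (simp_all add: Gk_def)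
  have Gkt: "Gk\<^sup>T = Gk"
    by (rule mat_eqI_mult_vec[of _ s _ s])
      (simp_all add: Gk_def transpose_mult_dim K22_sym mult_mat_vec_assoc_dim ndims)
  \<comment> \<open>a kernel vector gives a \<open>z\<close> in the range of \<open>C2\<^sup>T\<close> with \<open>C2 z = 0\<close>, and these spaces are orthogonal\<close>
  have Gk_inj: "v = 0\<^sub>v s" if "v \<in> carrier_vec s" "Gk *\<^sub>v v = 0\<^sub>v s" for v
  proof -
    have v: "dim_vec v = s" using that by auto
    define z where "z = Y2 *\<^sub>v v"
    have z: "dim_vec z = n2" by (simp add: z_def)
    have "(C2 P *\<^sub>v z) \<bullet> (M0 *\<^sub>v (C2 P *\<^sub>v z)) = z \<bullet> (K22 P *\<^sub>v z)" by (rule K22_form[OF z, symmetric])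
    also have "\<dots> = v \<bullet> (Gk *\<^sub>v v)"
      using v by (simp add: Gk_def z_def mult_mat_vec_assoc_dim ndims scalar_prod_mult_mat_vec[of v "Y2\<^sup>T"])
    also have "\<dots> = 0" using v by (simp add: that(2) one_zero_mult_vec_dim)
    finally have "C2 P *\<^sub>v z = 0\<^sub>v (n_face P)"
      using M0 unfolding sym_pos_def_def by (metis carrier_vecI dim_mult_mat_vec fem_dims(11) less_irrefl)
    moreover have "z \<in> mat_image ((C2 P)\<^sup>T)"
      unfolding z_def Y2 using columns_basis_mem[OF Yhat(2), of "Y *\<^sub>v v"] v by (simp add: mult_mat_vec_assoc_dim)
    then obtain p where p: "z = (C2 P)\<^sup>T *\<^sub>v p" "dim_vec p = n_face P" by (auto simp: mat_image_def)
    ultimately have "z \<bullet> z = 0"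
      using z by (subst (2) p(1)) (simp add: scalar_prod_mult_mat_vec p(2) ndims one_zero_mult_vec_dim)
    then have "z = 0\<^sub>v n2" using scalar_prod_self_eq_0[of z] z by simp
    then have "Yhat *\<^sub>v (Y *\<^sub>v v) = 0\<^sub>v n2" using v by (simp add: z_def Y2 mult_mat_vec_assoc_dim)
    then have "Y *\<^sub>v v = 0\<^sub>v k" using columns_basis_inj[OF Yhat(2), of "Y *\<^sub>v v"] by simp
    then show "v = 0\<^sub>v s" using columns_basis_inj[OF Y(2), of v] v by simp
  qed
  have Gkc: "Gk \<in> carrier_mat s s" by (rule carrier_matI) simp_all
  note Wi = minv_inverse[OF Gkc Gk_inj]
  have W_eq: "W = minv Gk" by (simp add: W Gk_def)
  have Wt: "W\<^sup>T = W" unfolding W_eq by (rule symmetric_inverse[OF Gkc _ Gkt]) (use Wi in auto)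
  have R: "sym_pos_def m (Res P)" using problem(2) by (simp add: windings_ok_def dims)
  note Ri = sym_pos_def_minv[OF R]
  show ?thesis
  proof
    show "W * (Y2\<^sup>T * K22 P * Y2) = 1\<^sub>m s" using Wi(3) by (simp add: W_eq Gk_def)
    show "(Xmat P)\<^sup>T *\<^sub>v (0\<^sub>v n1 @\<^sub>v z) = (X2 P)\<^sup>T *\<^sub>v z" if "dim_vec z = n2" for z
      unfolding X2_def using that by (simp add: mult_vec_lower_rows[of _ n1 n2 m] ne ndims)
    show "C = minv Q * Z2\<^sup>T * (1\<^sub>m n2 - K22 P * Y2 * W * Y2\<^sup>T) * (K21 P * U1 @\<^sub>c K22 P * Z2)"
      unfolding C Zhat_eq ..
    show "0 < v \<bullet> (Res P *\<^sub>v v)" if "dim_vec v = m" "v \<noteq> 0\<^sub>v m" for v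
      using R that by (auto simp: sym_pos_def_def intro: carrier_vecI)
    show "0 < v \<bullet> (M11 P *\<^sub>v v)" if "dim_vec v = n1" "v \<noteq> 0\<^sub>v n1" for v
      using M11_spd that by (auto simp: sym_pos_def_def intro: carrier_vecI)
    show "v = 0\<^sub>v r" if "dim_vec v = r" "U1 *\<^sub>v v = 0\<^sub>v n1" for v
      using U1dims(3)[of v] that U1(2) by simp
    show "dim_row W = s" "dim_col W = s" using Wi(1) by (auto simp: W_eq)
    show "dim_row (minv (Res P)) = m" "dim_col (minv (Res P)) = m" "dim_row (Res P) = m" "dim_col (Res P) = m"
      using Ri(1) R by (auto simp: sym_pos_def_def)
    show "dim_row U1 = n1" "dim_col U1 = r" using U1dims U1(2) by auto
  qed (use Wt X2Z2 X2Y2 Qt Qi Ri(2) in \<open>simp_all add: K22_sym dims n_edge_def U E\<close>)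
qed

section \<open>Passivity of the perturbed system\<close>

theorem mainTheorem7:
  fixes P :: fem_problem
    and T :: real
    and m n1 n2 k2 s r l q :: nat
    and Yhat Y Q Z Zhat Y2 Z2 W U1 U Uf S E B C Al :: "real mat"
    and u_snap a_snap i_snap :: "real \<Rightarrow> real vec"
    and ts :: "nat \<Rightarrow> real"
    and \<kappa> :: "nat \<Rightarrow> nat"
    and A :: "real vec \<Rightarrow> real mat"
    and f1hat :: "real vec \<Rightarrow> real vec"
    and fPOD fDEIM :: "real vec \<Rightarrow> real vec"
    and x0 :: "real vec"
    and \<delta> :: "(real \<Rightarrow> real vec) \<Rightarrow> real \<Rightarrow> real"
  assumes T: "0 < T"
    and problem: "geometry_ok P" "material_ok P" "windings_ok P" "mesh_ok P"
    and dims: "m = n_wind P" "n1 = n_one P" "n2 = n_two P"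
    and K_factor: "\<And>a. a \<in> carrier_vec (n_edge P) \<Longrightarrow>
          Kmat P a = (Cd P)\<^sup>T * M_nu P (Cd P *\<^sub>v a) * Cd P"
    and M_nu_spd: "\<And>a. a \<in> carrier_vec (n_edge P) \<Longrightarrow>
          sym_pos_def (n_face P) (M_nu P (Cd P *\<^sub>v a))"
    and X_factor: "Xmat P = (Cd P)\<^sup>T * Upsilon P"
    and M11_spd: "sym_pos_def n1 (M11 P)"
    and X2_rank: "vec_space.rank n2 (X2 P) = m"
    and k2: "k2 = kernel_dim (C2 P)"
    and Yhat: "Yhat \<in> carrier_mat n2 (n2 - k2)" "columns_basis Yhat (mat_image ((C2 P)\<^sup>T))"
    and Y: "Y \<in> carrier_mat (n2 - k2) s" "columns_basis Y (mat_kernel ((X2 P)\<^sup>T * Yhat))"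
           "orthonormal_columns Y"
    and Q: "is_pd_sqrt ((X2 P)\<^sup>T * Yhat * Yhat\<^sup>T * X2 P) Q"
    and Z: "Z = Yhat\<^sup>T * X2 P * minv Q"
    and Zhat: "Zhat = Yhat\<^sup>T * X2 P * minv ((X2 P)\<^sup>T * Yhat * Yhat\<^sup>T * X2 P)"
    and Y2: "Y2 = Yhat * Y"
    and Z2: "Z2 = Yhat * Z"
    and W: "W = minv (Y2\<^sup>T * K22 P * Y2)"
    and snapshots: "semidiscrete_solution T P u_snap a_snap i_snap" "\<And>k. k < q \<Longrightarrow> ts k \<in> {0..T}"
    and U1: "leading_left_singular_vectors (mat n1 q (\<lambda>(i, k). a_snap (ts k) $ i)) r U1"
    and U: "U = four_block_mat U1 (0\<^sub>m n1 m)
                  (- (Y2 * W * Y2\<^sup>T * K21 P * U1)) ((1\<^sub>m n2 - Y2 * W * Y2\<^sup>T * K22 P) * Z2)"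
    and E: "E = four_block_mat (U1\<^sup>T * M11 P * U1) (0\<^sub>m r m) (0\<^sub>m m r) (0\<^sub>m m m)
                + U\<^sup>T * Xmat P * minv (Res P) * (Xmat P)\<^sup>T * U"
    and A: "\<And>x. A x = - (U\<^sup>T * Kmat P (U *\<^sub>v x) * U)"
    and B: "B = U\<^sup>T * Xmat P * minv (Res P)"
    and C: "C = Zhat\<^sup>T * Yhat\<^sup>T * (1\<^sub>m n2 - K22 P * Y2 * W * Y2\<^sup>T)
                * (K21 P * U1 @\<^sub>c K22 P * Z2)"
    and fPOD: "\<And>x. fPOD x = A x *\<^sub>v x"
    and Al: "Al = - (U\<^sup>T * four_block_mat (K11l P) (K12 P) (K21 P) (K22 P) * U)"
    and Uf: "leading_left_singular_vectors
               (mat n1 q (\<lambda>(i, k). f1 P (vec_first (a_snap (ts k)) n1) $ i)) l Uf"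
    and DEIM: "greedy_deim Uf \<kappa>" "S = selector n1 l \<kappa>"
    and f1hat: "\<And>a1. f1hat a1 = U1\<^sup>T * Uf * minv (S\<^sup>T * Uf) * S\<^sup>T *\<^sub>v f1 P (U1 *\<^sub>v a1)"
    and fDEIM: "\<And>x. fDEIM x = Al *\<^sub>v x + (f1hat (vec_first x r) @\<^sub>v 0\<^sub>v m)"
    and x0: "x0 \<in> carrier_vec (r + m)" "E *\<^sub>v x0 = 0\<^sub>v (r + m)"
    and delta: "\<And>u xPOD xDEIM t.
          L2_signal T m u \<Longrightarrow>
          state_solution T (r + m) E fPOD B u xPOD \<Longrightarrow> xPOD 0 = x0 \<Longrightarrow>
          state_solution T (r + m) E fDEIM B u xDEIM \<Longrightarrow> xDEIM 0 = x0 \<Longrightarrow>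
          t \<in> {0..T} \<Longrightarrow>
          \<delta> u t \<ge> (if enorm (u t) \<noteq> 0
                    then spectral_norm C * enorm (xPOD t - xDEIM t) / enorm (u t) else 0)"
  shows "input_output_passive T (r + m) m E fDEIM B
           (\<lambda>u x t. C *\<^sub>v x t + \<delta> u t \<cdot>\<^sub>v u t)"
  unfolding input_output_passive_def
proof (intro allI impI ballI, elim conjE)
  fix u x t
  assume u: "L2_signal T m u" and sol: "state_solution T (r + m) E fDEIM B u x"
    and init: "E *\<^sub>v x 0 = 0\<^sub>v (r + m)"
    and out: "L2_signal T m (\<lambda>t. C *\<^sub>v x t + \<delta> u t \<cdot>\<^sub>v u t)" and t: "t \<in> {0..T}"
  have ne: "n_edge P = n1 + n2" by (simp add: n_edge_def dims)
  interpret pm: projected_mqs n1 n2 r s m U1 Y2 Z2 W "K21 P" "K22 P" "X2 P" "Xmat P" "M11 P"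
           "Res P" "minv (Res P)" Q "minv Q" U E C
    by (rule projected_mqs_fem[OF problem(1,3,4) dims K_factor M_nu_spd M11_spd Yhat Y(1,2) Q Z Zhat Y2 Z2 W U1 _ U E C])
      simp_all
  obtain L N0 where form: "reluctivity_form (Om P) (nu P) (energy_density P) (face_fun P) L N0"
    by (rule reluctivity_form_faces[OF problem(1,2)])
  interpret rf: reluctivity_form "Om P" "nu P" "energy_density P" "face_fun P" "n_face P" L N0
    by (rule form)
  have E_carrier: "E \<in> carrier_mat (r + m) (r + m)" by (rule carrier_matI) simp_all
  have Ei: "minv E \<in> carrier_mat (r + m) (r + m)" "E * minv E = 1\<^sub>m (r + m)"
    using minv_inverse(1,2)[OF E_carrier] pm.E_inj by auto
  define D where "D = Cd P * U"
  have Ddims: "dim_row D = n_face P" "dim_col D = r + m" by (simp_all add: D_def)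
  have Bdims: "dim_row B = r + m" "dim_col B = m" by (simp_all add: B)
  define force where "force = (\<lambda>v. vec (n_face P) (rf.flux (\<lambda>j. (D *\<^sub>v v) $ j)))"
  have force_dim: "dim_vec (force v) = n_face P" for v by (simp add: force_def)
  have K_eq: "Kmat P (U *\<^sub>v v) *\<^sub>v (U *\<^sub>v v) = (Cd P)\<^sup>T *\<^sub>v force v" if v: "dim_vec v = r + m" for v
  proof -
    define b where "b = Cd P *\<^sub>v (U *\<^sub>v v)"
    have b: "dim_vec b = n_face P" by (simp add: b_def)
    have bD: "D *\<^sub>v v = b" using v by (simp add: D_def b_def mult_mat_vec_assoc_dim ne)
    have "M_nu P b *\<^sub>v b = force v"
    proof (rule eq_vecI)
      fix k assume "k < dim_vec (force v)"
      then have k: "k < n_face P" by (simp add: force_dim)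
      have "(M_nu P b *\<^sub>v b) $ k = (\<Sum>l<n_face P. M_nu P b $$ (k, l) * b $ l)"
        using k b by (simp add: scalar_prod_def lessThan_atLeast0)
      also have "\<dots> = rf.flux (\<lambda>j. b $ j) k"
        using rf.flux_sum[OF k, of "\<lambda>j. b $ j"] k by (simp add: M_nu_def rf.field_def)
      finally show "(M_nu P b *\<^sub>v b) $ k = force v $ k" using k by (simp add: force_def bD)
    qed (simp add: force_dim)
    moreover have "U *\<^sub>v v \<in> carrier_vec (n_edge P)" by (rule carrier_vecI) (simp add: ne)
    note K_factor[OF this]
    ultimately show ?thesis
      by (simp add: mult_mat_vec_assoc_dim ne b flip: b_def)
  qed
  have fPOD_eq: "fPOD v = - (U\<^sup>T *\<^sub>v ((Cd P)\<^sup>T *\<^sub>v force v))" if v: "dim_vec v = r + m" for v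
    unfolding fPOD A K_eq[OF v, symmetric] using v by (simp add: mat_vec_simps ne)
  have fPOD_D: "fPOD v = - (D\<^sup>T *\<^sub>v vec (n_face P) (rf.flux (\<lambda>j. (D *\<^sub>v v) $ j)))" if v: "dim_vec v = r + m" for v
    unfolding fPOD_eq[OF v]
    using v by (simp add: force_def D_def transpose_mult_dim mult_mat_vec_assoc_dim ne)
  have balance: "(D *\<^sub>v h) \<bullet> vec (n_face P) (rf.flux (\<lambda>j. (D *\<^sub>v v) $ j)) \<le> w \<bullet> (C *\<^sub>v v)"
    if v: "dim_vec v = r + m" and h: "dim_vec h = r + m" and w: "dim_vec w = m" and ode: "E *\<^sub>v h = fPOD v + B *\<^sub>v w"
    for v h w
  proof -
    obtain a1 a2 where a: "U *\<^sub>v v = a1 @\<^sub>v a2" "dim_vec a1 = n1" "dim_vec a2 = n2"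
      using append_vec_split[of "U *\<^sub>v v" n1 n2] by (metis dim_mult_mat_vec pm.U_dim(1))
    have "(U *\<^sub>v h) \<bullet> ((Cd P)\<^sup>T *\<^sub>v force v) \<le> w \<bullet> (C *\<^sub>v v)"
    proof (rule pm.reduced_power_balance[OF v h w _ a])
      show "(0\<^sub>v n1 @\<^sub>v z) \<bullet> ((Cd P)\<^sup>T *\<^sub>v force v) = z \<bullet> (K21 P *\<^sub>v a1 + K22 P *\<^sub>v a2)" if "dim_vec z = n2" for z
        unfolding K_eq[OF v, symmetric] a(1)
        using Kmat_lower_rows[OF problem(4,1), of z a1 a2] that a(2,3) by (simp add: dims)
      show "E *\<^sub>v h = - (U\<^sup>T *\<^sub>v ((Cd P)\<^sup>T *\<^sub>v force v)) + U\<^sup>T * Xmat P * minv (Res P) *\<^sub>v w"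
        by (simp only: ode fPOD_eq[OF v] B)
    qed (simp add: ne)
    also have "(U *\<^sub>v h) \<bullet> ((Cd P)\<^sup>T *\<^sub>v force v) = (D *\<^sub>v h) \<bullet> force v"
      using h by (subst scalar_prod_mult_mat_vec) (simp_all add: ne force_dim D_def mult_mat_vec_assoc_dim)
    finally show ?thesis by (simp add: force_def)
  qed
  obtain xP where solP: "state_solution T (r + m) E fPOD B u xP" and xP0: "xP 0 = 0\<^sub>v (r + m)"
    and xP_passive: "\<And>t. t \<in> {0..T} \<Longrightarrow> 0 \<le> integral {0..t} (\<lambda>s. u s \<bullet> (C *\<^sub>v xP s))"
  proof (rule rf.passive_solution[where D = D and E = E and Ei = "minv E" and B = B and C = C and f = fPOD and u = u])
    show "fPOD v = - (D\<^sup>T *\<^sub>v vec (n_face P) (rf.flux (\<lambda>j. (D *\<^sub>v v) $ j)))" if "dim_vec v = r + m" for v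
      by (rule fPOD_D[OF that])
    show "(D *\<^sub>v h) \<bullet> vec (n_face P) (rf.flux (\<lambda>j. (D *\<^sub>v v) $ j)) \<le> w \<bullet> (C *\<^sub>v v)"
      if "dim_vec v = r + m" "dim_vec h = r + m" "dim_vec w = m" "E *\<^sub>v h = fPOD v + B *\<^sub>v w" for v h w
      by (rule balance[OF that])
    show "0 \<le> T" using T by simp
    show "E * minv E = 1\<^sub>m (r + m)" by (rule Ei(2))
    show "L2_signal T m u" by (rule u)
  qed ((use Ei(1) Ddims Bdims in simp; fail) | (rule that; assumption))+
  have x_dim: "dim_vec (x s) = r + m" and xP_dim: "dim_vec (xP s) = r + m" and u_dim: "dim_vec (u s) = m"
    if "s \<in> {0..T}" for s
    using sol solP u that by (auto simp: state_solution_def continuous_signal_def L2_signal_def)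
  \<comment> \<open>the state error is taken for trajectories starting in \<open>x0\<close>, while passivity only prescribes
    \<open>E x(0) = 0\<close>; both initial values are 0\<close>
  have zero: "x 0 = 0\<^sub>v (r + m)" "x0 = 0\<^sub>v (r + m)"
    using pm.E_inj[OF x_dim init] pm.E_inj[of x0] x0 T by auto
  \<comment> \<open>the damping \<open>\<delta>\<close> absorbs the output error at every instant\<close>
  have pointwise: "u s \<bullet> (C *\<^sub>v xP s) \<le> u s \<bullet> (C *\<^sub>v x s + \<delta> u s \<cdot>\<^sub>v u s)" if s: "s \<in> {0..T}" for s
  proof (cases "enorm (u s) = 0")
    case True
    then have "u s = 0\<^sub>v m" using enorm_eq_0[of "u s"] u_dim[OF s] by simp
    then show ?thesis using x_dim[OF s] by (simp add: one_zero_mult_vec_dim)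
  next
    case False
    then have pos: "enorm (u s) > 0" using enorm_nonneg[of "u s"] by simp
    let ?e = "xP s - x s"
    have "\<delta> u s \<ge> spectral_norm C * enorm ?e / enorm (u s)"
      using delta[OF u solP _ sol _ s] xP0 zero False by simp
    then have d: "spectral_norm C * enorm ?e \<le> \<delta> u s * enorm (u s)"
      using pos by (simp add: field_simps)
    have "u s \<bullet> (C *\<^sub>v ?e) \<le> enorm (u s) * enorm (C *\<^sub>v ?e)"
      using abs_scalar_prod_le[of "u s" "C *\<^sub>v ?e"] u_dim[OF s] by simp
    also have "\<dots> \<le> enorm (u s) * (spectral_norm C * enorm ?e)"
      using x_dim[OF s] xP_dim[OF s] pos
      by (intro mult_left_mono enorm_mult_mat_vec_le) (auto intro: carrier_vecI)
    also have "\<dots> \<le> enorm (u s) * (\<delta> u s * enorm (u s))"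
      using d pos by (intro mult_left_mono) auto
    also have "\<dots> = \<delta> u s * (u s \<bullet> u s)"
      using scalar_prod_self_nonneg[of "u s"] by (simp add: enorm_def)
    finally have "u s \<bullet> (C *\<^sub>v xP s) - u s \<bullet> (C *\<^sub>v x s) \<le> \<delta> u s * (u s \<bullet> u s)"
      using x_dim[OF s] xP_dim[OF s] by (simp add: mat_vec_simps)
    moreover have "u s \<bullet> (C *\<^sub>v x s + \<delta> u s \<cdot>\<^sub>v u s) = u s \<bullet> (C *\<^sub>v x s) + \<delta> u s * (u s \<bullet> u s)"
      using u_dim[OF s] by (simp add: scalar_prod_distrib_dim)
    ultimately show ?thesis by simp
  qed
  have sub: "{0..t} \<subseteq> {0..T}" using t by auto
  have "(\<lambda>s. u s \<bullet> (C *\<^sub>v x s + \<delta> u s \<cdot>\<^sub>v u s)) absolutely_integrable_on {0..T}"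
    by (rule L2_signal_scalar_prod[OF u out])
  then have ai: "(\<lambda>s. u s \<bullet> (C *\<^sub>v x s + \<delta> u s \<cdot>\<^sub>v u s)) absolutely_integrable_on {0..t}"
    by (rule set_integrable_subset) (use sub in auto)
  have "continuous_on {0..T} (\<lambda>s. (C *\<^sub>v xP s) $ i)" if i: "i < m" for i
  proof -
    have "continuous_on {0..T} (\<lambda>s. \<Sum>j = 0..<r + m. C $$ (i, j) * xP s $ j)"
      using solP by (intro continuous_intros) (auto simp: state_solution_def continuous_signal_def)
    then show ?thesis
      by (rule continuous_on_eq) (use i xP_dim in \<open>simp add: scalar_prod_def\<close>)
  qed
  then have "(\<lambda>s. u s \<bullet> (C *\<^sub>v xP s)) absolutely_integrable_on {0..T}"
    by (intro integrable_signal_scalar_prod_continuous[OF L2_signal_integrable[OF u]]) auto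
  then have "(\<lambda>s. u s \<bullet> (C *\<^sub>v xP s)) integrable_on {0..T}"
    by (simp add: absolutely_integrable_on_def)
  then have Pi: "(\<lambda>s. u s \<bullet> (C *\<^sub>v xP s)) integrable_on {0..t}"
    using sub by (rule integrable_subinterval_real)
  have "0 \<le> integral {0..t} (\<lambda>s. u s \<bullet> (C *\<^sub>v xP s))" by (rule xP_passive[OF t])
  also have "\<dots> \<le> integral {0..t} (\<lambda>s. u s \<bullet> (C *\<^sub>v x s + \<delta> u s \<cdot>\<^sub>v u s))"
    using ai sub by (intro integral_le Pi pointwise) (auto simp: absolutely_integrable_on_def)
  also have "\<dots> = (LINT \<tau>:{0..t}|lebesgue. u \<tau> \<bullet> (C *\<^sub>v x \<tau> + \<delta> u \<tau> \<cdot>\<^sub>v u \<tau>))"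
    by (rule set_lebesgue_integral_eq_integral(2)[OF ai, symmetric])
  finally show "0 \<le> (LINT \<tau>:{0..t}|lebesgue. u \<tau> \<bullet> (C *\<^sub>v x \<tau> + \<delta> u \<tau> \<cdot>\<^sub>v u \<tau>))" .
qed

end
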